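(* Suppose $X$ is a compact, connected Hausdorff space and the discrete group $\Gamma$ acts on $X$ by homeomorphisms. Put $C=C(X)\rtimes_r\Gamma$ and $D=C(X)\subseteq C$, and let $D^c$ be the relative commutant of $D$ in $C$. The following statements are equivalent. (a) $(C,D^c)$ is a Cartan inclusion. (b) There is an abelian subgroup $N\subseteq\Gamma$ such that for $s\in\Gamma$, $(\operatorname{fix}s)^\circ=X$ if $s\in N$ and $(\operatorname{fix}s)^\circ=\emptyset$ if $s\notin N$. (c) There is an abelian subgroup $N$ of $\Gamma$ such that the action of $N$ on $X$ is trivial and $D^c=C(X)\rtimes_r N\simeq C(X)\otimes C^*(N)$. (d) $D^c$ is abelian and there is a conditional expectation $\Delta\colon C\to D^c$ (not assumed faithful). When this occurs, $N$ is a normal subgroup of $\Gamma$.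
   Context: $C(X)\rtimes_r\Gamma$ is the reduced crossed product, with $C(X)$ and the canonical unitaries $w_s$ ($s\in\Gamma$) embedded in it, $w_sfw_s^*=f(s^{-1}\,\cdot)$ for $f\in C(X)$. For a subgroup $N\subseteq\Gamma$, $C(X)\rtimes_rN$ is identified with the closed linear span of $\{fw_s:f\in C(X),s\in N\}$ in $C(X)\rtimes_r\Gamma$. For $s\in\Gamma$, $\operatorname{fix}s=\{x\in X:sx=x\}$, and $(\operatorname{fix}s)^\circ$ is its interior. An inclusion $(A,B)$ of $C^*$-algebras is a $C^*$-algebra $A$ with a $C^*$-subalgebra $B$ containing an approximate unit for $A$; it is regular if $\{n\in A: nBn^*\subseteq B,\ n^*Bn\subseteq B\}$ has dense span in $A$. A Cartan inclusion is a regular inclusion $(A,B)$ with $B$ maximal abelian in $A$ and with a faithful conditional expectation $A\to B$. *)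

theory Defs
  imports "HOL-Analysis.Analysis" "HOL-Algebra.Group_Action"
begin

section \<open>C*-algebras\<close>

class scaleC = scaleR +
  fixes scaleC :: "complex \<Rightarrow> 'a \<Rightarrow> 'a"  (infixr "*\<^sub>C" 75)
  assumes scaleR_scaleC: "scaleR r = scaleC (complex_of_real r)"

class cstar_algebra = real_normed_algebra + banach + scaleC +
  fixes star :: "'a \<Rightarrow> 'a"
  assumes scaleC_add_right: "c *\<^sub>C (a + b) = c *\<^sub>C a + c *\<^sub>C b"
    and scaleC_add_left: "(c + d) *\<^sub>C a = c *\<^sub>C a + d *\<^sub>C a"
    and scaleC_scaleC: "c *\<^sub>C d *\<^sub>C a = (c * d) *\<^sub>C a"
    and scaleC_one: "1 *\<^sub>C a = a"
    and mult_scaleC_left: "(c *\<^sub>C a) * b = c *\<^sub>C (a * b)"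
    and mult_scaleC_right: "a * (c *\<^sub>C b) = c *\<^sub>C (a * b)"
    and norm_scaleC: "norm (c *\<^sub>C a) = cmod c * norm a"
    and star_add: "star (a + b) = star a + star b"
    and star_scaleC: "star (c *\<^sub>C a) = cnj c *\<^sub>C star a"
    and star_mult: "star (a * b) = star b * star a"
    and star_star: "star (star a) = a"
    and cstar_identity: "norm (star a * a) = (norm a)\<^sup>2"


section \<open>The Hilbert space of square summable families\<close>

typedef 'i ell2 = "{f :: 'i \<Rightarrow> complex. (\<lambda>i. (cmod (f i))\<^sup>2) summable_on UNIV}"
  by (rule exI[of _ "\<lambda>_. 0"]) simp

setup_lifting type_definition_ell2

lemma infsum_complex_of_real:
  assumes "f summable_on A"
  shows "(\<Sum>\<^sub>\<infinity>i\<in>A. complex_of_real (f i)) = complex_of_real (\<Sum>\<^sub>\<infinity>i\<in>A. f i)"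
  using has_sum_of_real[OF has_sum_infsum[OF assms]] by (rule infsumI)

lemma ell2_add_summable:
  fixes f g :: "'i \<Rightarrow> complex"
  assumes "(\<lambda>i. (cmod (f i))\<^sup>2) summable_on UNIV" "(\<lambda>i. (cmod (g i))\<^sup>2) summable_on UNIV"
  shows "(\<lambda>i. (cmod (f i + g i))\<^sup>2) summable_on UNIV"
proof (rule summable_on_comparison_test)
  show "(\<lambda>i. 2 * (cmod (f i))\<^sup>2 + 2 * (cmod (g i))\<^sup>2) summable_on UNIV"
    by (intro summable_on_add summable_on_cmult_right assms)
  fix i
  have "(cmod (f i + g i))\<^sup>2 \<le> (cmod (f i) + cmod (g i))\<^sup>2"
    by (intro power_mono norm_triangle_ineq norm_ge_zero)
  also have "\<dots> \<le> 2 * (cmod (f i))\<^sup>2 + 2 * (cmod (g i))\<^sup>2"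
    using sum_squares_bound[of "cmod (f i)" "cmod (g i)"] by (simp add: power2_sum)
  finally show "(cmod (f i + g i))\<^sup>2 \<le> 2 * (cmod (f i))\<^sup>2 + 2 * (cmod (g i))\<^sup>2" .
qed auto

lemma ell2_scale_summable:
  fixes f :: "'i \<Rightarrow> complex"
  assumes "(\<lambda>i. (cmod (f i))\<^sup>2) summable_on UNIV"
  shows "(\<lambda>i. (cmod (c * f i))\<^sup>2) summable_on UNIV"
  using summable_on_cmult_right[OF assms, of "(cmod c)\<^sup>2"]
  by (simp add: norm_mult power_mult_distrib)

lemma ell2_prod_summable:
  fixes f g :: "'i \<Rightarrow> complex"
  assumes "(\<lambda>i. (cmod (f i))\<^sup>2) summable_on UNIV" "(\<lambda>i. (cmod (g i))\<^sup>2) summable_on UNIV"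
  shows "(\<lambda>i. cnj (f i) * g i) summable_on UNIV"
proof (rule abs_summable_summable, rule summable_on_comparison_test)
  show "(\<lambda>i. (cmod (f i))\<^sup>2 + (cmod (g i))\<^sup>2) summable_on UNIV"
    by (intro summable_on_add assms)
  fix i
  have "2 * (cmod (f i) * cmod (g i)) \<le> (cmod (f i))\<^sup>2 + (cmod (g i))\<^sup>2"
    using sum_squares_bound[of "cmod (f i)" "cmod (g i)"] by simp
  moreover have "0 \<le> cmod (f i) * cmod (g i)" by simp
  ultimately have "cmod (f i) * cmod (g i) \<le> (cmod (f i))\<^sup>2 + (cmod (g i))\<^sup>2" by linarith
  then show "norm (cnj (f i) * g i) \<le> (cmod (f i))\<^sup>2 + (cmod (g i))\<^sup>2"
    by (simp add: norm_mult)
qed auto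

text \<open>The inner product is conjugate-linear in the first argument.\<close>

lift_definition cinner :: "'i ell2 \<Rightarrow> 'i ell2 \<Rightarrow> complex"
  is "\<lambda>f g. \<Sum>\<^sub>\<infinity>i. cnj (f i) * g i" .

instantiation ell2 :: (type) real_inner
begin

lift_definition zero_ell2 :: "'a ell2" is "\<lambda>_. 0" by simp
lift_definition plus_ell2 :: "'a ell2 \<Rightarrow> 'a ell2 \<Rightarrow> 'a ell2" is "\<lambda>f g i. f i + g i"
  by (rule ell2_add_summable)
lift_definition uminus_ell2 :: "'a ell2 \<Rightarrow> 'a ell2" is "\<lambda>f i. - f i" by simp
lift_definition minus_ell2 :: "'a ell2 \<Rightarrow> 'a ell2 \<Rightarrow> 'a ell2" is "\<lambda>f g i. f i - g i"
  using ell2_add_summable[of _ "\<lambda>i. - _ i"] by simp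
lift_definition scaleR_ell2 :: "real \<Rightarrow> 'a ell2 \<Rightarrow> 'a ell2" is "\<lambda>r f i. complex_of_real r * f i"
  by (rule ell2_scale_summable)

definition inner_ell2 :: "'a ell2 \<Rightarrow> 'a ell2 \<Rightarrow> real"
  where "inner_ell2 \<xi> \<eta> = Re (cinner \<xi> \<eta>)"
definition norm_ell2 :: "'a ell2 \<Rightarrow> real"
  where "norm_ell2 \<xi> = sqrt (inner \<xi> \<xi>)"
definition sgn_ell2 :: "'a ell2 \<Rightarrow> 'a ell2"
  where "sgn_ell2 \<xi> = inverse (norm \<xi>) *\<^sub>R \<xi>"
definition dist_ell2 :: "'a ell2 \<Rightarrow> 'a ell2 \<Rightarrow> real"
  where "dist_ell2 \<xi> \<eta> = norm (\<xi> - \<eta>)"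
definition uniformity_ell2 :: "('a ell2 \<times> 'a ell2) filter"
  where "uniformity_ell2 = (INF e\<in>{0<..}. principal {(\<xi>, \<eta>). dist \<xi> \<eta> < e})"
definition open_ell2 :: "'a ell2 set \<Rightarrow> bool"
  where "open_ell2 U \<longleftrightarrow> (\<forall>\<xi>\<in>U. \<forall>\<^sub>F (\<xi>', \<eta>) in uniformity. \<xi>' = \<xi> \<longrightarrow> \<eta> \<in> U)"

instance
proof
  fix a b c :: "'a ell2" and r s :: real
  show "a + b + c = a + (b + c)" "a + b = b + a" "0 + a = a" "- a + a = 0" "a - b = a + - b"
    by (transfer; simp add: algebra_simps)+
  show "r *\<^sub>R (a + b) = r *\<^sub>R a + r *\<^sub>R b" "(r + s) *\<^sub>R a = r *\<^sub>R a + s *\<^sub>R a"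
    "r *\<^sub>R s *\<^sub>R a = (r * s) *\<^sub>R a" "1 *\<^sub>R a = a"
    by (transfer; simp add: algebra_simps)+
  show "dist a b = norm (a - b)" by (rule dist_ell2_def)
  show "sgn a = inverse (norm a) *\<^sub>R a" by (rule sgn_ell2_def)
  show "uniformity = (INF e\<in>{0<..}. principal {(\<xi>::'a ell2, \<eta>). dist \<xi> \<eta> < e})"
    by (rule uniformity_ell2_def)
  show "open U \<longleftrightarrow> (\<forall>\<xi>\<in>U. \<forall>\<^sub>F (\<xi>', \<eta>) in uniformity. \<xi>' = \<xi> \<longrightarrow> \<eta> \<in> U)" for U :: "'a ell2 set"
    by (rule open_ell2_def)
  show "norm a = sqrt (inner a a)" by (rule norm_ell2_def)
  have "cinner b a = cnj (cinner a b)"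
    by transfer (simp flip: infsum_cnj add: mult.commute)
  then show "inner a b = inner b a" by (simp add: inner_ell2_def)
  have "cinner (a + b) c = cinner a c + cinner b c"
    by transfer (simp add: distrib_right infsum_add ell2_prod_summable)
  then show "inner (a + b) c = inner a c + inner b c" by (simp add: inner_ell2_def)
  have "cinner (r *\<^sub>R a) b = complex_of_real r * cinner a b"
    by transfer (simp add: mult.assoc infsum_cmult_right')
  then show "inner (r *\<^sub>R a) b = r * inner a b" by (simp add: inner_ell2_def)
  have self: "inner a a = (\<Sum>\<^sub>\<infinity>i. (cmod (Rep_ell2 a i))\<^sup>2)"
    unfolding inner_ell2_def
  proof transfer
    fix f :: "'a \<Rightarrow> complex" assume [simp]: "(\<lambda>i. (cmod (f i))\<^sup>2) summable_on UNIV"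
    have "cnj z * z = complex_of_real ((cmod z)\<^sup>2)" for z
      using complex_norm_square[of z] by (simp add: mult.commute)
    then show "Re (\<Sum>\<^sub>\<infinity>i. cnj (f i) * f i) = (\<Sum>\<^sub>\<infinity>i. (cmod (f i))\<^sup>2)"
      by (simp add: infsum_complex_of_real del: of_real_power)
  qed
  show "0 \<le> inner a a" unfolding self by (rule infsum_nonneg) simp
  show "inner a a = 0 \<longleftrightarrow> a = 0"
  proof
    assume "inner a a = 0"
    then have "(cmod (Rep_ell2 a i))\<^sup>2 = 0" for i
      using nonneg_infsum_le_0D[of "\<lambda>i. (cmod (Rep_ell2 a i))\<^sup>2" UNIV i] Rep_ell2[of a]
      unfolding self by simp
    then show "a = 0" by transfer auto
  next
    assume "a = 0"
    moreover have "inner (0::'a ell2) 0 = 0" unfolding inner_ell2_def by transfer simp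
    ultimately show "inner a a = 0" by simp
  qed
qed

end

lemma cinner_commute: "cnj (cinner \<xi> \<eta>) = cinner \<eta> \<xi>"
  by transfer (simp flip: infsum_cnj add: mult.commute)

lemma cinner_add_left: "cinner (\<xi> + \<eta>) \<zeta> = cinner \<xi> \<zeta> + cinner \<eta> \<zeta>"
  by transfer (simp add: distrib_right infsum_add ell2_prod_summable)

lemma cinner_add_right: "cinner \<zeta> (\<xi> + \<eta>) = cinner \<zeta> \<xi> + cinner \<zeta> \<eta>"
  by (metis cinner_add_left cinner_commute complex_cnj_add)

instantiation ell2 :: (type) scaleC
begin
lift_definition scaleC_ell2 :: "complex \<Rightarrow> 'a ell2 \<Rightarrow> 'a ell2" is "\<lambda>c f i. c * f i"
  by (rule ell2_scale_summable)
instance by standard (rule ext, transfer, simp)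
end

lemma cinner_scaleC_left: "cinner (c *\<^sub>C \<xi>) \<eta> = cnj c * cinner \<xi> \<eta>"
  by transfer (simp add: mult.assoc infsum_cmult_right')

lemma cinner_scaleC_right: "cinner \<xi> (c *\<^sub>C \<eta>) = c * cinner \<xi> \<eta>"
  by (metis cinner_scaleC_left cinner_commute complex_cnj_cnj complex_cnj_mult)

lemma cinner_self: "cinner \<xi> \<xi> = complex_of_real ((norm \<xi>)\<^sup>2)"
proof -
  have "Im (cinner \<xi> \<xi>) = 0" using cinner_commute[of \<xi> \<xi>] by (simp add: complex_eq_iff)
  then show ?thesis by (simp add: complex_eq_iff power2_norm_eq_inner inner_ell2_def)
qed

lemma norm_scaleC_ell2: "norm (c *\<^sub>C (\<xi>::'i ell2)) = cmod c * norm \<xi>"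
proof -
  have "complex_of_real ((norm (c *\<^sub>C \<xi>))\<^sup>2) = complex_of_real ((cmod c * norm \<xi>)\<^sup>2)"
    unfolding cinner_self[symmetric] cinner_scaleC_left cinner_scaleC_right
    by (simp add: cinner_self power_mult_distrib complex_norm_square mult_ac flip: of_real_power)
  then show ?thesis by (simp only: of_real_eq_iff power2_eq_iff_nonneg norm_ge_zero mult_nonneg_nonneg)
qed

lemma cinner_Cauchy_Schwarz: "cmod (cinner \<xi> \<eta>) \<le> norm \<xi> * norm \<eta>"
proof (cases "cinner \<xi> \<eta> = 0")
  case False
  define u where "u = cnj (sgn (cinner \<xi> \<eta>))"
  have u: "cmod u = 1" using False by (simp add: u_def norm_sgn)
  have "cinner \<xi> (u *\<^sub>C \<eta>) = complex_of_real (cmod (cinner \<xi> \<eta>))"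
    using False complex_norm_square[of "cinner \<xi> \<eta>"]
    by (simp add: cinner_scaleC_right u_def sgn_eq power2_eq_square field_simps)
  then have "cmod (cinner \<xi> \<eta>) = inner \<xi> (u *\<^sub>C \<eta>)" by (simp add: inner_ell2_def)
  also have "\<dots> \<le> norm \<xi> * norm (u *\<^sub>C \<eta>)" by (rule norm_cauchy_schwarz)
  finally show ?thesis by (simp add: norm_scaleC_ell2 u)
qed simp

lemma bounded_bilinear_cinner: "bounded_bilinear (cinner :: 'i ell2 \<Rightarrow> _)"
proof
  show "cinner (r *\<^sub>R a) b = r *\<^sub>R cinner a b" for r and a b :: "'i ell2"
    by (simp add: scaleR_scaleC cinner_scaleC_left scaleR_conv_of_real)
  show "cinner a (r *\<^sub>R b) = r *\<^sub>R cinner a b" for r and a b :: "'i ell2"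
    by (simp add: scaleR_scaleC cinner_scaleC_right scaleR_conv_of_real)
  show "\<exists>K. \<forall>a b :: 'i ell2. cmod (cinner a b) \<le> norm a * norm b * K"
    by (rule exI[of _ 1]) (simp add: cinner_Cauchy_Schwarz)
qed (simp_all add: cinner_add_left cinner_add_right)

lemma norm_ell2_sq: "(norm \<xi>)\<^sup>2 = (\<Sum>\<^sub>\<infinity>i. (cmod (Rep_ell2 \<xi> i))\<^sup>2)"
proof -
  have "cnj z * z = complex_of_real ((cmod z)\<^sup>2)" for z
    using complex_norm_square[of z] by (simp add: mult.commute)
  then have "cinner \<xi> \<xi> = complex_of_real (\<Sum>\<^sub>\<infinity>i. (cmod (Rep_ell2 \<xi> i))\<^sup>2)"
    using Rep_ell2[of \<xi>] by (simp add: cinner.rep_eq infsum_complex_of_real del: of_real_power)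
  then show ?thesis by (simp only: cinner_self of_real_eq_iff)
qed

lemma ell2_sum_le: "finite S \<Longrightarrow> (\<Sum>i\<in>S. (cmod (Rep_ell2 \<xi> i))\<^sup>2) \<le> (norm \<xi>)\<^sup>2"
  unfolding norm_ell2_sq using Rep_ell2[of \<xi>] by (intro finite_sum_le_infsum) auto

instance ell2 :: (type) banach
proof
  fix X :: "nat \<Rightarrow> 'a ell2" assume X: "Cauchy X"
  have coord: "cmod (Rep_ell2 \<xi> i) \<le> norm \<xi>" for \<xi> :: "'a ell2" and i
    using ell2_sum_le[of "{i}" \<xi>] by (simp add: power2_le_iff_abs_le)
  have "Cauchy (\<lambda>n. Rep_ell2 (X n) i)" for i
  proof (rule metric_CauchyI)
    fix e :: real assume "e > 0"
    then obtain M where M: "\<And>m n. m \<ge> M \<Longrightarrow> n \<ge> M \<Longrightarrow> norm (X m - X n) < e"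
      using X unfolding Cauchy_iff by blast
    have "dist (Rep_ell2 (X m) i) (Rep_ell2 (X n) i) < e" if "m \<ge> M" "n \<ge> M" for m n
      using coord[of "X m - X n" i] M[OF that] by (simp add: dist_norm minus_ell2.rep_eq)
    then show "\<exists>M. \<forall>m\<ge>M. \<forall>n\<ge>M. dist (Rep_ell2 (X m) i) (Rep_ell2 (X n) i) < e" by blast
  qed
  then have "\<exists>l. (\<lambda>n. Rep_ell2 (X n) i) \<longlonglongrightarrow> l" for i
    by (simp add: Cauchy_convergent_iff convergent_def)
  then obtain f where f: "\<And>i. (\<lambda>n. Rep_ell2 (X n) i) \<longlonglongrightarrow> f i"
    by metis
  have bd: "(\<Sum>i\<in>S. (cmod (Rep_ell2 (X m) i - f i))\<^sup>2) \<le> e\<^sup>2"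
    if "\<And>n. n \<ge> m \<Longrightarrow> norm (X m - X n) < e" "finite S" for m S e
  proof (rule LIMSEQ_le_const2)
    show "(\<lambda>n. \<Sum>i\<in>S. (cmod (Rep_ell2 (X m) i - Rep_ell2 (X n) i))\<^sup>2) \<longlonglongrightarrow>
        (\<Sum>i\<in>S. (cmod (Rep_ell2 (X m) i - f i))\<^sup>2)"
      by (intro tendsto_intros f)
    have "(\<Sum>i\<in>S. (cmod (Rep_ell2 (X m) i - Rep_ell2 (X n) i))\<^sup>2) \<le> e\<^sup>2" if "n \<ge> m" for n
    proof -
      have "(norm (X m - X n))\<^sup>2 \<le> e\<^sup>2" 
        using \<open>\<And>n. n \<ge> m \<Longrightarrow> norm (X m - X n) < e\<close>[OF that] by (intro power_mono) auto
      then show ?thesis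
        using ell2_sum_le[OF \<open>finite S\<close>, of "X m - X n"] by (simp add: minus_ell2.rep_eq)
    qed
    then show "\<exists>N. \<forall>n\<ge>N. (\<Sum>i\<in>S. (cmod (Rep_ell2 (X m) i - Rep_ell2 (X n) i))\<^sup>2) \<le> e\<^sup>2" by blast
  qed
  have tail: "(\<lambda>i. (cmod (Rep_ell2 (X m) i - f i))\<^sup>2) summable_on UNIV"
    if "\<And>n. n \<ge> m \<Longrightarrow> norm (X m - X n) < e" for m e
    by (rule nonneg_bdd_above_summable_on) (auto intro!: bdd_aboveI2[of _ _ "e\<^sup>2"] bd[OF that])
  obtain M1 where M1: "\<And>n. n \<ge> M1 \<Longrightarrow> norm (X M1 - X n) < 1"
    using X unfolding Cauchy_iff by (metis zero_less_one order_refl)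
  have "(\<lambda>i. (cmod (Rep_ell2 (X M1) i + - (Rep_ell2 (X M1) i - f i)))\<^sup>2) summable_on UNIV"
    using tail[OF M1] Rep_ell2[of "X M1"]
    by (intro ell2_add_summable) (simp_all add: norm_minus_commute)
  then have fs: "(\<lambda>i. (cmod (f i))\<^sup>2) summable_on UNIV" by simp
  define L where "L = Abs_ell2 f"
  have L: "Rep_ell2 L = f" using fs by (simp add: L_def Abs_ell2_inverse)
  have "X \<longlonglongrightarrow> L"
  proof (rule LIMSEQ_I)
    fix e :: real assume "e > 0"
    then obtain M where M: "\<And>m n. m \<ge> M \<Longrightarrow> n \<ge> M \<Longrightarrow> norm (X m - X n) < e / 2"
      using X unfolding Cauchy_iff by (meson half_gt_zero)
    have "norm (X m - L) < e" if "m \<ge> M" for m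
    proof -
      have m: "\<And>n. n \<ge> m \<Longrightarrow> norm (X m - X n) < e / 2" using M that by simp
      have "(norm (X m - L))\<^sup>2 \<le> (e / 2)\<^sup>2"
        unfolding norm_ell2_sq minus_ell2.rep_eq L
        by (rule infsum_le_finite_sums[OF tail[OF m]]) (use bd[OF m] in auto)
      then have "norm (X m - L) \<le> e / 2" using \<open>e > 0\<close> by (auto intro: power2_le_imp_le)
      then show ?thesis using \<open>e > 0\<close> by simp
    qed
    then show "\<exists>M. \<forall>m\<ge>M. norm (X m - L) < e" by blast
  qed
  then show "convergent X" by (auto simp: convergent_def)
qed



lemma scaleC_ell2_simps:
  fixes \<xi> \<eta> :: "'i ell2"
  shows "c *\<^sub>C (\<xi> + \<eta>) = c *\<^sub>C \<xi> + c *\<^sub>C \<eta>" "(c + d) *\<^sub>C \<xi> = c *\<^sub>C \<xi> + d *\<^sub>C \<xi>"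
    "c *\<^sub>C d *\<^sub>C \<xi> = (c * d) *\<^sub>C \<xi>" "1 *\<^sub>C \<xi> = \<xi>" "c *\<^sub>C r *\<^sub>R \<xi> = r *\<^sub>R c *\<^sub>C \<xi>"
  by (transfer; simp add: algebra_simps)+

lifting_forget ell2.lifting


section \<open>Bounded operators on it\<close>

text \<open>The library type \<open>\<Rightarrow>\<^sub>L\<close> consists of real-linear operators. A bounded real-linear operator on
  a complex Hilbert space has an adjoint for the complex inner product if and only if it is
  complex-linear.\<close>

typedef 'i bop = "{a :: 'i ell2 \<Rightarrow>\<^sub>L 'i ell2. \<exists>b :: 'i ell2 \<Rightarrow>\<^sub>L 'i ell2.
    \<forall>\<xi> \<eta>. cinner (a \<xi>) \<eta> = cinner \<xi> (b \<eta>)}"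
  by (rule exI[of _ 0]) (auto intro!: exI[of _ 0] simp: bounded_bilinear.zero_left[OF bounded_bilinear_cinner]
    bounded_bilinear.zero_right[OF bounded_bilinear_cinner])

setup_lifting type_definition_bop

lift_definition bop_apply :: "'i bop \<Rightarrow> 'i ell2 \<Rightarrow> 'i ell2" (infixr "\<cdot>" 75)
  is blinfun_apply .

lemmas cinner_simps = cinner_add_left cinner_add_right cinner_scaleC_left cinner_scaleC_right
  bounded_bilinear.zero_left[OF bounded_bilinear_cinner]
  bounded_bilinear.zero_right[OF bounded_bilinear_cinner]
  bounded_bilinear.minus_left[OF bounded_bilinear_cinner]
  bounded_bilinear.minus_right[OF bounded_bilinear_cinner]
  bounded_bilinear.diff_left[OF bounded_bilinear_cinner]
  bounded_bilinear.diff_right[OF bounded_bilinear_cinner]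

lemma cinner_eqI: "(\<And>\<zeta>. cinner \<zeta> \<xi> = cinner \<zeta> \<eta>) \<Longrightarrow> \<xi> = \<eta>"
  using cinner_self[of "\<xi> - \<eta>"] by (simp add: cinner_simps)

lemma bop_eqI: "(\<And>\<xi>. a \<cdot> \<xi> = b \<cdot> \<xi>) \<Longrightarrow> a = b"
  by transfer (rule blinfun_eqI)

lemma bounded_linear_scaleC_ell2: "bounded_linear (\<lambda>\<xi> :: 'i ell2. c *\<^sub>C \<xi>)"
  by (rule bounded_linear_intro[of _ "cmod c"])
    (simp_all add: scaleC_ell2_simps(1,5) norm_scaleC_ell2 mult.commute)

instantiation bop :: (type) real_normed_algebra
begin

lift_definition zero_bop :: "'a bop" is 0
  by (auto intro!: exI[of _ 0] simp: cinner_simps)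
lift_definition plus_bop :: "'a bop \<Rightarrow> 'a bop \<Rightarrow> 'a bop" is plus
proof -
  fix a1 a2 :: "'a ell2 \<Rightarrow>\<^sub>L 'a ell2"
  assume "\<exists>b :: 'a ell2 \<Rightarrow>\<^sub>L 'a ell2. \<forall>\<xi> \<eta>. cinner (a1 \<xi>) \<eta> = cinner \<xi> (b \<eta>)"
    "\<exists>b :: 'a ell2 \<Rightarrow>\<^sub>L 'a ell2. \<forall>\<xi> \<eta>. cinner (a2 \<xi>) \<eta> = cinner \<xi> (b \<eta>)"
  then obtain b1 b2 :: "'a ell2 \<Rightarrow>\<^sub>L 'a ell2" where
    "\<forall>\<xi> \<eta>. cinner (a1 \<xi>) \<eta> = cinner \<xi> (b1 \<eta>)" "\<forall>\<xi> \<eta>. cinner (a2 \<xi>) \<eta> = cinner \<xi> (b2 \<eta>)" by blast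
  then show "\<exists>b :: 'a ell2 \<Rightarrow>\<^sub>L 'a ell2. \<forall>\<xi> \<eta>. cinner ((a1 + a2) \<xi>) \<eta> = cinner \<xi> (b \<eta>)"
    by (intro exI[of _ "b1 + b2"]) (simp add: blinfun.add_left cinner_simps)
qed
lift_definition uminus_bop :: "'a bop \<Rightarrow> 'a bop" is uminus
proof -
  fix a :: "'a ell2 \<Rightarrow>\<^sub>L 'a ell2"
  assume "\<exists>b :: 'a ell2 \<Rightarrow>\<^sub>L 'a ell2. \<forall>\<xi> \<eta>. cinner (a \<xi>) \<eta> = cinner \<xi> (b \<eta>)"
  then obtain b :: "'a ell2 \<Rightarrow>\<^sub>L 'a ell2" where "\<forall>\<xi> \<eta>. cinner (a \<xi>) \<eta> = cinner \<xi> (b \<eta>)" by blast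
  then show "\<exists>b :: 'a ell2 \<Rightarrow>\<^sub>L 'a ell2. \<forall>\<xi> \<eta>. cinner ((- a) \<xi>) \<eta> = cinner \<xi> (b \<eta>)"
    by (intro exI[of _ "- b"]) (simp add: blinfun.minus_left cinner_simps)
qed
definition minus_bop :: "'a bop \<Rightarrow> 'a bop \<Rightarrow> 'a bop" where "minus_bop a b = a + - b"
lift_definition times_bop :: "'a bop \<Rightarrow> 'a bop \<Rightarrow> 'a bop" is "(o\<^sub>L)"
proof -
  fix a1 a2 :: "'a ell2 \<Rightarrow>\<^sub>L 'a ell2"
  assume "\<exists>b :: 'a ell2 \<Rightarrow>\<^sub>L 'a ell2. \<forall>\<xi> \<eta>. cinner (a1 \<xi>) \<eta> = cinner \<xi> (b \<eta>)"
    "\<exists>b :: 'a ell2 \<Rightarrow>\<^sub>L 'a ell2. \<forall>\<xi> \<eta>. cinner (a2 \<xi>) \<eta> = cinner \<xi> (b \<eta>)"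
  then obtain b1 b2 :: "'a ell2 \<Rightarrow>\<^sub>L 'a ell2" where
    "\<forall>\<xi> \<eta>. cinner (a1 \<xi>) \<eta> = cinner \<xi> (b1 \<eta>)" "\<forall>\<xi> \<eta>. cinner (a2 \<xi>) \<eta> = cinner \<xi> (b2 \<eta>)" by blast
  then show "\<exists>b :: 'a ell2 \<Rightarrow>\<^sub>L 'a ell2. \<forall>\<xi> \<eta>. cinner ((a1 o\<^sub>L a2) \<xi>) \<eta> = cinner \<xi> (b \<eta>)"
    by (intro exI[of _ "b2 o\<^sub>L b1"]) simp
qed
lift_definition scaleR_bop :: "real \<Rightarrow> 'a bop \<Rightarrow> 'a bop" is scaleR
proof -
  fix r and a :: "'a ell2 \<Rightarrow>\<^sub>L 'a ell2"
  assume "\<exists>b :: 'a ell2 \<Rightarrow>\<^sub>L 'a ell2. \<forall>\<xi> \<eta>. cinner (a \<xi>) \<eta> = cinner \<xi> (b \<eta>)"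
  then obtain b :: "'a ell2 \<Rightarrow>\<^sub>L 'a ell2" where "\<forall>\<xi> \<eta>. cinner (a \<xi>) \<eta> = cinner \<xi> (b \<eta>)" by blast
  then show "\<exists>b :: 'a ell2 \<Rightarrow>\<^sub>L 'a ell2. \<forall>\<xi> \<eta>. cinner ((r *\<^sub>R a) \<xi>) \<eta> = cinner \<xi> (b \<eta>)"
    by (intro exI[of _ "r *\<^sub>R b"]) (simp add: blinfun.scaleR_left cinner_simps scaleR_scaleC)
qed
lift_definition norm_bop :: "'a bop \<Rightarrow> real" is norm .

definition sgn_bop :: "'a bop \<Rightarrow> 'a bop"
  where "sgn_bop a = inverse (norm a) *\<^sub>R a"
definition dist_bop :: "'a bop \<Rightarrow> 'a bop \<Rightarrow> real"
  where "dist_bop a b = norm (a - b)"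
definition uniformity_bop :: "('a bop \<times> 'a bop) filter"
  where "uniformity_bop = (INF e\<in>{0<..}. principal {(a, b). dist a b < e})"
definition open_bop :: "'a bop set \<Rightarrow> bool"
  where "open_bop U \<longleftrightarrow> (\<forall>a\<in>U. \<forall>\<^sub>F (a', b) in uniformity. a' = a \<longrightarrow> b \<in> U)"

instance
proof
  fix a b c :: "'a bop" and r s :: real
  show "a + b + c = a + (b + c)" "a + b = b + a" "0 + a = a" "- a + a = 0"
    by (transfer; simp)+
  show "a - b = a + - b" by (rule minus_bop_def)
  show "r *\<^sub>R (a + b) = r *\<^sub>R a + r *\<^sub>R b" "(r + s) *\<^sub>R a = r *\<^sub>R a + s *\<^sub>R a"
    "r *\<^sub>R s *\<^sub>R a = (r * s) *\<^sub>R a" "1 *\<^sub>R a = a"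
    by (transfer; simp add: algebra_simps)+
  show "a * b * c = a * (b * c)" "(a + b) * c = a * c + b * c" "a * (b + c) = a * b + a * c"
    "(r *\<^sub>R a) * b = r *\<^sub>R (a * b)" "a * r *\<^sub>R b = r *\<^sub>R (a * b)"
    by (transfer; rule blinfun_eqI; simp add: blinfun.add_left blinfun.add_right
      blinfun.scaleR_left blinfun.scaleR_right)+
  show "dist a b = norm (a - b)" by (rule dist_bop_def)
  show "sgn a = inverse (norm a) *\<^sub>R a" by (rule sgn_bop_def)
  show "uniformity = (INF e\<in>{0<..}. principal {(a::'a bop, b). dist a b < e})"
    by (rule uniformity_bop_def)
  show "open U \<longleftrightarrow> (\<forall>a\<in>U. \<forall>\<^sub>F (a', b) in uniformity. a' = a \<longrightarrow> b \<in> U)" for U :: "'a bop set"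
    by (rule open_bop_def)
  show "norm a = 0 \<longleftrightarrow> a = 0" by transfer simp
  show "norm (a + b) \<le> norm a + norm b" by transfer (rule norm_triangle_ineq)
  show "norm (r *\<^sub>R a) = \<bar>r\<bar> * norm a" by transfer simp
  show "norm (a * b) \<le> norm a * norm b" by transfer (rule norm_blinfun_compose)
qed

end

lemma Rep_bop_minus: "Rep_bop (a - b) = Rep_bop a - Rep_bop b"
  unfolding minus_bop_def plus_bop.rep_eq uminus_bop.rep_eq by simp

definition bop_star :: "'i bop \<Rightarrow> 'i bop"
  where "bop_star a = (THE b. \<forall>\<xi> \<eta>. cinner (a \<cdot> \<xi>) \<eta> = cinner \<xi> (b \<cdot> \<eta>))"

lemma bop_star: "cinner (a \<cdot> \<xi>) \<eta> = cinner \<xi> (bop_star a \<cdot> \<eta>)"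
proof -
  obtain b where b: "\<And>\<xi> \<eta>. cinner (Rep_bop a \<xi>) \<eta> = cinner \<xi> (blinfun_apply b \<eta>)"
    using Rep_bop[of a] by blast
  have "cinner (b \<xi>) \<eta> = cinner \<xi> (Rep_bop a \<eta>)" for \<xi> \<eta>
    using b[of \<eta> \<xi>] by (subst (1 2) cinner_commute[symmetric]) simp
  then have "Rep_bop (Abs_bop b) = b" by (intro Abs_bop_inverse) blast
  then have "\<forall>\<xi> \<eta>. cinner (a \<cdot> \<xi>) \<eta> = cinner \<xi> (Abs_bop b \<cdot> \<eta>)"
    by (simp add: bop_apply.rep_eq b)
  moreover have "c = d" if "\<forall>\<xi> \<eta>. cinner (a \<cdot> \<xi>) \<eta> = cinner \<xi> (c \<cdot> \<eta>)"
      "\<forall>\<xi> \<eta>. cinner (a \<cdot> \<xi>) \<eta> = cinner \<xi> (d \<cdot> \<eta>)" for c d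
    by (rule bop_eqI, rule cinner_eqI) (simp only: that[rule_format, symmetric])
  ultimately have "\<exists>!b. \<forall>\<xi> \<eta>. cinner (a \<cdot> \<xi>) \<eta> = cinner \<xi> (b \<cdot> \<eta>)" by blast
  then have "\<forall>\<xi> \<eta>. cinner (a \<cdot> \<xi>) \<eta> = cinner \<xi> (bop_star a \<cdot> \<eta>)"
    unfolding bop_star_def by (rule theI')
  then show ?thesis by blast
qed

lemma bop_star': "cinner (bop_star a \<cdot> \<xi>) \<eta> = cinner \<xi> (a \<cdot> \<eta>)"
  using arg_cong[OF bop_star[of a \<eta> \<xi>], of cnj] by (simp add: cinner_commute)

lemma norm_bop_apply: "norm (a \<cdot> \<xi>) \<le> norm a * norm \<xi>"
  by transfer (rule norm_blinfun)

lemma norm_bop_leI: "0 \<le> K \<Longrightarrow> (\<And>\<xi>. norm (a \<cdot> \<xi>) \<le> K * norm \<xi>) \<Longrightarrow> norm a \<le> K"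
  by transfer (rule norm_blinfun_bound)

lemma bop_star_sq: "(norm a)\<^sup>2 \<le> norm (bop_star a * a)"
proof -
  have "norm a \<le> sqrt (norm (bop_star a * a))"
  proof (rule norm_bop_leI)
    fix \<xi>
    have "complex_of_real ((norm (a \<cdot> \<xi>))\<^sup>2) = cinner \<xi> ((bop_star a * a) \<cdot> \<xi>)"
      unfolding cinner_self[symmetric] bop_star
      by (simp add: bop_apply.rep_eq times_bop.rep_eq)
    then have "(norm (a \<cdot> \<xi>))\<^sup>2 = cmod (cinner \<xi> ((bop_star a * a) \<cdot> \<xi>))"
      by (metis abs_of_nonneg norm_of_real zero_le_power2)
    also have "\<dots> \<le> norm \<xi> * norm ((bop_star a * a) \<cdot> \<xi>)" by (rule cinner_Cauchy_Schwarz)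
    also have "\<dots> \<le> norm \<xi> * (norm (bop_star a * a) * norm \<xi>)"
      by (intro mult_left_mono norm_bop_apply norm_ge_zero)
    finally have "(norm (a \<cdot> \<xi>))\<^sup>2 \<le> (sqrt (norm (bop_star a * a)) * norm \<xi>)\<^sup>2"
      by (simp add: power_mult_distrib power2_eq_square mult_ac)
    then show "norm (a \<cdot> \<xi>) \<le> sqrt (norm (bop_star a * a)) * norm \<xi>"
      by (rule power2_le_imp_le) simp
  qed simp
  then have "(norm a)\<^sup>2 \<le> (sqrt (norm (bop_star a * a)))\<^sup>2" by (intro power_mono) auto
  then show ?thesis by simp
qed

lemma bop_star_star: "bop_star (bop_star a) = a"
proof (intro bop_eqI cinner_eqI)
  show "cinner \<zeta> (bop_star (bop_star a) \<cdot> \<xi>) = cinner \<zeta> (a \<cdot> \<xi>)" for \<zeta> \<xi>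
    using bop_star[of "bop_star a" \<zeta> \<xi>] bop_star'[of a \<zeta> \<xi>] by simp
qed

lemma norm_bop_star: "norm (bop_star a) = norm a"
proof -
  have *: "norm a \<le> norm (bop_star a)" for a :: "'i bop"
  proof (cases "norm a = 0")
    case False
    have "norm a * norm a \<le> norm (bop_star a) * norm a"
      using bop_star_sq[of a] norm_mult_ineq[of "bop_star a" a] by (simp add: power2_eq_square)
    then show ?thesis using False by simp
  qed simp
  show ?thesis using *[of a] *[of "bop_star a"] by (simp add: bop_star_star)
qed

lemma bop_apply_simps:
  "(a + b) \<cdot> \<xi> = a \<cdot> \<xi> + b \<cdot> \<xi>" "(a * b) \<cdot> \<xi> = a \<cdot> b \<cdot> \<xi>" "(a - b) \<cdot> \<xi> = a \<cdot> \<xi> - b \<cdot> \<xi>"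
  by (simp_all only: bop_apply.rep_eq plus_bop.rep_eq times_bop.rep_eq Rep_bop_minus
    blinfun.add_left blinfun.diff_left blinfun_apply_blinfun_compose)

lemma bop_apply_scaleC: "a \<cdot> c *\<^sub>C \<xi> = c *\<^sub>C a \<cdot> \<xi>"
proof (rule cinner_eqI)
  fix \<zeta>
  show "cinner \<zeta> (a \<cdot> c *\<^sub>C \<xi>) = cinner \<zeta> (c *\<^sub>C a \<cdot> \<xi>)"
    using bop_star'[of a \<zeta> "c *\<^sub>C \<xi>"] bop_star'[of a \<zeta> \<xi>] by (simp add: cinner_simps)
qed

instantiation bop :: (type) cstar_algebra
begin

definition star_bop :: "'a bop \<Rightarrow> 'a bop" where "star_bop = bop_star"

lift_definition scaleC_bop :: "complex \<Rightarrow> 'a bop \<Rightarrow> 'a bop"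
  is "\<lambda>c a. Blinfun (\<lambda>\<xi>. c *\<^sub>C blinfun_apply a \<xi>)"
proof -
  fix c and a :: "'a ell2 \<Rightarrow>\<^sub>L 'a ell2"
  assume "\<exists>b :: 'a ell2 \<Rightarrow>\<^sub>L 'a ell2. \<forall>\<xi> \<eta>. cinner (a \<xi>) \<eta> = cinner \<xi> (b \<eta>)"
  then obtain b :: "'a ell2 \<Rightarrow>\<^sub>L 'a ell2" where b: "\<forall>\<xi> \<eta>. cinner (a \<xi>) \<eta> = cinner \<xi> (b \<eta>)" by blast
  have "blinfun_apply (Blinfun (\<lambda>\<xi>. c *\<^sub>C blinfun_apply a \<xi>)) \<xi> = c *\<^sub>C blinfun_apply a \<xi>"
    for c \<xi> and a :: "'a ell2 \<Rightarrow>\<^sub>L 'a ell2"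
    by (simp add: bounded_linear_Blinfun_apply bounded_linear_compose[OF bounded_linear_scaleC_ell2]
      blinfun.bounded_linear_right)
  then show "\<exists>d :: 'a ell2 \<Rightarrow>\<^sub>L 'a ell2. \<forall>\<xi> \<eta>.
      cinner (Blinfun (\<lambda>\<xi>. c *\<^sub>C blinfun_apply a \<xi>) \<xi>) \<eta> = cinner \<xi> (d \<eta>)"
    using b by (intro exI[of _ "Blinfun (\<lambda>\<xi>. cnj c *\<^sub>C blinfun_apply b \<xi>)"])
      (simp add: cinner_simps)
qed

instance
proof
  have sc: "(c *\<^sub>C a) \<cdot> \<xi> = c *\<^sub>C a \<cdot> \<xi>" for c \<xi> and a :: "'a bop"
    by transfer (simp add: bounded_linear_Blinfun_apply
      bounded_linear_compose[OF bounded_linear_scaleC_ell2] blinfun.bounded_linear_right)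
  fix a b :: "'a bop" and c d :: complex
  have scR: "(r *\<^sub>R a) \<cdot> \<xi> = r *\<^sub>R a \<cdot> \<xi>" for r \<xi> and a :: "'a bop"
    by transfer (simp add: blinfun.scaleR_left)
  show "(scaleR r :: 'a bop \<Rightarrow> _) = scaleC (complex_of_real r)" for r
    by (rule ext, rule bop_eqI) (simp add: sc scR scaleR_scaleC)
  show "c *\<^sub>C (a + b) = c *\<^sub>C a + c *\<^sub>C b"
    by (rule bop_eqI) (simp add: sc bop_apply_simps scaleC_ell2_simps)
  show "(c + d) *\<^sub>C a = c *\<^sub>C a + d *\<^sub>C a"
    by (rule bop_eqI) (simp add: sc bop_apply_simps scaleC_ell2_simps)
  show "c *\<^sub>C d *\<^sub>C a = (c * d) *\<^sub>C a"
    by (rule bop_eqI) (simp add: sc scaleC_ell2_simps)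
  show "1 *\<^sub>C a = a"
    by (rule bop_eqI) (simp add: sc scaleC_ell2_simps)
  show "(c *\<^sub>C a) * b = c *\<^sub>C (a * b)" "a * (c *\<^sub>C b) = c *\<^sub>C (a * b)"
    by (rule bop_eqI, simp add: sc bop_apply_simps bop_apply_scaleC)+
  have le: "norm (c *\<^sub>C a) \<le> cmod c * norm a" for c and a :: "'a bop"
    by (rule norm_bop_leI)
      (auto simp: sc norm_scaleC_ell2 mult.assoc intro!: mult_left_mono norm_bop_apply)
  show "norm (c *\<^sub>C a) = cmod c * norm a"
  proof (rule antisym[OF le], cases "c = 0")
    case False
    have "inverse c *\<^sub>C c *\<^sub>C a = a"
      using False by (intro bop_eqI) (simp add: sc scaleC_ell2_simps)
    then have "norm a \<le> cmod (inverse c) * norm (c *\<^sub>C a)" using le by metis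
    then show "cmod c * norm a \<le> norm (c *\<^sub>C a)"
      using False by (simp add: norm_inverse norm_divide field_simps)
  qed simp
  show "star (a + b) = star a + star b"
    by (intro bop_eqI cinner_eqI)
      (simp add: star_bop_def bop_apply_simps cinner_simps flip: bop_star)
  show "star (c *\<^sub>C a) = cnj c *\<^sub>C star a"
    by (intro bop_eqI cinner_eqI)
      (simp add: star_bop_def sc cinner_simps flip: bop_star)
  show "star (a * b) = star b * star a"
    by (intro bop_eqI cinner_eqI)
      (simp add: star_bop_def bop_apply_simps flip: bop_star)
  show "star (star a) = a" by (simp add: star_bop_def bop_star_star)
  show "norm (star a * a) = (norm a)\<^sup>2"
    using bop_star_sq[of a] norm_mult_ineq[of "bop_star a" a]
    by (simp add: star_bop_def norm_bop_star power2_eq_square)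
next
  fix X :: "nat \<Rightarrow> 'a bop" assume X: "Cauchy X"
  have diff: "norm (bop_star a - bop_star b) = norm (a - b)" for a b :: "'a bop"
  proof -
    have "bop_star a - bop_star b = bop_star (a - b)"
      by (intro bop_eqI cinner_eqI) (simp add: bop_apply_simps cinner_simps flip: bop_star)
    then show ?thesis by (simp add: norm_bop_star)
  qed
  have "Cauchy (\<lambda>n. Rep_bop (X n))" "Cauchy (\<lambda>n. Rep_bop (bop_star (X n)))"
    using X unfolding Cauchy_iff by (simp_all add: diff flip: Rep_bop_minus norm_bop.rep_eq)
  then obtain L M where L: "(\<lambda>n. Rep_bop (X n)) \<longlonglongrightarrow> L" and M: "(\<lambda>n. Rep_bop (bop_star (X n))) \<longlonglongrightarrow> M"
    by (auto simp: Cauchy_convergent_iff convergent_def)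
  have "cinner (L \<xi>) \<eta> = cinner \<xi> (M \<eta>)" for \<xi> \<eta>
  proof (rule LIMSEQ_unique)
    show "(\<lambda>n. cinner (Rep_bop (X n) \<xi>) \<eta>) \<longlonglongrightarrow> cinner (L \<xi>) \<eta>"
      by (intro bounded_bilinear.tendsto[OF bounded_bilinear_cinner] tendsto_intros
        bounded_linear.tendsto[OF blinfun.bounded_linear_left] L)
    have "(\<lambda>n. cinner \<xi> (Rep_bop (bop_star (X n)) \<eta>)) \<longlonglongrightarrow> cinner \<xi> (M \<eta>)"
      by (intro bounded_bilinear.tendsto[OF bounded_bilinear_cinner] tendsto_intros
        bounded_linear.tendsto[OF blinfun.bounded_linear_left] M)
    then show "(\<lambda>n. cinner (Rep_bop (X n) \<xi>) \<eta>) \<longlonglongrightarrow> cinner \<xi> (M \<eta>)"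
      by (simp add: bop_star flip: bop_apply.rep_eq)
  qed
  then have "Rep_bop (Abs_bop L) = L" by (intro Abs_bop_inverse) auto
  then have "X \<longlonglongrightarrow> Abs_bop L"
    using L unfolding LIMSEQ_iff by (simp add: Rep_bop_minus norm_bop.rep_eq)
  then show "convergent X" by (auto simp: convergent_def)
qed

end


section \<open>Notions for C*-algebras\<close>

global_interpretation complex_vector: vector_space "scaleC :: complex \<Rightarrow> 'a \<Rightarrow> 'a :: cstar_algebra"
  defines cspan = complex_vector.span
  by standard (simp_all add: scaleC_add_right scaleC_add_left scaleC_scaleC scaleC_one)

definition cstar_subalgebra :: "'a::cstar_algebra set \<Rightarrow> bool" where
  "cstar_subalgebra A \<longleftrightarrow> closed A \<and> 0 \<in> A \<and> (\<forall>a\<in>A. \<forall>b\<in>A. a + b \<in> A \<and> a * b \<in> A) \<and>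
    (\<forall>c. \<forall>a\<in>A. c *\<^sub>C a \<in> A) \<and> (\<forall>a\<in>A. star a \<in> A)"

text \<open>Positivity of an element does not depend on the ambient C*-algebra, so the witness may be
  taken anywhere in the type.\<close>

definition positive :: "'a::cstar_algebra \<Rightarrow> bool" where
  "positive a \<longleftrightarrow> (\<exists>c. a = star c * c)"

text \<open>The net of an approximate unit is represented by its filter of tails.\<close>

definition has_approximate_unit_in :: "'a::cstar_algebra set \<Rightarrow> 'a set \<Rightarrow> bool" where
  "has_approximate_unit_in A B \<longleftrightarrow> (\<exists>F. F \<noteq> bot \<and>
    (\<forall>\<^sub>F u in F. u \<in> B \<and> positive u \<and> norm u \<le> 1) \<and>
    (\<forall>a\<in>A. ((\<lambda>u. u * a) \<longlongrightarrow> a) F \<and> ((\<lambda>u. a * u) \<longlongrightarrow> a) F))"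

definition cstar_inclusion :: "'a::cstar_algebra set \<Rightarrow> 'a set \<Rightarrow> bool" where
  "cstar_inclusion A B \<longleftrightarrow> cstar_subalgebra A \<and> cstar_subalgebra B \<and> B \<subseteq> A \<and>
    has_approximate_unit_in A B"

definition normalizers :: "'a::cstar_algebra set \<Rightarrow> 'a set \<Rightarrow> 'a set" where
  "normalizers A B = {n \<in> A. \<forall>b\<in>B. n * b * star n \<in> B \<and> star n * b * n \<in> B}"

definition regular_inclusion :: "'a::cstar_algebra set \<Rightarrow> 'a set \<Rightarrow> bool" where
  "regular_inclusion A B \<longleftrightarrow> cstar_inclusion A B \<and> A \<subseteq> closure (cspan (normalizers A B))"

definition abelian :: "'a::cstar_algebra set \<Rightarrow> bool" where
  "abelian B \<longleftrightarrow> (\<forall>a\<in>B. \<forall>b\<in>B. a * b = b * a)"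

definition maximal_abelian :: "'a::cstar_algebra set \<Rightarrow> 'a set \<Rightarrow> bool" where
  "maximal_abelian A B \<longleftrightarrow> cstar_subalgebra B \<and> B \<subseteq> A \<and> abelian B \<and>
    (\<forall>B'. cstar_subalgebra B' \<and> B' \<subseteq> A \<and> abelian B' \<and> B \<subseteq> B' \<longrightarrow> B' = B)"

text \<open>Only the values of \<^term>\<open>E\<close> on \<^term>\<open>A\<close> matter. A positive \<^term>\<open>B\<close>-bimodule
  projection is automatically completely positive.\<close>

definition conditional_expectation :: "'a::cstar_algebra set \<Rightarrow> 'a set \<Rightarrow> ('a \<Rightarrow> 'a) \<Rightarrow> bool" where
  "conditional_expectation A B E \<longleftrightarrow>
    (\<forall>a\<in>A. E a \<in> B) \<and> (\<forall>b\<in>B. E b = b) \<and>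
    (\<forall>a\<in>A. \<forall>a'\<in>A. E (a + a') = E a + E a') \<and> (\<forall>c. \<forall>a\<in>A. E (c *\<^sub>C a) = c *\<^sub>C E a) \<and>
    (\<forall>a\<in>A. norm (E a) \<le> norm a) \<and> (\<forall>a\<in>A. positive a \<longrightarrow> positive (E a)) \<and>
    (\<forall>a\<in>A. \<forall>b\<in>B. E (b * a) = b * E a \<and> E (a * b) = E a * b)"

definition faithful_on :: "'a::cstar_algebra set \<Rightarrow> ('a \<Rightarrow> 'a) \<Rightarrow> bool" where
  "faithful_on A E \<longleftrightarrow> (\<forall>a\<in>A. E (star a * a) = 0 \<longrightarrow> a = 0)"

definition cartan_inclusion :: "'a::cstar_algebra set \<Rightarrow> 'a set \<Rightarrow> bool" where
  "cartan_inclusion A B \<longleftrightarrow> regular_inclusion A B \<and> maximal_abelian A B \<and>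
    (\<exists>E. conditional_expectation A B E \<and> faithful_on A E)"

definition relative_commutant :: "'a::cstar_algebra set \<Rightarrow> 'a set \<Rightarrow> 'a set" where
  "relative_commutant A D = {a \<in> A. \<forall>d\<in>D. a * d = d * a}"

definition cstar_isomorphic :: "'a::cstar_algebra set \<Rightarrow> 'b::cstar_algebra set \<Rightarrow> bool" where
  "cstar_isomorphic A B \<longleftrightarrow> (\<exists>\<theta>. bij_betw \<theta> A B \<and>
    (\<forall>a\<in>A. \<forall>b\<in>A. \<theta> (a + b) = \<theta> a + \<theta> b \<and> \<theta> (a * b) = \<theta> a * \<theta> b) \<and>
    (\<forall>c. \<forall>a\<in>A. \<theta> (c *\<^sub>C a) = c *\<^sub>C \<theta> a) \<and> (\<forall>a\<in>A. \<theta> (star a) = star (\<theta> a)))"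


section \<open>Crossed products, group C*-algebras and tensor products\<close>

text \<open>The bounded operator given by a formula on coordinates. Here and below, \<open>THE\<close> picks a
  bounded operator that exists, and is unique, in all the cases considered.\<close>

definition bop_of :: "(('i \<Rightarrow> complex) \<Rightarrow> 'i \<Rightarrow> complex) \<Rightarrow> 'i bop" where
  "bop_of F = (THE a. \<forall>\<xi>. Rep_ell2 (a \<cdot> \<xi>) = F (Rep_ell2 \<xi>))"

text \<open>\<open>C(X)\<close>, for compact \<open>X\<close>, acting faithfully by multiplication on \<open>\<ell>\<^sup>2(X)\<close>.\<close>

definition mult_op :: "('x \<Rightarrow> complex) \<Rightarrow> 'x bop" where
  "mult_op f = bop_of (\<lambda>\<xi> x. f x * \<xi> x)"

definition continuous_functions :: "'x::topological_space bop set" where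
  "continuous_functions = {mult_op f | f. continuous_on UNIV f}"

text \<open>The reduced crossed product of \<open>C(X)\<close> by \<open>\<Gamma> = carrier G\<close> is realised by the regular
  representation induced from the faithful representation \<^const>\<open>mult_op\<close>, which acts on
  \<open>\<ell>\<^sup>2(\<Gamma>, \<ell>\<^sup>2(X)) = \<ell>\<^sup>2(\<Gamma> \<times> X)\<close> by
  \<open>(f \<xi>)(t, x) = f (t x) \<xi>(t, x)\<close> and \<open>(w\<^sub>s \<xi>)(t, x) = \<xi>(s\<^sup>-\<^sup>1 t, x)\<close>; thus
  \<open>w\<^sub>s f w\<^sub>s\<^sup>* = f(s\<^sup>-\<^sup>1 \<cdot>)\<close>. Since \<open>\<Gamma>\<close> may be a proper subset of the type \<^typ>\<open>'g\<close>, all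
  operators are extended by \<open>0\<close> from \<open>\<ell>\<^sup>2(\<Gamma> \<times> X)\<close> to \<open>\<ell>\<^sup>2('g \<times> 'x)\<close>: the unit of the
  crossed product is the projection onto \<open>\<ell>\<^sup>2(\<Gamma> \<times> X)\<close>.\<close>

definition crossed_fun ::
    "'g monoid \<Rightarrow> ('g \<Rightarrow> 'x \<Rightarrow> 'x) \<Rightarrow> ('x \<Rightarrow> complex) \<Rightarrow> ('g \<times> 'x) bop" where
  "crossed_fun G \<phi> f = bop_of (\<lambda>\<xi> (t, x). if t \<in> carrier G then f (\<phi> t x) * \<xi> (t, x) else 0)"

definition crossed_unitary :: "'g monoid \<Rightarrow> 'g \<Rightarrow> ('g \<times> 'x) bop" where
  "crossed_unitary G s =
    bop_of (\<lambda>\<xi> (t, x). if t \<in> carrier G then \<xi> (inv\<^bsub>G\<^esub> s \<otimes>\<^bsub>G\<^esub> t, x) else 0)"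

definition crossed_functions ::
    "'g monoid \<Rightarrow> ('g \<Rightarrow> 'x \<Rightarrow> 'x::topological_space) \<Rightarrow> ('g \<times> 'x) bop set" where
  "crossed_functions G \<phi> = {crossed_fun G \<phi> f | f. continuous_on UNIV f}"

definition reduced_crossed_product ::
    "'g monoid \<Rightarrow> ('g \<Rightarrow> 'x \<Rightarrow> 'x::topological_space) \<Rightarrow> 'g set \<Rightarrow> ('g \<times> 'x) bop set" where
  "reduced_crossed_product G \<phi> N = closure (cspan
    {crossed_fun G \<phi> f * crossed_unitary G s | f s. continuous_on UNIV f \<and> s \<in> N})"

text \<open>The full C*-algebra of a discrete group \<open>H\<close> is the C*-algebra generated by the universal
  representation: the direct sum of all unitary representations of \<open>H\<close> on \<open>\<ell>\<^sup>2('g)\<close>. Every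
  cyclic representation of \<open>H\<close> has Hilbert space dimension at most that of \<open>\<ell>\<^sup>2('g)\<close>, hence is
  a subrepresentation of one of these, so the norm is the supremum over all representations.\<close>

definition unitary_reps :: "'g monoid \<Rightarrow> ('g \<Rightarrow> 'g bop) set" where
  "unitary_reps H = {\<rho>. (\<forall>\<xi>. \<rho> \<one>\<^bsub>H\<^esub> \<cdot> \<xi> = \<xi>) \<and>
    (\<forall>s\<in>carrier H. \<forall>t\<in>carrier H. \<rho> (s \<otimes>\<^bsub>H\<^esub> t) = \<rho> s * \<rho> t) \<and>
    (\<forall>s\<in>carrier H. star (\<rho> s) = \<rho> (inv\<^bsub>H\<^esub> s))}"

definition universal_unitary :: "'g monoid \<Rightarrow> 'g \<Rightarrow> (('g \<Rightarrow> 'g bop) \<times> 'g) bop" where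
  "universal_unitary H s = bop_of (\<lambda>\<xi> (\<rho>, i).
    if \<rho> \<in> unitary_reps H then Rep_ell2 (\<rho> s \<cdot> Abs_ell2 (\<lambda>j. \<xi> (\<rho>, j))) i else 0)"

definition group_cstar :: "'g monoid \<Rightarrow> (('g \<Rightarrow> 'g bop) \<times> 'g) bop set" where
  "group_cstar H = closure (cspan (universal_unitary H ` carrier H))"

text \<open>The spatial (minimal) tensor product of C*-algebras of operators on \<open>\<ell>\<^sup>2(I)\<close> and
  \<open>\<ell>\<^sup>2(J)\<close>, acting on \<open>\<ell>\<^sup>2(I) \<otimes> \<ell>\<^sup>2(J) = \<ell>\<^sup>2(I \<times> J)\<close>.\<close>

definition tensor_vec :: "'i ell2 \<Rightarrow> 'j ell2 \<Rightarrow> ('i \<times> 'j) ell2" where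
  "tensor_vec \<xi> \<eta> = Abs_ell2 (\<lambda>(i, j). Rep_ell2 \<xi> i * Rep_ell2 \<eta> j)"

definition tensor_op :: "'i bop \<Rightarrow> 'j bop \<Rightarrow> ('i \<times> 'j) bop" where
  "tensor_op a b = (THE c. \<forall>\<xi> \<eta>. c \<cdot> tensor_vec \<xi> \<eta> = tensor_vec (a \<cdot> \<xi>) (b \<cdot> \<eta>))"

definition cstar_tensor :: "'i bop set \<Rightarrow> 'j bop set \<Rightarrow> ('i \<times> 'j) bop set" where
  "cstar_tensor A B = closure (cspan {tensor_op a b | a b. a \<in> A \<and> b \<in> B})"


section \<open>The conditions on a subgroup\<close>

definition abelian_subgroup :: "'g set \<Rightarrow> 'g monoid \<Rightarrow> bool" where
  "abelian_subgroup N G \<longleftrightarrow> subgroup N G \<and> (\<forall>s\<in>N. \<forall>t\<in>N. s \<otimes>\<^bsub>G\<^esub> t = t \<otimes>\<^bsub>G\<^esub> s)"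

definition fix_interior_condition ::
    "'g monoid \<Rightarrow> ('g \<Rightarrow> 'x \<Rightarrow> 'x::topological_space) \<Rightarrow> 'g set \<Rightarrow> bool" where
  "fix_interior_condition G \<phi> N \<longleftrightarrow> abelian_subgroup N G \<and>
    (\<forall>s\<in>carrier G. interior {x. \<phi> s x = x} = (if s \<in> N then UNIV else {}))"

definition commutant_condition ::
    "'g monoid \<Rightarrow> ('g \<Rightarrow> 'x \<Rightarrow> 'x::topological_space) \<Rightarrow> 'g set \<Rightarrow> bool" where
  "commutant_condition G \<phi> N \<longleftrightarrow> abelian_subgroup N G \<and> (\<forall>s\<in>N. \<forall>x. \<phi> s x = x) \<and>
    relative_commutant (reduced_crossed_product G \<phi> (carrier G)) (crossed_functions G \<phi>)
      = reduced_crossed_product G \<phi> N \<and>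
    cstar_isomorphic (reduced_crossed_product G \<phi> N)
      (cstar_tensor (continuous_functions :: 'x bop set) (group_cstar (G\<lparr>carrier := N\<rparr>)))"

end

theory Submission
  imports Defs "HOL-Real_Asymp.Real_Asymp"
begin

text \<open>
  An element \<open>a\<close> of the crossed product is determined by its Fourier coefficients, continuous functions
  \<open>f\<^sub>s\<close> on \<open>X\<close> which formally give \<open>a = \<Sum> f\<^sub>s w\<^sub>s\<close> (\<open>entry_eq_coef\<close>, \<open>continuous_coef\<close>). It commutes with C(X) iff
  each \<open>f\<^sub>s\<close> vanishes outside the fixed points of \<open>s\<close> (\<open>commutant_iff\<close>), and by continuity then outside
  their interior.

  Suppose that the relative commutant is abelian and the range of a conditional expectation \<open>\<Delta>\<close>. The
  coefficient of \<open>\<Delta> w\<^sub>s\<close> at \<open>s\<close> turns out to be the indicator function of the interior of the fixed points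
  of \<open>s\<close> (\<open>interior_fixed_points_clopen\<close>). As it is continuous and \<open>X\<close> is connected, this interior is
  empty or \<open>X\<close>. So the condition on the interiors holds for the kernel \<open>N\<close> of the action, which is
  abelian because the unitaries of its elements lie in the relative commutant. The subgroup in the
  condition on the interiors, and the one in the condition on the relative commutant, can only be
  the kernel of the action, whence it is normal.

  Conversely, assume the condition on the interiors for \<open>N\<close>. The coefficients of an element of
  the relative commutant are concentrated on \<open>N\<close>. Compressing operators to the diagonal blocks given by the cosets of \<open>N\<close> is a faithful
  conditional expectation onto the crossed product by \<open>N\<close>; an element with coefficients concentrated
  on \<open>N\<close> is fixed by it (\<open>in_crossed_if_coef_eq_0\<close>), so the relative commutant is
  the crossed product by \<open>N\<close>, an abelian algebra.
  The monomials \<open>f w\<^sub>s\<close> normalize it, and it is a Cartan subalgebra. Positivity of the compression amounts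
  to the existence of square roots of positive operators, which come from the binomial series.

  It remains to identify the crossed product by \<open>N\<close> with the tensor product of C(X) and the group
  C*-algebra. Both are completions of the convolution algebra of finitely supported functions from
  \<open>N\<close> to C(X), in two C*-norms which lie between the maximum and the sum of the norms of the values.
  For \<open>c = star a * a\<close> a C*-norm satisfies \<open>\<parallel>a\<parallel> ^ (2 n) = \<parallel>c ^ n\<parallel>\<close> for \<open>n\<close> a power of 2. An abelian
  group has polynomial growth, so the support of \<open>c ^ n\<close> has polynomial size in \<open>n\<close>, and the ratio of the
  two norms of \<open>c ^ n\<close> grows at most polynomially. Taking roots, the two norms of \<open>a\<close> agree
  (\<open>pairs_norm_le\<close>). For constant functions this says that \<open>N\<close> is amenable.
\<close>

section \<open>Matrix entries of operators\<close>

lemma ell2_eqI: "(\<And>i. Rep_ell2 \<xi> i = Rep_ell2 \<eta> i) \<Longrightarrow> \<xi> = \<eta>"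
  by (metis Rep_ell2_inject ext)

lemma ell2_of_finite_sums:
  fixes f :: "'i \<Rightarrow> complex"
  assumes "0 \<le> K" and "\<And>F. finite F \<Longrightarrow> (\<Sum>i\<in>F. (cmod (f i))\<^sup>2) \<le> K\<^sup>2"
  shows "Rep_ell2 (Abs_ell2 f) = f" and "norm (Abs_ell2 f) \<le> K"
proof -
  have s: "(\<lambda>i. (cmod (f i))\<^sup>2) summable_on UNIV"
    by (rule nonneg_bdd_above_summable_on) (use assms(2) in \<open>auto intro!: bdd_aboveI2[of _ _ "K\<^sup>2"]\<close>)
  then show R: "Rep_ell2 (Abs_ell2 f) = f"
    by (simp add: Abs_ell2_inverse)
  have "(norm (Abs_ell2 f))\<^sup>2 \<le> K\<^sup>2"
    unfolding norm_ell2_sq R by (rule infsum_le_finite_sums[OF s]) (use assms(2) in auto)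
  then show "norm (Abs_ell2 f) \<le> K"
    using assms(1) by (rule power2_le_imp_le)
qed

lemma cinner_summable: "(\<lambda>i. cnj (Rep_ell2 \<xi> i) * Rep_ell2 \<eta> i) summable_on UNIV"
  using Rep_ell2[of \<xi>] Rep_ell2[of \<eta>] by (intro ell2_prod_summable) auto

definition ket :: "'i \<Rightarrow> 'i ell2"
  where "ket i = Abs_ell2 (\<lambda>j. if j = i then 1 else 0)"

lemma Rep_ket: "Rep_ell2 (ket i) j = (if j = i then 1 else 0)"
  and norm_ket_le: "norm (ket i) \<le> 1"
proof -
  have *: "(\<Sum>j\<in>F. (cmod (if j = i then 1 else 0))\<^sup>2) \<le> 1\<^sup>2" if "finite F" for F
  proof -
    have "(\<Sum>j\<in>F. (cmod (if j = i then 1 else 0))\<^sup>2) = (\<Sum>j\<in>F. if j = i then 1 else 0)"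
      by (rule sum.cong) auto
    then show ?thesis using that by simp
  qed
  show "Rep_ell2 (ket i) j = (if j = i then 1 else 0)" "norm (ket i) \<le> 1"
    unfolding ket_def using ell2_of_finite_sums[of 1 "\<lambda>j. if j = i then 1 else 0", OF _ *] by auto
qed

lemma cinner_ket: "cinner (ket i) \<xi> = Rep_ell2 \<xi> i"
proof -
  have "cinner (ket i) \<xi> = (\<Sum>\<^sub>\<infinity>j. cnj (Rep_ell2 (ket i) j) * Rep_ell2 \<xi> j)"
    by (simp add: cinner.rep_eq)
  also have "\<dots> = (\<Sum>\<^sub>\<infinity>j\<in>{i}. Rep_ell2 \<xi> j)"
    by (rule infsum_cong_neutral) (auto simp: Rep_ket)
  finally show ?thesis by simp
qed

lemma norm_coordinate_le: "cmod (Rep_ell2 \<xi> i) \<le> norm \<xi>"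
  using ell2_sum_le[of "{i}" \<xi>] by (simp add: power2_le_iff_abs_le)

lemma bop_apply_scaleC_left: "(c *\<^sub>C a) \<cdot> \<xi> = c *\<^sub>C (a \<cdot> \<xi>)"
  by transfer (simp add: bounded_linear_Blinfun_apply
    bounded_linear_compose[OF bounded_linear_scaleC_ell2] blinfun.bounded_linear_right)

lemma bop_apply_add_right: "a \<cdot> (\<xi> + \<eta>) = a \<cdot> \<xi> + a \<cdot> \<eta>"
  by transfer (rule blinfun.add_right)

lemma bop_apply_zero_left: "0 \<cdot> \<xi> = 0"
  by transfer simp

lemma cinner_star_right: "cinner \<xi> (star a \<cdot> \<eta>) = cinner (a \<cdot> \<xi>) \<eta>"
  by (simp add: star_bop_def bop_star)

lemma cinner_star_left: "cinner (star a \<cdot> \<xi>) \<eta> = cinner \<xi> (a \<cdot> \<eta>)"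
  by (simp add: star_bop_def bop_star')

definition entry :: "'i bop \<Rightarrow> 'i \<Rightarrow> 'i \<Rightarrow> complex"
  where "entry a i j = Rep_ell2 (a \<cdot> ket j) i"

lemma entry_eq_cinner: "entry a i j = cinner (ket i) (a \<cdot> ket j)"
  by (simp add: entry_def cinner_ket)

lemma entry_star: "entry (star a) i j = cnj (entry a j i)"
  by (metis cinner_commute cinner_star_right entry_eq_cinner)

text \<open>Each row of the matrix of \<open>a\<close> is the square summable family \<open>star a \<cdot> ket i\<close>, so the entries
  determine \<open>a\<close>.\<close>

lemma apply_eq_row: "Rep_ell2 (a \<cdot> \<xi>) i = cinner (star a \<cdot> ket i) \<xi>"
  by (simp add: cinner_star_left cinner_ket)

lemma bop_eqI_entry:
  assumes "\<And>i j. entry a i j = entry b i j"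
  shows "a = b"
proof (intro bop_eqI ell2_eqI)
  fix \<xi> i
  have "star a \<cdot> ket i = star b \<cdot> ket i"
    by (rule ell2_eqI) (simp add: assms entry_star flip: entry_def)
  then show "Rep_ell2 (a \<cdot> \<xi>) i = Rep_ell2 (b \<cdot> \<xi>) i"
    by (simp add: apply_eq_row)
qed

lemma entry_add: "entry (a + b) i j = entry a i j + entry b i j"
  by (simp add: entry_def bop_apply_simps plus_ell2.rep_eq)

lemma entry_diff: "entry (a - b) i j = entry a i j - entry b i j"
  by (simp add: entry_def bop_apply_simps minus_ell2.rep_eq)

lemma entry_scaleC: "entry (c *\<^sub>C a) i j = c * entry a i j"
  by (simp add: entry_def bop_apply_scaleC_left scaleC_ell2.rep_eq)

lemma entry_zero: "entry 0 i j = 0"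
  by (simp add: entry_def bop_apply_zero_left zero_ell2.rep_eq)

lemma entry_sum: "entry (\<Sum>s\<in>S. a s) i j = (\<Sum>s\<in>S. entry (a s) i j)"
  by (induction S rule: infinite_finite_induct) (simp_all add: entry_add entry_zero)

lemma norm_entry_le: "cmod (entry a i j) \<le> norm a"
proof -
  have "cmod (entry a i j) \<le> norm a * norm (ket j)"
    unfolding entry_def using norm_coordinate_le norm_bop_apply by (rule order_trans)
  also have "\<dots> \<le> norm a * 1" by (intro mult_left_mono norm_ket_le norm_ge_zero)
  finally show ?thesis by simp
qed

lemma tendsto_entry:
  assumes "X \<longlonglongrightarrow> a"
  shows "(\<lambda>n. entry (X n) i j) \<longlonglongrightarrow> entry a i j"
proof -
  have "(\<lambda>n. norm (X n - a)) \<longlonglongrightarrow> 0"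
    using assms by (simp add: LIM_zero tendsto_norm_zero)
  then have "(\<lambda>n. entry (X n) i j - entry a i j) \<longlonglongrightarrow> 0"
    by (rule Lim_null_comparison[rotated]) (simp add: norm_entry_le flip: entry_diff)
  then show ?thesis by (rule LIM_zero_cancel)
qed

text \<open>A bounded map with a formal adjoint is a bounded operator: its linearity and a bound for the
  adjoint both follow from the adjoint relation.\<close>

lemma ex_bop_of_adjoint:
  fixes A B :: "'i ell2 \<Rightarrow> 'i ell2"
  assumes "\<And>\<xi>. norm (A \<xi>) \<le> K * norm \<xi>" and adj: "\<And>\<xi> \<eta>. cinner (A \<xi>) \<eta> = cinner \<xi> (B \<eta>)"
  shows "\<exists>a. \<forall>\<xi>. a \<cdot> \<xi> = A \<xi>"
proof -
  have adj': "cinner (B \<xi>) \<eta> = cinner \<xi> (A \<eta>)" for \<xi> \<eta>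
    by (metis adj cinner_commute)
  have lin: "A' (\<xi> + \<eta>) = A' \<xi> + A' \<eta>" "A' (r *\<^sub>R \<xi>) = r *\<^sub>R A' \<xi>"
    if "\<And>\<xi> \<eta>. cinner (B' \<xi>) \<eta> = cinner \<xi> (A' \<eta>)" for A' B' :: "'i ell2 \<Rightarrow> 'i ell2" and \<xi> \<eta> r
    by (rule cinner_eqI, simp add: cinner_simps scaleR_scaleC flip: that)+
  have nB: "norm (B \<eta>) \<le> norm \<eta> * K" for \<eta>
  proof (cases "norm (B \<eta>) = 0")
    case False
    have "(norm (B \<eta>))\<^sup>2 = cmod (cinner (A (B \<eta>)) \<eta>)"
      by (simp add: adj cinner_self norm_power)
    also have "\<dots> \<le> norm (A (B \<eta>)) * norm \<eta>" by (rule cinner_Cauchy_Schwarz)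
    also have "\<dots> \<le> K * norm (B \<eta>) * norm \<eta>" by (intro mult_right_mono assms norm_ge_zero)
    finally show ?thesis using False by (simp add: power2_eq_square mult_ac)
  next
    case True
    have "0 \<le> norm \<eta> * K"
      using order_trans[OF norm_ge_zero assms(1)[of \<eta>]] by (simp add: mult.commute)
    then show ?thesis using True by simp
  qed
  have blA: "bounded_linear A"
    by (rule bounded_linear_intro[of _ K]) (simp_all add: lin[OF adj'] assms(1) mult.commute)
  have blB: "bounded_linear B"
    by (rule bounded_linear_intro[of _ K]) (simp_all add: lin[OF adj] nB)
  have "Rep_bop (Abs_bop (Blinfun A)) = Blinfun A"
    by (rule Abs_bop_inverse)
      (auto intro!: exI[of _ "Blinfun B"] simp: bounded_linear_Blinfun_apply blA blB adj)
  then have "\<forall>\<xi>. Abs_bop (Blinfun A) \<cdot> \<xi> = A \<xi>"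
    by (simp add: bop_apply.rep_eq bounded_linear_Blinfun_apply blA)
  then show ?thesis ..
qed

lemma bop_of_eqI:
  assumes "\<And>\<xi>. Rep_ell2 (a \<cdot> \<xi>) = F (Rep_ell2 \<xi>)"
  shows "bop_of F = a"
  unfolding bop_of_def
proof (rule the_equality)
  show "b = a" if "\<forall>\<xi>. Rep_ell2 (b \<cdot> \<xi>) = F (Rep_ell2 \<xi>)" for b
    using that assms by (intro bop_eqI) (metis Rep_ell2_inject)
qed (use assms in blast)


section \<open>Weighted composition operators\<close>

definition wcomp :: "('i \<Rightarrow> complex) \<Rightarrow> ('i \<Rightarrow> 'j) \<Rightarrow> 'j ell2 \<Rightarrow> 'i ell2"
  where "wcomp g \<sigma> \<xi> = Abs_ell2 (\<lambda>i. g i * Rep_ell2 \<xi> (\<sigma> i))"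

lemma wcomp_bounded:
  assumes "inj_on \<sigma> {i. g i \<noteq> 0}" and g: "\<And>i. cmod (g i) \<le> K" and "0 \<le> K"
  shows Rep_wcomp: "Rep_ell2 (wcomp g \<sigma> \<xi>) = (\<lambda>i. g i * Rep_ell2 \<xi> (\<sigma> i))"
    and norm_wcomp_le: "norm (wcomp g \<sigma> \<xi>) \<le> K * norm \<xi>"
proof -
  have *: "(\<Sum>i\<in>F. (cmod (g i * Rep_ell2 \<xi> (\<sigma> i)))\<^sup>2) \<le> (K * norm \<xi>)\<^sup>2" if "finite F" for F
  proof -
    have inj: "inj_on \<sigma> {i\<in>F. g i \<noteq> 0}" using assms(1) by (rule inj_on_subset) auto
    have "(\<Sum>i\<in>F. (cmod (g i * Rep_ell2 \<xi> (\<sigma> i)))\<^sup>2)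
        = (\<Sum>i\<in>{i\<in>F. g i \<noteq> 0}. (cmod (g i * Rep_ell2 \<xi> (\<sigma> i)))\<^sup>2)"
      by (rule sum.mono_neutral_right) (use that in auto)
    also have "\<dots> \<le> (\<Sum>i\<in>{i\<in>F. g i \<noteq> 0}. K\<^sup>2 * (cmod (Rep_ell2 \<xi> (\<sigma> i)))\<^sup>2)"
      using g by (intro sum_mono) (auto simp: norm_mult power_mult_distrib intro!: mult_right_mono power_mono)
    also have "\<dots> = K\<^sup>2 * (\<Sum>j\<in>\<sigma> ` {i\<in>F. g i \<noteq> 0}. (cmod (Rep_ell2 \<xi> j))\<^sup>2)"
      by (simp add: sum.reindex[OF inj] o_def flip: sum_distrib_left)
    also have "\<dots> \<le> K\<^sup>2 * (norm \<xi>)\<^sup>2"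
      using that by (intro mult_left_mono ell2_sum_le) auto
    finally show ?thesis by (simp add: power_mult_distrib)
  qed
  have "0 \<le> K * norm \<xi>" using \<open>0 \<le> K\<close> by simp
  note ell2_of_finite_sums[OF this *]
  then show "Rep_ell2 (wcomp g \<sigma> \<xi>) = (\<lambda>i. g i * Rep_ell2 \<xi> (\<sigma> i))"
    "norm (wcomp g \<sigma> \<xi>) \<le> K * norm \<xi>"
    by (simp_all add: wcomp_def)
qed

text \<open>The adjoint of a weighted composition operator composes with the inverse map.\<close>

lemma cinner_wcomp:
  assumes g: "\<And>i. g i \<noteq> 0 \<Longrightarrow> h (\<sigma> i) = cnj (g i) \<and> \<tau> (\<sigma> i) = i"
    and h: "\<And>j. h j \<noteq> 0 \<Longrightarrow> g (\<tau> j) = cnj (h j) \<and> \<sigma> (\<tau> j) = j"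
    and bg: "\<And>i. cmod (g i) \<le> K" and "0 \<le> K"
  shows "cinner (wcomp g \<sigma> \<xi>) \<eta> = cinner \<xi> (wcomp h \<tau> \<eta>)"
proof -
  have bh: "cmod (h j) \<le> K" for j
    using h[of j] bg[of "\<tau> j"] \<open>0 \<le> K\<close> by (cases "h j = 0") auto
  have i: "inj_on \<sigma> {i. g i \<noteq> 0}" "inj_on \<tau> {j. h j \<noteq> 0}"
    by (rule inj_on_inverseI[of _ \<tau>], use g in simp) (rule inj_on_inverseI[of _ \<sigma>], use h in simp)
  have bij: "bij_betw \<sigma> {i. g i \<noteq> 0} {j. h j \<noteq> 0}"
    by (rule bij_betw_byWitness[of _ \<tau>]) (use g h in force)+
  have "cinner (wcomp g \<sigma> \<xi>) \<eta> = (\<Sum>\<^sub>\<infinity>i. cnj (g i * Rep_ell2 \<xi> (\<sigma> i)) * Rep_ell2 \<eta> i)"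
    by (simp add: cinner.rep_eq Rep_wcomp[OF i(1) bg \<open>0 \<le> K\<close>])
  also have "\<dots> = (\<Sum>\<^sub>\<infinity>i\<in>{i. g i \<noteq> 0}.
      cnj (Rep_ell2 \<xi> (\<sigma> i)) * (h (\<sigma> i) * Rep_ell2 \<eta> (\<tau> (\<sigma> i))))"
    by (rule infsum_cong_neutral) (auto simp: g)
  also have "\<dots> = (\<Sum>\<^sub>\<infinity>j\<in>{j. h j \<noteq> 0}. cnj (Rep_ell2 \<xi> j) * (h j * Rep_ell2 \<eta> (\<tau> j)))"
    by (rule infsum_reindex_bij_betw[OF bij])
  also have "\<dots> = (\<Sum>\<^sub>\<infinity>j. cnj (Rep_ell2 \<xi> j) * (h j * Rep_ell2 \<eta> (\<tau> j)))"
    by (rule infsum_cong_neutral) auto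
  also have "\<dots> = cinner \<xi> (wcomp h \<tau> \<eta>)"
    by (simp add: cinner.rep_eq Rep_wcomp[OF i(2) bh \<open>0 \<le> K\<close>])
  finally show ?thesis .
qed

lemma ex_wcomp_bop:
  fixes \<sigma> \<tau> :: "'i \<Rightarrow> 'i"
  assumes g: "\<And>i. g i \<noteq> 0 \<Longrightarrow> h (\<sigma> i) = cnj (g i) \<and> \<tau> (\<sigma> i) = i"
    and h: "\<And>j. h j \<noteq> 0 \<Longrightarrow> g (\<tau> j) = cnj (h j) \<and> \<sigma> (\<tau> j) = j"
    and bg: "\<And>i. cmod (g i) \<le> K" and "0 \<le> K"
  shows "\<exists>a. (\<forall>\<xi>. Rep_ell2 (a \<cdot> \<xi>) = (\<lambda>i. g i * Rep_ell2 \<xi> (\<sigma> i))) \<and> norm a \<le> K"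
proof -
  have i: "inj_on \<sigma> {i. g i \<noteq> 0}"
    by (rule inj_on_inverseI[of _ \<tau>]) (use g in simp)
  note w = wcomp_bounded[OF i bg \<open>0 \<le> K\<close>]
  obtain a where a: "\<And>\<xi>. a \<cdot> \<xi> = wcomp g \<sigma> \<xi>"
    using ex_bop_of_adjoint[of "wcomp g \<sigma>", OF w(2) cinner_wcomp[of g h \<sigma> \<tau> K]] assms by blast
  have "norm a \<le> K" using \<open>0 \<le> K\<close> by (rule norm_bop_leI) (simp add: a w(2))
  then show ?thesis using a w(1) by metis
qed

section \<open>Operators acting fibrewise\<close>

definition fibre :: "('k \<times> 'j) ell2 \<Rightarrow> 'k \<Rightarrow> 'j ell2"
  where "fibre \<xi> k = wcomp (\<lambda>_. 1) (\<lambda>j. (k, j)) \<xi>"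

lemma Rep_fibre: "Rep_ell2 (fibre \<xi> k) j = Rep_ell2 \<xi> (k, j)"
proof -
  have "inj_on (\<lambda>j. (k, j)) {i. (1::complex) \<noteq> 0}" by (auto intro: inj_onI)
  from Rep_wcomp[OF this, of 1 \<xi>] show ?thesis by (simp add: fibre_def)
qed

lemma sum_norm_fibre_le:
  assumes "finite A"
  shows "(\<Sum>k\<in>A. (norm (fibre \<xi> k))\<^sup>2) \<le> (norm \<xi>)\<^sup>2"
proof -
  have s: "(\<lambda>p. (cmod (Rep_ell2 \<xi> p))\<^sup>2) summable_on UNIV"
    using Rep_ell2[of \<xi>] by simp
  have sA: "(\<lambda>p. (cmod (Rep_ell2 \<xi> p))\<^sup>2) summable_on (A \<times> UNIV)"
    using s by (rule summable_on_subset_banach) simp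
  have "(\<Sum>k\<in>A. (norm (fibre \<xi> k))\<^sup>2) = (\<Sum>\<^sub>\<infinity>k\<in>A. \<Sum>\<^sub>\<infinity>j. (cmod (Rep_ell2 \<xi> (k, j)))\<^sup>2)"
    using assms by (simp add: norm_ell2_sq Rep_fibre)
  also have "\<dots> = (\<Sum>\<^sub>\<infinity>p\<in>A \<times> UNIV. (cmod (Rep_ell2 \<xi> p))\<^sup>2)"
    by (rule infsum_Sigma_banach[OF sA])
  also have "\<dots> \<le> (\<Sum>\<^sub>\<infinity>p. (cmod (Rep_ell2 \<xi> p))\<^sup>2)"
    by (rule infsum_mono_neutral[OF sA s]) auto
  finally show ?thesis by (simp add: norm_ell2_sq)
qed

lemma cinner_eq_infsum_fibre: "cinner \<xi> \<eta> = (\<Sum>\<^sub>\<infinity>k. cinner (fibre \<xi> k) (fibre \<eta> k))"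
proof -
  have "(\<Sum>\<^sub>\<infinity>k. \<Sum>\<^sub>\<infinity>j. cnj (Rep_ell2 \<xi> (k, j)) * Rep_ell2 \<eta> (k, j))
      = (\<Sum>\<^sub>\<infinity>p\<in>UNIV \<times> UNIV. cnj (Rep_ell2 \<xi> p) * Rep_ell2 \<eta> p)"
    using cinner_summable[of \<xi> \<eta>] by (intro infsum_Sigma_banach) simp
  then show ?thesis by (simp add: cinner.rep_eq Rep_fibre)
qed

definition fibre_op :: "('k \<Rightarrow> 'j bop) \<Rightarrow> ('k \<times> 'j) bop"
  where "fibre_op b = bop_of (\<lambda>\<xi> (k, j). Rep_ell2 (b k \<cdot> Abs_ell2 (\<lambda>j. \<xi> (k, j))) j)"

lemma Abs_ell2_slice: "Abs_ell2 (\<lambda>j. Rep_ell2 \<xi> (k, j)) = fibre \<xi> k"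
  by (simp add: fibre_def wcomp_def)

lemma fibre_op_bounded:
  assumes b: "\<And>k. norm (b k) \<le> K"
  shows fibre_fibre_op: "fibre (fibre_op b \<cdot> \<xi>) k = b k \<cdot> fibre \<xi> k"
    and norm_fibre_op_le: "norm (fibre_op b) \<le> K"
proof -
  have K: "0 \<le> K" using b norm_ge_zero order_trans by blast
  define A where "A = (\<lambda>(c :: 'a \<Rightarrow> 'b bop) \<xi>. Abs_ell2 (\<lambda>(k, j). Rep_ell2 (c k \<cdot> fibre \<xi> k) j))"
  have *: "(\<Sum>p\<in>F. (cmod (case p of (k, j) \<Rightarrow> Rep_ell2 (c k \<cdot> fibre \<xi> k) j))\<^sup>2) \<le> (K * norm \<xi>)\<^sup>2"
    if "finite F" and c: "\<And>k. norm (c k) \<le> K" for F and c :: "'a \<Rightarrow> 'b bop" and \<xi>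
  proof -
    have "(\<Sum>p\<in>F. (cmod (case p of (k, j) \<Rightarrow> Rep_ell2 (c k \<cdot> fibre \<xi> k) j))\<^sup>2)
        \<le> (\<Sum>p\<in>fst ` F \<times> snd ` F. (cmod (case p of (k, j) \<Rightarrow> Rep_ell2 (c k \<cdot> fibre \<xi> k) j))\<^sup>2)"
      by (rule sum_mono2) (use \<open>finite F\<close> in \<open>auto simp: image_iff split: prod.splits\<close>, force+)
    also have "\<dots> = (\<Sum>k\<in>fst ` F. \<Sum>j\<in>snd ` F. (cmod (Rep_ell2 (c k \<cdot> fibre \<xi> k) j))\<^sup>2)"
      by (simp add: sum.cartesian_product split_def)
    also have "\<dots> \<le> (\<Sum>k\<in>fst ` F. (norm (c k \<cdot> fibre \<xi> k))\<^sup>2)"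
      using \<open>finite F\<close> by (intro sum_mono ell2_sum_le) simp
    also have "\<dots> \<le> (\<Sum>k\<in>fst ` F. K\<^sup>2 * (norm (fibre \<xi> k))\<^sup>2)"
    proof (rule sum_mono)
      fix k
      have "norm (c k \<cdot> fibre \<xi> k) \<le> K * norm (fibre \<xi> k)"
        by (rule order_trans[OF norm_bop_apply]) (intro mult_right_mono c norm_ge_zero)
      then have "(norm (c k \<cdot> fibre \<xi> k))\<^sup>2 \<le> (K * norm (fibre \<xi> k))\<^sup>2"
        by (intro power_mono) auto
      then show "(norm (c k \<cdot> fibre \<xi> k))\<^sup>2 \<le> K\<^sup>2 * (norm (fibre \<xi> k))\<^sup>2"
        by (simp add: power_mult_distrib)
    qed
    also have "\<dots> \<le> K\<^sup>2 * (norm \<xi>)\<^sup>2"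
      using \<open>finite F\<close> by (simp add: sum_norm_fibre_le mult_left_mono flip: sum_distrib_left)
    finally show ?thesis by (simp add: power_mult_distrib)
  qed
  have A: "Rep_ell2 (A c \<xi>) = (\<lambda>(k, j). Rep_ell2 (c k \<cdot> fibre \<xi> k) j)" "norm (A c \<xi>) \<le> K * norm \<xi>"
    if c: "\<And>k. norm (c k) \<le> K" for c \<xi>
    using ell2_of_finite_sums[of "K * norm \<xi>", OF _ *[OF _ c]] K by (simp_all add: A_def)
  have fA: "fibre (A c \<xi>) k = c k \<cdot> fibre \<xi> k" if c: "\<And>k. norm (c k) \<le> K" for c \<xi> k
    by (rule ell2_eqI) (simp add: Rep_fibre A(1)[OF c])
  have sb: "norm (star (b k)) \<le> K" for k
    by (simp add: star_bop_def norm_bop_star b)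
  have "cinner (A b \<xi>) \<eta> = cinner \<xi> (A (\<lambda>k. star (b k)) \<eta>)" for \<xi> \<eta>
    unfolding cinner_eq_infsum_fibre[of _ \<eta>] cinner_eq_infsum_fibre[of \<xi>] fA[of b, OF b]
      fA[of "\<lambda>k. star (b k)", OF sb] cinner_star_right ..
  then obtain a where a: "\<And>\<xi>. a \<cdot> \<xi> = A b \<xi>"
    using ex_bop_of_adjoint[of "A b" K, OF A(2)[OF b]] by blast
  have "fibre_op b = a"
    unfolding fibre_op_def by (rule bop_of_eqI) (simp add: a A(1)[OF b] Abs_ell2_slice)
  then show "fibre (fibre_op b \<cdot> \<xi>) k = b k \<cdot> fibre \<xi> k" "norm (fibre_op b) \<le> K"
    using a fA[OF b] A(2)[OF b] K by (auto intro: norm_bop_leI)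
qed

lemma fibre_eqI: "(\<And>k. fibre \<xi> k = fibre \<eta> k) \<Longrightarrow> \<xi> = \<eta>"
  by (rule ell2_eqI) (metis Rep_fibre prod.collapse)

lemma fibre_op_eqI:
  assumes "\<And>k. norm (b k) \<le> K" and "\<And>\<xi> k. fibre (a \<cdot> \<xi>) k = b k \<cdot> fibre \<xi> k"
  shows "fibre_op b = a"
  by (intro bop_eqI fibre_eqI) (simp add: fibre_fibre_op[OF assms(1)] assms(2))

lemma fibre_op_mult:
  assumes "\<And>k. norm (b k) \<le> K" and "\<And>k. norm (c k) \<le> L"
  shows "fibre_op b * fibre_op c = fibre_op (\<lambda>k. b k * c k)"
proof (rule fibre_op_eqI[symmetric])
  show "norm (b k * c k) \<le> K * L" for k
    by (rule order_trans[OF norm_mult_ineq])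
      (intro mult_mono assms norm_ge_zero order_trans[OF norm_ge_zero assms(1)])
qed (simp add: bop_apply_simps fibre_fibre_op[OF assms(1)] fibre_fibre_op[OF assms(2)])

lemma fibre_op_star:
  assumes b: "\<And>k. norm (b k) \<le> K"
  shows "star (fibre_op b) = fibre_op (\<lambda>k. star (b k))"
proof (intro bop_eqI cinner_eqI)
  have sb: "norm (star (b k)) \<le> K" for k
    by (simp add: star_bop_def norm_bop_star b)
  show "cinner \<zeta> (star (fibre_op b) \<cdot> \<xi>) = cinner \<zeta> (fibre_op (\<lambda>k. star (b k)) \<cdot> \<xi>)" for \<zeta> \<xi>
    unfolding cinner_star_right cinner_eq_infsum_fibre[of _ \<xi>] cinner_eq_infsum_fibre[of \<zeta>]
      fibre_fibre_op[OF b] fibre_fibre_op[of "\<lambda>k. star (b k)", OF sb] ..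
qed


section \<open>Square roots of positive operators\<close>

lemma norm_star: "norm (star a) = norm (a :: 'a::cstar_algebra)"
proof -
  have *: "norm a \<le> norm (star a)" for a :: 'a
  proof (cases "norm a = 0")
    case False
    have "norm a * norm a \<le> norm (star a) * norm a"
      using cstar_identity[of a] norm_mult_ineq[of "star a" a] by (simp add: power2_eq_square)
    then show ?thesis using False by simp
  qed simp
  show ?thesis using *[of a] *[of "star a"] by (simp add: star_star)
qed

lemma bounded_linear_star: "bounded_linear (star :: 'a::cstar_algebra \<Rightarrow> 'a)"
  by (rule bounded_linear_intro[of _ 1])
    (simp_all add: star_add scaleR_scaleC star_scaleC norm_star)

lemma star_diff: "star (a - b) = star a - star (b :: 'a::cstar_algebra)"
  by (rule linear_diff[OF bounded_linear.linear[OF bounded_linear_star]])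

instantiation bop :: (type) real_normed_algebra_1
begin

lift_definition one_bop :: "'a bop" is id_blinfun
  by (auto intro!: exI[of _ id_blinfun])

instance
proof
  have one: "1 \<cdot> \<xi> = \<xi>" for \<xi> :: "'a ell2"
    by transfer simp
  fix a :: "'a bop"
  show "1 * a = a" "a * 1 = a"
    by (rule bop_eqI, simp add: bop_apply_simps one)+
  obtain i :: 'a where True by simp
  have "Rep_ell2 ((1::'a bop) \<cdot> ket i) i \<noteq> Rep_ell2 ((0::'a bop) \<cdot> ket i) i"
    by (simp add: one bop_apply_zero_left Rep_ket zero_ell2.rep_eq)
  then show n: "(0::'a bop) \<noteq> 1" by metis
  have "norm (1::'a bop) \<le> 1" by (rule norm_bop_leI) (simp_all add: one)
  moreover have "norm (1::'a bop) * norm (1::'a bop) \<ge> norm (1::'a bop)"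
  proof -
    have "(1::'a bop) * 1 = 1" by (rule bop_eqI) (simp add: bop_apply_simps one)
    then show ?thesis using norm_mult_ineq[of "1::'a bop" 1] by simp
  qed
  ultimately show "norm (1::'a bop) = 1" using n by simp
qed

end

lemma one_apply: "1 \<cdot> \<xi> = \<xi>"
  by transfer simp

lemma star_one: "star 1 = (1::'i bop)"
  by (metis mult_1_right star_mult star_star)

text \<open>The binomial coefficients of \<open>sqrt (1 - z)\<close> are absolutely summable: apart from the first one
  they are negative, so their partial sums are controlled by the value of the function as
  \<open>z\<close> tends to \<open>1\<close>.\<close>

lemma summable_sqrt_coefficients:
  "summable (\<lambda>n. \<bar>((1/2::real) gchoose n) * (- 1) ^ n\<bar>)"
proof -
  define \<alpha> where "\<alpha> n = ((1/2::real) gchoose n) * (- 1) ^ n" for n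
  have rec: "\<alpha> (Suc n) = \<alpha> n * ((real n - 1/2) / (real n + 1))" for n
  proof -
    have "((1/2::real) gchoose (Suc n)) = ((1/2) gchoose n) * ((1/2 - real n) / (real n + 1))"
      by (simp add: gbinomial_prod_rev field_simps)
    then have "\<alpha> (Suc n) = ((1/2) gchoose n) * ((1/2 - real n) / (real n + 1)) * (- ((- 1) ^ n))"
      unfolding \<alpha>_def by (simp only: power_Suc mult_minus1)
    also have "\<dots> = \<alpha> n * (- ((1/2 - real n) / (real n + 1)))"
      unfolding \<alpha>_def by simp
    finally show ?thesis by (simp add: minus_divide_left)
  qed
  have neg: "\<alpha> (Suc n) \<le> 0" for n
  proof (induction n)
    case 0
    then show ?case by (simp add: \<alpha>_def)
  next
    case (Suc n)
    then show ?case by (subst rec) (intro mult_nonpos_nonneg divide_nonneg_pos, auto)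
  qed
  have partial: "(\<Sum>n<N. - \<alpha> (Suc n) * x ^ Suc n) \<le> 1" if x: "0 < x" "x < 1" for x and N
  proof -
    have "(\<lambda>n. \<alpha> n * x ^ n) sums ((1 + (- x)) powr (1/2))"
      using gen_binomial_real[of "- x" "1/2"] x
      by (simp add: \<alpha>_def mult.assoc flip: power_mult_distrib)
    then have "(\<lambda>n. - \<alpha> (Suc n) * x ^ Suc n) sums (1 - (1 - x) powr (1/2))"
      using sums_Suc_iff[of "\<lambda>n. \<alpha> n * x ^ n" "(1 - x) powr (1/2) - 1"]
        sums_minus[of "\<lambda>n. \<alpha> (Suc n) * x ^ Suc n" "(1 - x) powr (1/2) - 1"]
      by (simp add: \<alpha>_def)
    then have "(\<Sum>n<N. - \<alpha> (Suc n) * x ^ Suc n) \<le> 1 - (1 - x) powr (1/2)"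
      using sum_le_suminf[of "\<lambda>n. - \<alpha> (Suc n) * x ^ Suc n" "{..<N}"] neg x
      by (simp add: sums_iff mult_nonpos_nonneg)
    then show ?thesis by (meson diff_le_eq le_add_same_cancel1 order_trans powr_ge_zero)
  qed
  have "(\<Sum>n<N. - \<alpha> (Suc n)) \<le> 1" for N
  proof (rule tendsto_upperbound)
    have "((\<lambda>x. \<Sum>n<N. - \<alpha> (Suc n) * x ^ Suc n) \<longlongrightarrow> (\<Sum>n<N. - \<alpha> (Suc n) * 1 ^ Suc n)) (at_left 1)"
      by (intro tendsto_intros)
    then show "((\<lambda>x. \<Sum>n<N. - \<alpha> (Suc n) * x ^ Suc n) \<longlongrightarrow> (\<Sum>n<N. - \<alpha> (Suc n))) (at_left 1)"
      by simp
    have "\<forall>\<^sub>F x in at_left 1. x \<in> {0<..<1::real}"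
      by (rule eventually_at_left_real) simp
    then show "\<forall>\<^sub>F x in at_left 1. (\<Sum>n<N. - \<alpha> (Suc n) * x ^ Suc n) \<le> 1"
      by (rule eventually_mono) (use partial in auto)
  qed simp
  then have "summable (\<lambda>n. - \<alpha> (Suc n))"
    using neg by (intro summableI_nonneg_bounded[of _ 1]) auto
  then have "summable (\<lambda>n. \<bar>\<alpha> (Suc n)\<bar>)"
    using neg by (simp add: abs_of_nonpos)
  then show ?thesis
    by (subst (asm) summable_Suc_iff) (simp add: \<alpha>_def)
qed

text \<open>The root is the binomial series of \<open>sqrt (1 - z)\<close> evaluated at \<open>b\<close>. Its square is a Cauchy
  product, and by Vandermonde's identity the coefficients of the product are the binomial
  coefficients of \<open>(1 - z) ^ 1\<close>, which vanish from degree 2 on.\<close>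

lemma ex_self_adjoint_sqrt:
  fixes b :: "'i bop"
  assumes "star b = b" and "norm b \<le> 1"
  shows "\<exists>r. star r = r \<and> r * r = 1 - b"
proof -
  define \<alpha> where "\<alpha> n = ((1/2::real) gchoose n) * (- 1) ^ n" for n
  define r where "r = (\<Sum>n. \<alpha> n *\<^sub>R b ^ n)"
  have le: "norm (\<alpha> n *\<^sub>R b ^ n) \<le> \<bar>\<alpha> n\<bar>" for n
  proof -
    have "norm (b ^ n) \<le> norm b ^ n" by (rule norm_power_ineq)
    also have "\<dots> \<le> 1" using assms(2) by (simp add: power_le_one)
    finally show ?thesis by (simp add: mult_left_le)
  qed
  have sn: "summable (\<lambda>n. norm (\<alpha> n *\<^sub>R b ^ n))"
    by (rule summable_comparison_test'[OF summable_sqrt_coefficients, of 0])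
      (use le in \<open>simp add: \<alpha>_def\<close>)
  have "star (b ^ n) = b ^ n" for n
    by (induction n) (simp_all add: star_one star_mult assms(1) power_commutes)
  then have sr: "star r = r"
    unfolding r_def using bounded_linear.suminf[OF bounded_linear_star summable_norm_cancel[OF sn]]
    by (simp add: linear_scale[OF bounded_linear.linear[OF bounded_linear_star]])
  have coef: "(\<Sum>i\<le>n. \<alpha> i * \<alpha> (n - i)) = (1 gchoose n) * (- 1) ^ n" for n
  proof -
    have "(\<Sum>i\<le>n. \<alpha> i * \<alpha> (n - i)) = (\<Sum>i\<le>n. ((1/2) gchoose i) * ((1/2) gchoose (n - i)) * (- 1) ^ n)"
      by (rule sum.cong) (simp_all add: \<alpha>_def flip: power_add)
    also have "\<dots> = (1 gchoose n) * (- 1) ^ n"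
      using gbinomial_Vandermonde[of "1/2::real" "1/2" n] by (simp add: atMost_atLeast0 flip: sum_distrib_right)
    finally show ?thesis .
  qed
  have one: "(1::real) gchoose n = (if n \<le> 1 then 1 else 0)" for n
    using binomial_gbinomial[of 1 n, where ?'a = real] by (cases n; cases "n - 1") auto
  have "(\<lambda>n. \<Sum>i\<le>n. (\<alpha> i *\<^sub>R b ^ i) * (\<alpha> (n - i) *\<^sub>R b ^ (n - i))) sums (r * r)"
    unfolding r_def by (rule Cauchy_product_sums[OF sn sn])
  moreover have "(\<Sum>i\<le>n. (\<alpha> i *\<^sub>R b ^ i) * (\<alpha> (n - i) *\<^sub>R b ^ (n - i)))
      = ((1 gchoose n) * (- 1) ^ n) *\<^sub>R b ^ n" for n
    by (simp add: scaleR_left.sum mult.commute flip: coef power_add)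
  moreover have "(\<lambda>n. ((1 gchoose n) * (- 1) ^ n) *\<^sub>R b ^ n)
      sums (\<Sum>n\<in>{0, 1::nat}. ((1 gchoose n) * (- 1) ^ n) *\<^sub>R b ^ n)"
    by (rule sums_finite) (auto simp: one)
  ultimately have "r * r = (\<Sum>n\<in>{0, 1::nat}. ((1 gchoose n) * (- 1) ^ n) *\<^sub>R b ^ n)"
    by (metis (no_types, lifting) sums_cong sums_unique2)
  then have "r * r = 1 - b" by (simp add: one)
  with sr show ?thesis by blast
qed

text \<open>The hypothesis is a quadratic form version of \<open>0 \<le> a \<le> K\<close>. It makes \<open>1 - a / K\<close> a
  contraction, so that \<open>a / K\<close> has a square root by the preceding lemma.\<close>

lemma positiveI_quadratic_form:
  fixes a :: "'i bop"
  assumes "star a = a" and "0 < K" and K: "\<And>\<xi>. (norm (a \<cdot> \<xi>))\<^sup>2 \<le> K * Re (cinner \<xi> (a \<cdot> \<xi>))"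
  shows "positive a"
proof -
  define b where "b = 1 - (complex_of_real (1 / K)) *\<^sub>C a"
  have "norm b \<le> 1"
  proof (rule norm_bop_leI)
    fix \<xi>
    have b: "b \<cdot> \<xi> = \<xi> - (1 / K) *\<^sub>R (a \<cdot> \<xi>)"
      by (simp add: b_def bop_apply_simps one_apply bop_apply_scaleC_left scaleR_scaleC)
    have "(norm (b \<cdot> \<xi>))\<^sup>2 = (norm \<xi>)\<^sup>2 - 2 / K * inner \<xi> (a \<cdot> \<xi>) + (norm (a \<cdot> \<xi>))\<^sup>2 / K\<^sup>2"
      unfolding b power2_norm_eq_inner
      by (simp add: inner_diff inner_commute power2_eq_square algebra_simps)
    also have "(norm (a \<cdot> \<xi>))\<^sup>2 / K\<^sup>2 \<le> 1 / K * inner \<xi> (a \<cdot> \<xi>)"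
    proof -
      have "(norm (a \<cdot> \<xi>))\<^sup>2 / K\<^sup>2 \<le> K * inner \<xi> (a \<cdot> \<xi>) / K\<^sup>2"
        using K[of \<xi>] by (intro divide_right_mono) (auto simp: inner_ell2_def)
      then show ?thesis using \<open>0 < K\<close> by (simp add: power2_eq_square)
    qed
    also have "(norm \<xi>)\<^sup>2 - 2 / K * inner \<xi> (a \<cdot> \<xi>) + 1 / K * inner \<xi> (a \<cdot> \<xi>) \<le> (norm \<xi>)\<^sup>2"
    proof -
      have "0 \<le> K * inner \<xi> (a \<cdot> \<xi>)"
        using K[of \<xi>] zero_le_power2[of "norm (a \<cdot> \<xi>)"] unfolding inner_ell2_def by linarith
      then have "0 \<le> inner \<xi> (a \<cdot> \<xi>)"
        using \<open>0 < K\<close> zero_le_mult_iff[of K] by simp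
      then have "0 \<le> 1 / K * inner \<xi> (a \<cdot> \<xi>)"
        using \<open>0 < K\<close> by (intro mult_nonneg_nonneg) auto
      then show ?thesis by simp
    qed
    finally have "(norm (b \<cdot> \<xi>))\<^sup>2 \<le> (norm \<xi>)\<^sup>2" by simp
    then have "norm (b \<cdot> \<xi>) \<le> norm \<xi>" by (rule power2_le_imp_le) simp
    then show "norm (b \<cdot> \<xi>) \<le> 1 * norm \<xi>" by simp
  qed simp
  moreover have "star b = b"
    by (simp add: b_def star_diff star_one star_scaleC assms(1))
  ultimately obtain r where r: "star r = r" "r * r = 1 - b"
    using ex_self_adjoint_sqrt by blast
  have "star (complex_of_real (sqrt K) *\<^sub>C r) * (complex_of_real (sqrt K) *\<^sub>C r)
      = complex_of_real K *\<^sub>C (r * r)"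
    using \<open>0 < K\<close> by (simp add: star_scaleC r(1) mult_scaleC_left mult_scaleC_right scaleC_scaleC
      flip: of_real_mult)
  also have "\<dots> = complex_of_real K *\<^sub>C (complex_of_real (1 / K) *\<^sub>C a)"
    unfolding r(2) b_def by simp
  also have "\<dots> = a"
    using \<open>0 < K\<close> by (simp add: scaleC_scaleC scaleC_one flip: of_real_mult)
  finally show ?thesis unfolding positive_def by metis
qed


section \<open>Compression to the diagonal blocks of a partition\<close>

definition compress :: "('i \<Rightarrow> 'k) \<Rightarrow> 'i bop \<Rightarrow> 'i bop"
  where "compress \<kappa> a =
    bop_of (\<lambda>\<xi> i. Rep_ell2 (a \<cdot> Abs_ell2 (\<lambda>j. if \<kappa> j = \<kappa> i then \<xi> j else 0)) i)"

text \<open>The compression factors through \<open>\<ell>\<^sup>2('k \<times> 'i)\<close>: put the restriction of a vector to the block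
  \<open>k\<close> into the fibre over \<open>k\<close>, apply \<open>a\<close> in every fibre, and go back.\<close>

definition spread :: "('i \<Rightarrow> 'k) \<Rightarrow> 'i ell2 \<Rightarrow> ('k \<times> 'i) ell2"
  where "spread \<kappa> = wcomp (\<lambda>(k, i). if \<kappa> i = k then 1 else 0) snd"

definition gather :: "('i \<Rightarrow> 'k) \<Rightarrow> ('k \<times> 'i) ell2 \<Rightarrow> 'i ell2"
  where "gather \<kappa> = wcomp (\<lambda>_. 1) (\<lambda>i. (\<kappa> i, i))"

lemma Rep_spread: "Rep_ell2 (spread \<kappa> \<xi>) (k, i) = (if \<kappa> i = k then Rep_ell2 \<xi> i else 0)"
  and norm_spread_le: "norm (spread \<kappa> \<xi>) \<le> norm \<xi>"
proof -
  have "inj_on snd {p. (case p of (k, i) \<Rightarrow> if \<kappa> i = k then 1 else 0) \<noteq> (0::complex)}"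
    by (auto simp: inj_on_def split: prod.splits if_splits)
  from wcomp_bounded[OF this, of 1 \<xi>]
  show "Rep_ell2 (spread \<kappa> \<xi>) (k, i) = (if \<kappa> i = k then Rep_ell2 \<xi> i else 0)"
    "norm (spread \<kappa> \<xi>) \<le> norm \<xi>"
    by (auto simp: spread_def split: prod.splits)
qed

lemma Rep_gather: "Rep_ell2 (gather \<kappa> \<eta>) i = Rep_ell2 \<eta> (\<kappa> i, i)"
  and norm_gather_le: "norm (gather \<kappa> \<eta>) \<le> norm \<eta>"
proof -
  have "inj_on (\<lambda>i. (\<kappa> i, i)) {i. (1::complex) \<noteq> 0}"
    by (auto simp: inj_on_def)
  from wcomp_bounded[OF this, of 1 \<eta>]
  show "Rep_ell2 (gather \<kappa> \<eta>) i = Rep_ell2 \<eta> (\<kappa> i, i)" "norm (gather \<kappa> \<eta>) \<le> norm \<eta>"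
    by (auto simp: gather_def)
qed

lemma cinner_gather: "cinner (gather \<kappa> \<eta>) \<xi> = cinner \<eta> (spread \<kappa> \<xi>)"
  unfolding gather_def spread_def by (rule cinner_wcomp[of _ _ _ _ 1]) (auto split: if_splits)

lemma cinner_spread: "cinner (spread \<kappa> \<xi>) \<eta> = cinner \<xi> (gather \<kappa> \<eta>)"
  by (metis cinner_commute cinner_gather)

lemma compress_apply: "compress \<kappa> a \<cdot> \<xi> = gather \<kappa> (fibre_op (\<lambda>_. a) \<cdot> spread \<kappa> \<xi>)"
proof -
  define A where "A = (\<lambda>b \<xi>. gather \<kappa> (fibre_op (\<lambda>_. b) \<cdot> spread \<kappa> \<xi>))"
  have "norm (A a \<xi>) \<le> norm a * norm \<xi>" for \<xi>
  proof -
    have "norm (A a \<xi>) \<le> norm (fibre_op (\<lambda>_. a) :: ('b \<times> 'a) bop) * norm (spread \<kappa> \<xi>)"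
      unfolding A_def by (rule order_trans[OF norm_gather_le norm_bop_apply])
    also have "\<dots> \<le> norm a * norm \<xi>"
      by (intro mult_mono norm_fibre_op_le norm_spread_le norm_ge_zero order_refl)
    finally show ?thesis .
  qed
  moreover have "cinner (A a \<xi>) \<eta> = cinner \<xi> (A (star a) \<eta>)" for \<xi> \<eta>
    by (simp add: A_def cinner_gather flip: cinner_spread cinner_star_right fibre_op_star[OF order_refl])
  ultimately obtain c where c: "\<And>\<xi>. c \<cdot> \<xi> = A a \<xi>"
    using ex_bop_of_adjoint[of "A a"] by blast
  have "fibre (spread \<kappa> \<xi>) k = Abs_ell2 (\<lambda>i. if \<kappa> i = k then Rep_ell2 \<xi> i else 0)" for \<xi> k
    by (simp add: Rep_spread flip: Abs_ell2_slice)
  then have "compress \<kappa> a = c"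
    unfolding compress_def
    by (intro bop_of_eqI) (simp add: c A_def fun_eq_iff Rep_gather fibre_fibre_op[OF order_refl]
      flip: Rep_fibre)
  then show ?thesis by (simp add: c A_def)
qed

lemma entry_compress: "entry (compress \<kappa> a) i j = (if \<kappa> i = \<kappa> j then entry a i j else 0)"
proof -
  have "fibre (spread \<kappa> (ket j)) k = (if \<kappa> j = k then ket j else 0)" for k
    by (rule ell2_eqI) (auto simp: Rep_fibre Rep_spread Rep_ket zero_ell2.rep_eq)
  moreover have "a \<cdot> 0 = 0"
    by (metis bop_apply_add_right add_cancel_left_left)
  ultimately show ?thesis
    by (simp add: entry_def compress_apply Rep_gather fibre_fibre_op[OF order_refl] zero_ell2.rep_eq
      flip: Rep_fibre)
qed

lemma norm_compress_le: "norm (compress \<kappa> a) \<le> norm a"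
proof (rule norm_bop_leI)
  fix \<xi>
  have "norm (compress \<kappa> a \<cdot> \<xi>) \<le> norm (fibre_op (\<lambda>_. a) :: ('b \<times> 'a) bop) * norm (spread \<kappa> \<xi>)"
    unfolding compress_apply by (rule order_trans[OF norm_gather_le norm_bop_apply])
  also have "\<dots> \<le> norm a * norm \<xi>"
    by (intro mult_mono norm_fibre_op_le norm_spread_le norm_ge_zero order_refl)
  finally show "norm (compress \<kappa> a \<cdot> \<xi>) \<le> norm a * norm \<xi>" .
qed simp

lemma compress_add: "compress \<kappa> (a + b) = compress \<kappa> a + compress \<kappa> b"
  and compress_scaleC: "compress \<kappa> (c *\<^sub>C a) = c *\<^sub>C compress \<kappa> a"
  and compress_diff: "compress \<kappa> (a - b) = compress \<kappa> a - compress \<kappa> b"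
  and compress_star: "compress \<kappa> (star a) = star (compress \<kappa> a)"
  by (rule bop_eqI_entry, simp add: entry_compress entry_add entry_scaleC entry_diff entry_star)+

lemma compress_eq_self: "(\<And>i j. \<kappa> i \<noteq> \<kappa> j \<Longrightarrow> entry b i j = 0) \<Longrightarrow> compress \<kappa> b = b"
  by (rule bop_eqI_entry) (auto simp: entry_compress)

text \<open>For \<open>a = star c * c\<close> the quadratic form of the compression at \<open>\<xi>\<close> is the squared norm of
  the vector obtained by letting \<open>c\<close> act on each of the blocks of \<open>\<xi>\<close> in its own fibre. This does not
  exhibit the compression as \<open>star d * d\<close> with \<open>d\<close> acting on the original space, which is why a square
  root is taken.\<close>

lemma positive_compress:
  assumes "positive a"
  shows "positive (compress \<kappa> a)"
proof -
  obtain c where c: "a = star c * c" using assms by (auto simp: positive_def)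
  define F :: "'a bop \<Rightarrow> ('b \<times> 'a) bop" where "F b = fibre_op (\<lambda>_. b)" for b
  have Fa: "F a = star (F c) * F c"
    unfolding F_def c fibre_op_star[OF order_refl] by (rule fibre_op_mult[OF order_refl order_refl, symmetric])
  show ?thesis
  proof (rule positiveI_quadratic_form)
    show "star (compress \<kappa> a) = compress \<kappa> a"
      by (simp add: c star_mult star_star flip: compress_star)
    show "0 < (norm (F c))\<^sup>2 + 1" by (simp add: add_nonneg_pos)
    fix \<xi>
    define \<eta> where "\<eta> = F c \<cdot> spread \<kappa> \<xi>"
    have T: "compress \<kappa> a \<cdot> \<xi> = gather \<kappa> (star (F c) \<cdot> \<eta>)"
      by (simp add: compress_apply Fa bop_apply_simps \<eta>_def flip: F_def)
    have "cinner \<xi> (compress \<kappa> a \<cdot> \<xi>) = cinner \<eta> \<eta>"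
      by (simp add: T \<eta>_def cinner_star_right flip: cinner_spread)
    then have q: "Re (cinner \<xi> (compress \<kappa> a \<cdot> \<xi>)) = (norm \<eta>)\<^sup>2"
      by (simp add: cinner_self flip: of_real_power)
    have "norm (compress \<kappa> a \<cdot> \<xi>) \<le> norm (F c) * norm \<eta>"
      unfolding T using order_trans[OF norm_gather_le norm_bop_apply] by (metis norm_star)
    then have "(norm (compress \<kappa> a \<cdot> \<xi>))\<^sup>2 \<le> (norm (F c) * norm \<eta>)\<^sup>2"
      by (intro power_mono) auto
    also have "\<dots> \<le> ((norm (F c))\<^sup>2 + 1) * (norm \<eta>)\<^sup>2"
      by (simp add: power_mult_distrib mult_right_mono)
    finally show "(norm (compress \<kappa> a \<cdot> \<xi>))\<^sup>2
        \<le> ((norm (F c))\<^sup>2 + 1) * Re (cinner \<xi> (compress \<kappa> a \<cdot> \<xi>))"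
      by (simp add: q)
  qed
qed

text \<open>Row \<open>i\<close> of \<open>b\<close> is supported in the block of \<open>i\<close>. If \<open>i\<close> and \<open>j\<close> lie in one block, only
  entries of \<open>a\<close> within that block contribute to the entry of \<open>b * a\<close> at \<open>(i, j)\<close>, and the compression
  keeps these; otherwise both sides vanish.\<close>

lemma compress_mult_left:
  assumes b: "\<And>i j. \<kappa> i \<noteq> \<kappa> j \<Longrightarrow> entry b i j = 0"
  shows "compress \<kappa> (b * a) = b * compress \<kappa> a"
proof (rule bop_eqI_entry)
  fix i j
  have row: "Rep_ell2 (star b \<cdot> ket i) k = 0" if "\<kappa> k \<noteq> \<kappa> i" for k
    using b[of i k] that by (auto simp: entry_star simp flip: entry_def)
  have e: "entry (b * c) i j = (\<Sum>\<^sub>\<infinity>k. cnj (Rep_ell2 (star b \<cdot> ket i) k) * entry c k j)" for c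
    by (simp add: entry_def bop_apply_simps apply_eq_row[of b] cinner.rep_eq)
  show "entry (compress \<kappa> (b * a)) i j = entry (b * compress \<kappa> a) i j"
  proof (cases "\<kappa> i = \<kappa> j")
    case True
    then show ?thesis
      unfolding entry_compress e by (auto simp: entry_compress row intro!: infsum_cong)
  next
    case False
    then show ?thesis
      unfolding entry_compress e by (auto simp: entry_compress row intro!: infsum_0)
  qed
qed

lemma compress_mult_right:
  assumes b: "\<And>i j. \<kappa> i \<noteq> \<kappa> j \<Longrightarrow> entry b i j = 0"
  shows "compress \<kappa> (a * b) = compress \<kappa> a * b"
proof -
  have "entry (star b) i j = 0" if "\<kappa> i \<noteq> \<kappa> j" for i j
    using b[of j i] that by (simp add: entry_star)
  then have "compress \<kappa> (star b * star a) = star b * compress \<kappa> (star a)"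
    by (rule compress_mult_left)
  then show ?thesis
    by (metis compress_star star_mult star_star)
qed


section \<open>Isometric correspondences between dense *-subalgebras\<close>

text \<open>Along a sequence of pairs the two components have the same distances, so the second components
  form a Cauchy sequence as soon as the first ones converge.\<close>

lemma closure_relation_lift:
  fixes R :: "('a::cstar_algebra \<times> 'b::cstar_algebra) set"
  assumes diff: "\<And>p q. p \<in> R \<Longrightarrow> q \<in> R \<Longrightarrow> p - q \<in> R"
    and norm: "\<And>p. p \<in> R \<Longrightarrow> norm (fst p) = norm (snd p)"
  shows closure_relation_total: "x \<in> closure (fst ` R) \<Longrightarrow> \<exists>y. (x, y) \<in> closure R"
    and closure_relation_norm: "p \<in> closure R \<Longrightarrow> norm (fst p) = norm (snd p)"
proof -
  assume "x \<in> closure (fst ` R)"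
  then obtain u where u: "\<And>n. u n \<in> fst ` R" "u \<longlonglongrightarrow> x"
    unfolding closure_sequential by blast
  then have "\<forall>n. \<exists>r. r \<in> R \<and> fst r = u n" by fastforce
  then obtain r where r: "\<And>n. r n \<in> R" "\<And>n. fst (r n) = u n" by metis
  have d: "norm (snd (r m) - snd (r n)) = norm (u m - u n)" for m n
    using norm[OF diff[OF r(1)[of m] r(1)[of n]]] r(2) by simp
  have "Cauchy u" using u(2) by (rule LIMSEQ_imp_Cauchy)
  then have "Cauchy (\<lambda>n. snd (r n))" unfolding Cauchy_iff d .
  then obtain y where y: "(\<lambda>n. snd (r n)) \<longlonglongrightarrow> y"
    by (auto simp: Cauchy_convergent_iff convergent_def)
  have "(\<lambda>n. (fst (r n), snd (r n))) \<longlonglongrightarrow> (x, y)"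
    using u(2) y by (intro tendsto_Pair) (simp_all add: r(2))
  then show "\<exists>y. (x, y) \<in> closure R"
    using r(1) unfolding closure_sequential by auto
next
  assume "p \<in> closure R"
  then obtain r where r: "\<And>n. r n \<in> R" "r \<longlonglongrightarrow> p"
    unfolding closure_sequential by blast
  have "(\<lambda>n. norm (fst (r n))) \<longlonglongrightarrow> norm (fst p)" "(\<lambda>n. norm (snd (r n))) \<longlonglongrightarrow> norm (snd p)"
    using r(2) by (intro tendsto_norm tendsto_fst tendsto_snd; assumption)+
  then show "norm (fst p) = norm (snd p)"
    using norm[OF r(1)] by (simp add: LIMSEQ_unique)
qed

lemma bounded_linear_scaleC: "bounded_linear (\<lambda>a :: 'a::cstar_algebra. c *\<^sub>C a)"
  by (rule bounded_linear_intro[of _ "cmod c"])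
    (simp_all add: scaleC_add_right scaleR_scaleC scaleC_scaleC norm_scaleC mult.commute)

text \<open>The closure of an isometric *-isomorphism between dense *-subalgebras, regarded as a set of
  pairs, is the graph of an isomorphism of their closures.\<close>

lemma cstar_isomorphic_closure:
  fixes R :: "('a::cstar_algebra \<times> 'b::cstar_algebra) set"
  assumes add: "\<And>a b a' b'. (a, b) \<in> R \<Longrightarrow> (a', b') \<in> R \<Longrightarrow> (a + a', b + b') \<in> R"
    and mult: "\<And>a b a' b'. (a, b) \<in> R \<Longrightarrow> (a', b') \<in> R \<Longrightarrow> (a * a', b * b') \<in> R"
    and scale: "\<And>a b c. (a, b) \<in> R \<Longrightarrow> (c *\<^sub>C a, c *\<^sub>C b) \<in> R"
    and star: "\<And>a b. (a, b) \<in> R \<Longrightarrow> (star a, star b) \<in> R"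
    and norm: "\<And>a b. (a, b) \<in> R \<Longrightarrow> norm a = norm b"
  shows "cstar_isomorphic (closure (fst ` R)) (closure (snd ` R))"
proof -
  define Q where "Q = closure R"
  have uminus: "- a = (- 1) *\<^sub>C a" for a :: "'c::cstar_algebra"
    using scaleR_scaleC[of "- 1", where ?'a = 'c] by (metis of_real_1 of_real_minus scaleR_minus1_left)
  have diff: "p - q \<in> R" if "p \<in> R" "q \<in> R" for p q
  proof -
    have "(fst p + (- 1) *\<^sub>C fst q, snd p + (- 1) *\<^sub>C snd q) \<in> R"
      by (rule add[OF _ scale]) (use that in simp_all)
    then show ?thesis by (simp add: minus_prod_def flip: uminus)
  qed
  have Qseq: "(a, b) \<in> Q \<longleftrightarrow> (\<exists>u v. (\<forall>n. (u n, v n) \<in> R) \<and> u \<longlonglongrightarrow> a \<and> v \<longlonglongrightarrow> b)" for a b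
  proof
    assume "(a, b) \<in> Q"
    then obtain r where "\<And>n. r n \<in> R" "r \<longlonglongrightarrow> (a, b)"
      unfolding Q_def closure_sequential by blast
    then show "\<exists>u v. (\<forall>n. (u n, v n) \<in> R) \<and> u \<longlonglongrightarrow> a \<and> v \<longlonglongrightarrow> b"
      using tendsto_fst[of r "(a, b)"] tendsto_snd[of r "(a, b)"]
      by (intro exI[of _ "\<lambda>n. fst (r n)"] exI[of _ "\<lambda>n. snd (r n)"]) auto
  next
    assume "\<exists>u v. (\<forall>n. (u n, v n) \<in> R) \<and> u \<longlonglongrightarrow> a \<and> v \<longlonglongrightarrow> b"
    then obtain u v where uv: "\<And>n. (u n, v n) \<in> R" "u \<longlonglongrightarrow> a" "v \<longlonglongrightarrow> b" by blast
    then show "(a, b) \<in> Q"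
      unfolding Q_def closure_sequential
      by (intro exI[of _ "\<lambda>n. (u n, v n)"] conjI allI tendsto_Pair)
  qed
  have Qadd: "(a + a', b + b') \<in> Q" and Qmult: "(a * a', b * b') \<in> Q"
    if ab: "(a, b) \<in> Q" and ab': "(a', b') \<in> Q" for a b a' b'
  proof -
    obtain u v u' v' where uv: "\<And>n. (u n, v n) \<in> R" "u \<longlonglongrightarrow> a" "v \<longlonglongrightarrow> b"
      "\<And>n. (u' n, v' n) \<in> R" "u' \<longlonglongrightarrow> a'" "v' \<longlonglongrightarrow> b'"
      using ab ab' unfolding Qseq by blast
    show "(a + a', b + b') \<in> Q" unfolding Qseq
      by (rule exI[of _ "\<lambda>n. u n + u' n"], rule exI[of _ "\<lambda>n. v n + v' n"])
        (intro conjI allI add tendsto_add uv)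
    show "(a * a', b * b') \<in> Q" unfolding Qseq
      by (rule exI[of _ "\<lambda>n. u n * u' n"], rule exI[of _ "\<lambda>n. v n * v' n"])
        (intro conjI allI mult tendsto_mult uv)
  qed
  have Qscale: "(c *\<^sub>C a, c *\<^sub>C b) \<in> Q" and Qstar: "(star a, star b) \<in> Q" if ab: "(a, b) \<in> Q" for a b c
  proof -
    obtain u v where uv: "\<And>n. (u n, v n) \<in> R" "u \<longlonglongrightarrow> a" "v \<longlonglongrightarrow> b"
      using ab unfolding Qseq by blast
    show "(c *\<^sub>C a, c *\<^sub>C b) \<in> Q" unfolding Qseq
      by (rule exI[of _ "\<lambda>n. c *\<^sub>C u n"], rule exI[of _ "\<lambda>n. c *\<^sub>C v n"])
        (intro conjI allI scale bounded_linear.tendsto[OF bounded_linear_scaleC] uv)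
    show "(star a, star b) \<in> Q" unfolding Qseq
      by (rule exI[of _ "\<lambda>n. star (u n)"], rule exI[of _ "\<lambda>n. star (v n)"])
        (intro conjI allI star bounded_linear.tendsto[OF bounded_linear_star] uv)
  qed
  have Qnorm: "norm a = norm b" if "(a, b) \<in> Q" for a b
    using closure_relation_norm[of R "(a, b)"] diff norm that unfolding Q_def by fastforce
  have Qdiff: "(a - a', b - b') \<in> Q" if "(a, b) \<in> Q" "(a', b') \<in> Q" for a b a' b'
    using Qadd[OF that(1) Qscale[OF that(2), of "- 1"]] by (simp flip: uminus)
  have fun1: "b = b'" if "(a, b) \<in> Q" "(a, b') \<in> Q" for a b b'
    using Qnorm[OF Qdiff[OF that]] by simp
  have fun2: "a = a'" if "(a, b) \<in> Q" "(a', b) \<in> Q" for a a' b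
    using Qnorm[OF Qdiff[OF that]] by simp
  have dom: "(\<exists>b. (a, b) \<in> Q) \<longleftrightarrow> a \<in> closure (fst ` R)" for a
  proof
    show "a \<in> closure (fst ` R)" if "\<exists>b. (a, b) \<in> Q"
      using that unfolding Qseq closure_sequential by (metis fst_conv imageI)
    show "\<exists>b. (a, b) \<in> Q" if "a \<in> closure (fst ` R)"
      using closure_relation_total[of R a] diff norm that unfolding Q_def by fastforce
  qed
  have ran: "(\<exists>a. (a, b) \<in> Q) \<longleftrightarrow> b \<in> closure (snd ` R)" for b
  proof
    show "b \<in> closure (snd ` R)" if "\<exists>a. (a, b) \<in> Q"
      using that unfolding Qseq closure_sequential by (metis snd_conv imageI)
    assume b: "b \<in> closure (snd ` R)"
    have "fst ` prod.swap ` R = snd ` R" by (auto simp: image_comp)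
    moreover have "p - q \<in> prod.swap ` R" if "p \<in> prod.swap ` R" "q \<in> prod.swap ` R" for p q
    proof -
      obtain p' q' where "p' \<in> R" "q' \<in> R" "p = prod.swap p'" "q = prod.swap q'" using \<open>p \<in> prod.swap ` R\<close> \<open>q \<in> prod.swap ` R\<close> by auto
      then show ?thesis using diff[of p' q']
        by (intro image_eqI[of _ _ "p' - q'"]) (auto simp: prod_eq_iff)
    qed
    ultimately obtain a where "(b, a) \<in> closure (prod.swap ` R)"
      using closure_relation_total[of "prod.swap ` R" b] norm b by fastforce
    then obtain r where r: "\<And>n. r n \<in> prod.swap ` R" "r \<longlonglongrightarrow> (b, a)"
      unfolding closure_sequential by blast
    have "(a, b) \<in> Q"
      unfolding Qseq
    proof (intro exI conjI allI)
      show "(snd (r n), fst (r n)) \<in> R" for n using r(1)[of n] by auto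
      show "(\<lambda>n. snd (r n)) \<longlonglongrightarrow> a" "(\<lambda>n. fst (r n)) \<longlonglongrightarrow> b"
        using tendsto_fst[OF r(2)] tendsto_snd[OF r(2)] by auto
    qed
    then show "\<exists>a. (a, b) \<in> Q" ..
  qed
  define \<theta> where "\<theta> a = (SOME b. (a, b) \<in> Q)" for a
  have \<theta>Q: "(a, \<theta> a) \<in> Q" if "a \<in> closure (fst ` R)" for a
    using dom that unfolding \<theta>_def by (metis someI_ex)
  have \<theta>eq: "\<theta> a = b" if "(a, b) \<in> Q" for a b
    using fun1[OF \<theta>Q that] dom that by blast
  show ?thesis
    unfolding cstar_isomorphic_def
  proof (intro exI[of _ \<theta>] conjI ballI allI)
    show "bij_betw \<theta> (closure (fst ` R)) (closure (snd ` R))"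
      unfolding bij_betw_def
    proof
      show "inj_on \<theta> (closure (fst ` R))"
        by (rule inj_onI) (metis \<theta>Q fun2)
      show "\<theta> ` closure (fst ` R) = closure (snd ` R)"
      proof (intro equalityI subsetI)
        fix b assume "b \<in> \<theta> ` closure (fst ` R)"
        then show "b \<in> closure (snd ` R)" using \<theta>Q ran by blast
      next
        fix b assume "b \<in> closure (snd ` R)"
        then obtain a where "(a, b) \<in> Q" using ran by blast
        then show "b \<in> \<theta> ` closure (fst ` R)" using \<theta>eq dom by blast
      qed
    qed
    fix a assume a: "a \<in> closure (fst ` R)"
    show "\<theta> (c *\<^sub>C a) = c *\<^sub>C \<theta> a" "\<theta> (star a) = star (\<theta> a)" for c
      by (intro \<theta>eq Qscale Qstar \<theta>Q a)+
    fix b assume b: "b \<in> closure (fst ` R)"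
    show "\<theta> (a + b) = \<theta> a + \<theta> b" "\<theta> (a * b) = \<theta> a * \<theta> b"
      by (intro \<theta>eq Qadd Qmult \<theta>Q a b)+
  qed
qed


section \<open>Polynomial growth of abelian groups\<close>

text \<open>The set \<open>P n\<close> consists of the products of powers of the elements of \<open>S\<close> with exponents at most
  \<open>n\<close>; there are at most \<open>n + 1\<close> choices for each exponent. As the group is abelian, the exponents
  of a product of two such elements add up.\<close>

lemma (in comm_group) polynomial_growth:
  assumes "finite S" and "S \<subseteq> carrier G"
  shows "\<exists>P :: nat \<Rightarrow> 'a set. S \<subseteq> P 1 \<and> (\<forall>n. P n \<subseteq> carrier G \<and> \<one> \<in> P n \<and> finite (P n) \<and>
    card (P n) \<le> (n + 1) ^ card S) \<and> (\<forall>m n. \<forall>x\<in>P m. \<forall>y\<in>P n. x \<otimes> y \<in> P (m + n))"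
  using assms
proof (induction S)
  case empty
  show ?case by (rule exI[of _ "\<lambda>_. {\<one>}"]) simp
next
  case (insert g S)
  then obtain P :: "nat \<Rightarrow> 'a set" where P: "S \<subseteq> P 1" "\<And>n. P n \<subseteq> carrier G" "\<And>n. \<one> \<in> P n"
    "\<And>n. finite (P n)" "\<And>n. card (P n) \<le> (n + 1) ^ card S"
    "\<And>m n x y. x \<in> P m \<Longrightarrow> y \<in> P n \<Longrightarrow> x \<otimes> y \<in> P (m + n)" by auto
  have g: "g \<in> carrier G" using insert.prems by simp
  define P' where "P' n = (\<lambda>(k, h). g [^] k \<otimes> h) ` ({..n} \<times> P n)" for n :: nat
  have P'I: "x \<in> P' n" if "x = g [^] k \<otimes> h" "k \<le> n" "h \<in> P n" for x n h and k :: nat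
    unfolding P'_def using that by (intro image_eqI[of _ _ "(k, h)"]) auto
  have c: "P' n \<subseteq> carrier G" for n
    unfolding P'_def using P(2) g by auto
  have one: "\<one> \<in> P' n" for n
    using g by (intro P'I[of _ 0 "\<one>"] P(3)) auto
  have "card (P' n) \<le> card ({..n} \<times> P n)" for n
    unfolding P'_def by (intro card_image_le) (simp add: P(4))
  then have card: "card (P' n) \<le> (n + 1) ^ card (insert g S)" for n
    using insert.hyps order_trans[OF _ mult_le_mono2[OF P(5)[of n], of "n + 1"]]
    by (simp add: card_cartesian_product)
  have prod: "x \<otimes> y \<in> P' (m + n)" if x: "x \<in> P' m" and y: "y \<in> P' n" for m n x y
  proof -
    obtain k h l h' where h: "h \<in> P m" "h' \<in> P n" "k \<le> m" "l \<le> n" "x = g [^] k \<otimes> h" "y = g [^] l \<otimes> h'"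
      using x y unfolding P'_def by auto
    have hc: "h \<in> carrier G" "h' \<in> carrier G" using h P(2) by auto
    have "x \<otimes> y = g [^] (k + l) \<otimes> (h \<otimes> h')"
      using g hc by (simp add: h m_ac flip: nat_pow_mult)
    then show ?thesis
      using h by (intro P'I[of _ "k + l" "h \<otimes> h'"] P(6)) auto
  qed
  have sub: "insert g S \<subseteq> P' 1"
  proof (rule insert_subsetI)
    show "g \<in> P' 1" using g by (intro P'I[of _ 1 "\<one>"] P(3)) auto
    show "S \<subseteq> P' 1"
    proof
      fix s assume s: "s \<in> S"
      then show "s \<in> P' 1" using insert.prems P(1) by (intro P'I[of _ 0 s]) auto
    qed
  qed
  show ?case
    by (rule exI[of _ P']) (use sub c one card prod P(4) in \<open>auto simp: P'_def\<close>)
qed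


section \<open>Representations of functions on an abelian group with values in C(X)\<close>

text \<open>The element \<open>V f s\<close> represents the function on the group which has the value \<open>f\<close> at \<open>s\<close> and vanishes
  elsewhere; the product is convolution. The last two axioms bound the norm of a finitely supported
  function from above by the sum and from below by the maximum of the norms of its values. These
  crude bounds determine the norm, as is shown below.\<close>

locale coefficient_rep = H: comm_group H for H :: "'g monoid" (structure) +
  fixes V :: "('x::topological_space \<Rightarrow> complex) \<Rightarrow> 'g \<Rightarrow> 'a::cstar_algebra"
  assumes V_add: "\<And>f g s. continuous_on UNIV f \<Longrightarrow> continuous_on UNIV g \<Longrightarrow> s \<in> carrier H \<Longrightarrow>
      V (\<lambda>x. f x + g x) s = V f s + V g s"
    and V_scaleC: "\<And>f c s. continuous_on UNIV f \<Longrightarrow> s \<in> carrier H \<Longrightarrow>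
      V (\<lambda>x. c * f x) s = c *\<^sub>C V f s"
    and V_mult: "\<And>f g s t. continuous_on UNIV f \<Longrightarrow> continuous_on UNIV g \<Longrightarrow> s \<in> carrier H \<Longrightarrow>
      t \<in> carrier H \<Longrightarrow> V f s * V g t = V (\<lambda>x. f x * g x) (s \<otimes> t)"
    and V_star: "\<And>f s. continuous_on UNIV f \<Longrightarrow> s \<in> carrier H \<Longrightarrow>
      star (V f s) = V (\<lambda>x. cnj (f x)) (inv s)"
    and norm_V_le: "\<And>f s M. continuous_on UNIV f \<Longrightarrow> s \<in> carrier H \<Longrightarrow>
      (\<And>x. cmod (f x) \<le> M) \<Longrightarrow> norm (V f s) \<le> M"
    and coefficient_le: "\<And>F S s x. finite S \<Longrightarrow> S \<subseteq> carrier H \<Longrightarrow> (\<And>s. continuous_on UNIV (F s)) \<Longrightarrow>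
      s \<in> S \<Longrightarrow> cmod (F s x) \<le> norm (\<Sum>s\<in>S. V (F s) s)"
begin

lemma V_zero: "s \<in> carrier H \<Longrightarrow> V (\<lambda>_. 0) s = 0"
  using V_scaleC[of "\<lambda>_. 0" s 0] by simp

lemma V_sum:
  assumes "\<And>i. continuous_on UNIV (f i)" and "s \<in> carrier H"
  shows "V (\<lambda>x. \<Sum>i\<in>I. f i x) s = (\<Sum>i\<in>I. V (f i) s)"
  by (induction I rule: infinite_finite_induct)
    (simp_all add: V_zero V_add assms continuous_on_sum)

lemma sum_V_mult:
  assumes F: "\<And>s. continuous_on UNIV (F s)" "\<And>s. continuous_on UNIV (F' s)"
    and "finite S" "S \<subseteq> carrier H" "finite T" "T \<subseteq> carrier H"
  shows "(\<Sum>s\<in>S. V (F s) s) * (\<Sum>t\<in>T. V (F' t) t) = (\<Sum>u\<in>(\<lambda>(s, t). s \<otimes> t) ` (S \<times> T).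
    V (\<lambda>x. \<Sum>p\<in>{p \<in> S \<times> T. (case p of (s, t) \<Rightarrow> s \<otimes> t) = u}. F (fst p) x * F' (snd p) x) u)"
proof -
  let ?m = "\<lambda>(s, t). s \<otimes> t"
  have "(\<Sum>s\<in>S. V (F s) s) * (\<Sum>t\<in>T. V (F' t) t)
      = (\<Sum>p\<in>S \<times> T. V (\<lambda>x. F (fst p) x * F' (snd p) x) (?m p))"
    unfolding sum_product sum.cartesian_product
    by (rule sum.cong) (use assms in \<open>auto simp: V_mult subset_eq\<close>)
  also have "\<dots> = (\<Sum>u\<in>?m ` (S \<times> T). \<Sum>p\<in>{p \<in> S \<times> T. ?m p = u}.
      V (\<lambda>x. F (fst p) x * F' (snd p) x) (?m p))"
    by (rule sum.group[symmetric]) (use assms in auto)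
  also have "\<dots> = (\<Sum>u\<in>?m ` (S \<times> T).
      V (\<lambda>x. \<Sum>p\<in>{p \<in> S \<times> T. ?m p = u}. F (fst p) x * F' (snd p) x) u)"
  proof (rule sum.cong[OF refl])
    fix u assume "u \<in> ?m ` (S \<times> T)"
    then have u: "u \<in> carrier H" using assms by auto
    show "(\<Sum>p\<in>{p \<in> S \<times> T. ?m p = u}. V (\<lambda>x. F (fst p) x * F' (snd p) x) (?m p))
        = V (\<lambda>x. \<Sum>p\<in>{p \<in> S \<times> T. ?m p = u}. F (fst p) x * F' (snd p) x) u"
      by (subst V_sum[OF _ u]) (auto intro!: continuous_intros F)
  qed
  finally show ?thesis .
qed

lemma sum_V_star:
  assumes F: "\<And>s. continuous_on UNIV (F s)" and S: "S \<subseteq> carrier H"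
  shows "star (\<Sum>s\<in>S. V (F s) s) = (\<Sum>u\<in>(\<lambda>s. inv s) ` S. V (\<lambda>x. cnj (F (inv u) x)) u)"
proof -
  have "star (\<Sum>s\<in>S. V (F s) s) = (\<Sum>s\<in>S. star (V (F s) s))"
    by (rule linear_sum[OF bounded_linear.linear[OF bounded_linear_star]])
  also have "\<dots> = (\<Sum>s\<in>S. V (\<lambda>x. cnj (F (inv (inv s)) x)) (inv s))"
    using S by (intro sum.cong) (auto simp: V_star F subset_eq)
  also have "\<dots> = (\<Sum>u\<in>(\<lambda>s. inv s) ` S. V (\<lambda>x. cnj (F (inv u) x)) u)"
    using S by (subst sum.reindex) (auto simp: o_def intro: inj_on_subset[OF H.inv_inj])
  finally show ?thesis .
qed

end

locale coefficient_rep_pair = V: coefficient_rep H V + W: coefficient_rep H W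
  for H :: "'g monoid" (structure)
    and V :: "('x::topological_space \<Rightarrow> complex) \<Rightarrow> 'g \<Rightarrow> 'a::cstar_algebra"
    and W :: "('x \<Rightarrow> complex) \<Rightarrow> 'g \<Rightarrow> 'b::cstar_algebra"
begin

definition pairs :: "'g set \<Rightarrow> ('a \<times> 'b) set"
  where "pairs S =
    {(\<Sum>s\<in>S. V (F s) s, \<Sum>s\<in>S. W (F s) s) | F. \<forall>s. continuous_on UNIV (F s)}"

lemma pairsI: "(\<And>s. continuous_on UNIV (F s)) \<Longrightarrow> (\<Sum>s\<in>S. V (F s) s, \<Sum>s\<in>S. W (F s) s) \<in> pairs S"
  unfolding pairs_def by blast

lemma pairsE:
  assumes "(a, b) \<in> pairs S"
  obtains F where "\<And>s. continuous_on UNIV (F s)" "a = (\<Sum>s\<in>S. V (F s) s)" "b = (\<Sum>s\<in>S. W (F s) s)"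
  using assms unfolding pairs_def by blast

lemma pairs_mono:
  assumes "(a, b) \<in> pairs S" and "S \<subseteq> T" "finite T" "T \<subseteq> carrier H"
  shows "(a, b) \<in> pairs T"
proof -
  obtain F where F: "\<And>s. continuous_on UNIV (F s)" "a = (\<Sum>s\<in>S. V (F s) s)" "b = (\<Sum>s\<in>S. W (F s) s)"
    using pairsE[OF assms(1)] by metis
  let ?F = "\<lambda>s. if s \<in> S then F s else (\<lambda>_. 0)"
  have "continuous_on UNIV (?F s)" for s using F(1) by simp
  then have "(\<Sum>s\<in>T. V (?F s) s, \<Sum>s\<in>T. W (?F s) s) \<in> pairs T" by (rule pairsI)
  moreover have "(\<Sum>s\<in>T. V (?F s) s) = a" "(\<Sum>s\<in>T. W (?F s) s) = b"
    unfolding F(2,3)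
    by (rule sum.mono_neutral_cong_right; use assms in \<open>auto simp: V.V_zero W.V_zero subset_eq\<close>)+
  ultimately show ?thesis by simp
qed

lemma pairs_add:
  assumes "(a, b) \<in> pairs S" and "(a', b') \<in> pairs S" and "S \<subseteq> carrier H"
  shows "(a + a', b + b') \<in> pairs S"
proof -
  obtain F where F: "\<And>s. continuous_on UNIV (F s)" "a = (\<Sum>s\<in>S. V (F s) s)" "b = (\<Sum>s\<in>S. W (F s) s)"
    using pairsE[OF assms(1)] by metis
  obtain F' where F': "\<And>s. continuous_on UNIV (F' s)" "a' = (\<Sum>s\<in>S. V (F' s) s)" "b' = (\<Sum>s\<in>S. W (F' s) s)"
    using pairsE[OF assms(2)] by metis
  have "(\<Sum>s\<in>S. V (\<lambda>x. F s x + F' s x) s, \<Sum>s\<in>S. W (\<lambda>x. F s x + F' s x) s) \<in> pairs S"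
    by (intro pairsI continuous_intros F F')
  moreover have "(\<Sum>s\<in>S. V (\<lambda>x. F s x + F' s x) s) = a + a'" "(\<Sum>s\<in>S. W (\<lambda>x. F s x + F' s x) s) = b + b'"
    unfolding F F' sum.distrib[symmetric]
    by (rule sum.cong; use assms F F' in \<open>auto simp: V.V_add W.V_add\<close>)+
  ultimately show ?thesis by simp
qed

lemma pairs_scaleC:
  assumes "(a, b) \<in> pairs S" and "S \<subseteq> carrier H"
  shows "(c *\<^sub>C a, c *\<^sub>C b) \<in> pairs S"
proof -
  obtain F where F: "\<And>s. continuous_on UNIV (F s)" "a = (\<Sum>s\<in>S. V (F s) s)" "b = (\<Sum>s\<in>S. W (F s) s)"
    using pairsE[OF assms(1)] by metis
  have "(\<Sum>s\<in>S. V (\<lambda>x. c * F s x) s, \<Sum>s\<in>S. W (\<lambda>x. c * F s x) s) \<in> pairs S"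
    by (intro pairsI continuous_intros F)
  moreover have "(\<Sum>s\<in>S. V (\<lambda>x. c * F s x) s) = c *\<^sub>C a" "(\<Sum>s\<in>S. W (\<lambda>x. c * F s x) s) = c *\<^sub>C b"
    unfolding F complex_vector.scale_sum_right
    by (rule sum.cong; use assms F in \<open>auto simp: V.V_scaleC W.V_scaleC\<close>)+
  ultimately show ?thesis by simp
qed

lemma pairs_star:
  assumes "(a, b) \<in> pairs S" and "S \<subseteq> carrier H"
  shows "(star a, star b) \<in> pairs ((\<lambda>s. inv s) ` S)"
proof -
  obtain F where F: "\<And>s. continuous_on UNIV (F s)" "a = (\<Sum>s\<in>S. V (F s) s)" "b = (\<Sum>s\<in>S. W (F s) s)"
    using pairsE[OF assms(1)] by metis
  show ?thesis
    unfolding F(2,3) V.sum_V_star[OF F(1) assms(2)] W.sum_V_star[OF F(1) assms(2)]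
    by (rule pairsI) (intro continuous_intros F)
qed

lemma pairs_mult:
  assumes "(a, b) \<in> pairs S" "finite S" "S \<subseteq> carrier H"
    and "(a', b') \<in> pairs T" "finite T" "T \<subseteq> carrier H"
  shows "(a * a', b * b') \<in> pairs ((\<lambda>(s, t). s \<otimes> t) ` (S \<times> T))"
proof -
  obtain F where F: "\<And>s. continuous_on UNIV (F s)" "a = (\<Sum>s\<in>S. V (F s) s)" "b = (\<Sum>s\<in>S. W (F s) s)"
    using pairsE[OF assms(1)] by metis
  obtain F' where F': "\<And>s. continuous_on UNIV (F' s)" "a' = (\<Sum>s\<in>T. V (F' s) s)" "b' = (\<Sum>s\<in>T. W (F' s) s)"
    using pairsE[OF assms(4)] by metis
  note ST = assms(2,3,5,6)
  show ?thesis
    unfolding F(2,3) F'(2,3) V.sum_V_mult[OF F(1) F'(1) ST] W.sum_V_mult[OF F(1) F'(1) ST]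
    by (rule pairsI) (intro continuous_intros F F')
qed

text \<open>Each norm lies between the largest coefficient and the sum of all coefficients, so the two
  norms differ at most by a factor which is the number of coefficients.\<close>

lemma pairs_norm_le_card:
  assumes "(a, b) \<in> pairs S" and "finite S" "S \<subseteq> carrier H"
  shows "norm a \<le> card S * norm b"
proof -
  obtain F where F: "\<And>s. continuous_on UNIV (F s)" "a = (\<Sum>s\<in>S. V (F s) s)" "b = (\<Sum>s\<in>S. W (F s) s)"
    using pairsE[OF assms(1)] by metis
  have "norm a \<le> (\<Sum>s\<in>S. norm (V (F s) s))" unfolding F by (rule norm_sum)
  also have "\<dots> \<le> (\<Sum>s\<in>S. norm b)"
    by (rule sum_mono) (use assms F W.coefficient_le[of S F] in \<open>auto intro!: V.norm_V_le\<close>)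
  finally show ?thesis by simp
qed

text \<open>For \<open>c = star a * a\<close> the norm of \<open>c ^ 2 ^ k\<close> is a power of the norm of \<open>a\<close>, while
  the number of coefficients of \<open>c ^ 2 ^ k\<close> grows only polynomially in \<open>2 ^ k\<close>. So the factor
  of the preceding lemma disappears in the limit.\<close>

lemma pairs_norm_le:
  assumes ab: "(a, b) \<in> pairs S" and S: "finite S" "S \<subseteq> carrier H"
  shows "norm a \<le> norm b"
proof -
  \<comment> \<open>\<open>S0\<close> carries the coefficients of \<open>star a * a\<close>; \<open>va k\<close> and \<open>vb k\<close> are obtained from
    this element and its counterpart by \<open>k\<close> squarings, and have their coefficients in \<open>P (2 ^ k)\<close>.\<close>
  define S0 where "S0 = (\<lambda>(s, t). s \<otimes> t) ` ((\<lambda>s. inv s) ` S \<times> S)"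
  have S0: "finite S0" "S0 \<subseteq> carrier H" using S by (auto simp: S0_def)
  have c0: "(star a * a, star b * b) \<in> pairs S0"
    unfolding S0_def using S by (intro pairs_mult pairs_star ab) auto
  obtain P :: "nat \<Rightarrow> 'g set" where P: "S0 \<subseteq> P 1" "\<And>n. P n \<subseteq> carrier H" "\<And>n. finite (P n)"
    "\<And>n. card (P n) \<le> (n + 1) ^ card S0"
    "\<And>m n x y. x \<in> P m \<Longrightarrow> y \<in> P n \<Longrightarrow> x \<otimes> y \<in> P (m + n)"
    using V.H.polynomial_growth[OF S0] by metis
  define d where "d = card S0"
  define va where "va k = ((\<lambda>y. y * y) ^^ k) (star a * a)" for k
  define vb where "vb k = ((\<lambda>y. y * y) ^^ k) (star b * b)" for k
  have vS: "va (Suc k) = va k * va k" "vb (Suc k) = vb k * vb k" for k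
    by (simp_all add: va_def vb_def)
  have in_pairs: "(va k, vb k) \<in> pairs (P (2 ^ k))" for k
  proof (induction k)
    case 0
    show ?case using pairs_mono[OF c0 P(1) P(3) P(2)] by (simp add: va_def vb_def)
  next
    case (Suc k)
    have "(va k * va k, vb k * vb k) \<in> pairs ((\<lambda>(s, t). s \<otimes> t) ` (P (2 ^ k) \<times> P (2 ^ k)))"
      by (intro pairs_mult Suc P(2,3))
    moreover have "(\<lambda>(s, t). s \<otimes> t) ` (P (2 ^ k) \<times> P (2 ^ k)) \<subseteq> P (2 ^ Suc k)"
      using P(5)[of _ "2 ^ k" _ "2 ^ k"] by (auto simp: mult_2)
    ultimately show ?case
      unfolding vS using P(3,2) by (rule pairs_mono)
  qed
  have star_va: "star (va k) = va k" "star (vb k) = vb k" for k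
    by (induction k) (simp_all add: vS star_mult, simp_all add: va_def vb_def star_mult star_star)
  have norm_v: "norm (va k) = norm a ^ (2 * 2 ^ k)" "norm (vb k) = norm b ^ (2 * 2 ^ k)" for k
  proof (induction k)
    case 0
    show "norm (va 0) = norm a ^ (2 * 2 ^ 0)" "norm (vb 0) = norm b ^ (2 * 2 ^ 0)"
      by (simp_all add: va_def vb_def cstar_identity)
  next
    case (Suc k)
    show "norm (va (Suc k)) = norm a ^ (2 * 2 ^ Suc k)" "norm (vb (Suc k)) = norm b ^ (2 * 2 ^ Suc k)"
      using cstar_identity[of "va k"] cstar_identity[of "vb k"] Suc
      by (simp_all add: vS star_va mult.commute flip: power_mult)
  qed
  have le: "norm a ^ (2 * 2 ^ k) \<le> (real (2 ^ k) + 1) ^ d * norm b ^ (2 * 2 ^ k)" for k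
  proof -
    have "norm (va k) \<le> real (card (P (2 ^ k))) * norm (vb k)"
      by (rule pairs_norm_le_card[OF in_pairs P(3) P(2)])
    also have "\<dots> \<le> real ((2 ^ k + 1) ^ d) * norm (vb k)"
      unfolding d_def by (intro mult_right_mono of_nat_mono P(4) norm_ge_zero)
    finally show ?thesis by (simp add: norm_v add.commute)
  qed
  show ?thesis
  proof (rule ccontr)
    assume "\<not> norm a \<le> norm b"
    then have lt: "norm b < norm a" by simp
    then have "0 < norm a" using norm_ge_zero[of b] by linarith
    have "norm b \<noteq> 0"
      using le[of 0] \<open>0 < norm a\<close> by auto
    then have b: "0 < norm b" by simp
    define r where "r = (norm a / norm b)\<^sup>2"
    have "1 < r" using lt b by (simp add: r_def one_less_power)
    have "r ^ 2 ^ k \<le> (real (2 ^ k) + 1) ^ d" for k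
      using le[of k] b by (simp add: r_def power_divide divide_le_eq flip: power_mult)
    moreover have "(\<lambda>n. (real n + 1) ^ d / r ^ n) \<longlonglongrightarrow> 0"
      using \<open>1 < r\<close> by real_asymp
    then have "\<forall>\<^sub>F n in sequentially. (real n + 1) ^ d / r ^ n < 1"
      by (rule order_tendstoD) simp
    then obtain n0 where n0: "\<And>n. n \<ge> n0 \<Longrightarrow> (real n + 1) ^ d / r ^ n < 1"
      unfolding eventually_sequentially by blast
    have "(real (2 ^ n0) + 1) ^ d < r ^ 2 ^ n0"
      using n0[of "2 ^ n0"] \<open>1 < r\<close> by (simp add: divide_less_eq less_exp less_imp_le)
    ultimately show False by (metis not_le)
  qed
qed

end

text \<open>Two representations of the finitely supported functions thus induce the same norm, so the closures
  of their ranges are isomorphic. For scalar functions this is the amenability of abelian groups: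
  the regular representation is as faithful as the universal one.\<close>

lemma coefficient_reps_isomorphic:
  fixes V :: "('x::topological_space \<Rightarrow> complex) \<Rightarrow> 'g \<Rightarrow> 'a::cstar_algebra"
    and W :: "('x \<Rightarrow> complex) \<Rightarrow> 'g \<Rightarrow> 'b::cstar_algebra"
  assumes V: "coefficient_rep H V" and W: "coefficient_rep H W"
  shows "cstar_isomorphic (closure (cspan {V f s | f s. continuous_on UNIV f \<and> s \<in> carrier H}))
    (closure (cspan {W f s | f s. continuous_on UNIV f \<and> s \<in> carrier H}))"
proof -
  interpret VW: coefficient_rep_pair H V W using V W by (rule coefficient_rep_pair.intro)
  interpret WV: coefficient_rep_pair H W V using W V by (rule coefficient_rep_pair.intro)
  define R where "R = (\<Union>S\<in>{S. finite S \<and> S \<subseteq> carrier H}. VW.pairs S)"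
  have R: "p \<in> R \<longleftrightarrow> (\<exists>S. finite S \<and> S \<subseteq> carrier H \<and> p \<in> VW.pairs S)" for p
    by (auto simp: R_def)
  have common: "\<exists>S. finite S \<and> S \<subseteq> carrier H \<and> p \<in> VW.pairs S \<and> q \<in> VW.pairs S"
    if pq: "p \<in> R" "q \<in> R" for p q
  proof -
    obtain S T where "finite S" "S \<subseteq> carrier H" "p \<in> VW.pairs S" "finite T" "T \<subseteq> carrier H" "q \<in> VW.pairs T"
      using pq unfolding R by blast
    then show ?thesis
      using VW.pairs_mono[of "fst p" "snd p" S "S \<union> T"] VW.pairs_mono[of "fst q" "snd q" T "S \<union> T"]
      by (intro exI[of _ "S \<union> T"]) auto
  qed
  have add: "(a + a', b + b') \<in> R" if "(a, b) \<in> R" "(a', b') \<in> R" for a b a' b'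
    using common[OF that] VW.pairs_add R by meson
  have scale: "(c *\<^sub>C a, c *\<^sub>C b) \<in> R" if "(a, b) \<in> R" for a b c
    using that VW.pairs_scaleC R by meson
  have star: "(star a, star b) \<in> R" if "(a, b) \<in> R" for a b
  proof -
    obtain S where S: "finite S" "S \<subseteq> carrier H" "(a, b) \<in> VW.pairs S" using \<open>(a, b) \<in> R\<close> unfolding R by blast
    then show ?thesis
      unfolding R by (intro exI[of _ "(\<lambda>s. inv\<^bsub>H\<^esub> s) ` S"]) (auto intro: VW.pairs_star)
  qed
  have mult: "(a * a', b * b') \<in> R" if ab: "(a, b) \<in> R" "(a', b') \<in> R" for a b a' b'
  proof -
    obtain S where S: "finite S" "S \<subseteq> carrier H" "(a, b) \<in> VW.pairs S" "(a', b') \<in> VW.pairs S"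
      using common[OF ab] by blast
    have "(a * a', b * b') \<in> VW.pairs ((\<lambda>(s, t). s \<otimes>\<^bsub>H\<^esub> t) ` (S \<times> S))"
      by (intro VW.pairs_mult S)
    then show ?thesis
      unfolding R using S by (intro exI[of _ "(\<lambda>(s, t). s \<otimes>\<^bsub>H\<^esub> t) ` (S \<times> S)"]) auto
  qed
  have norm: "norm a = norm b" if "(a, b) \<in> R" for a b
  proof -
    obtain S where S: "finite S" "S \<subseteq> carrier H" "(a, b) \<in> VW.pairs S" using \<open>(a, b) \<in> R\<close> unfolding R by blast
    then have "(b, a) \<in> WV.pairs S" unfolding VW.pairs_def WV.pairs_def by blast
    with S show ?thesis by (meson VW.pairs_norm_le WV.pairs_norm_le antisym)
  qed
  have gen: "(V f s, W f s) \<in> R" if "continuous_on UNIV f" "s \<in> carrier H" for f s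
    unfolding R using that VW.pairsI[of "\<lambda>_. f" "{s}"] by (intro exI[of _ "{s}"]) auto
  have zero: "(0, 0) \<in> R"
    unfolding R using VW.pairsI[of "\<lambda>_ _. 0" "{}"] by (intro exI[of _ "{}"]) auto
  have "fst ` R = cspan {V f s | f s. continuous_on UNIV f \<and> s \<in> carrier H}"
  proof
    show "fst ` R \<subseteq> cspan {V f s | f s. continuous_on UNIV f \<and> s \<in> carrier H}"
    proof
      fix a assume "a \<in> fst ` R"
      then obtain S F where SF: "S \<subseteq> carrier H" "\<forall>s. continuous_on UNIV (F s)" "a = (\<Sum>s\<in>S. V (F s) s)"
        unfolding R_def VW.pairs_def by fastforce
      have "V (F s) s \<in> {V f s | f s. continuous_on UNIV f \<and> s \<in> carrier H}" if "s \<in> S" for s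
        using that SF(1,2) by blast
      then show "a \<in> cspan {V f s | f s. continuous_on UNIV f \<and> s \<in> carrier H}"
        unfolding SF(3) by (intro complex_vector.span_sum complex_vector.span_base)
    qed
    have "complex_vector.subspace (fst ` R)"
    proof (rule complex_vector.subspaceI)
      show "0 \<in> fst ` R" using zero by (rule rev_image_eqI) simp
    next
      fix x y assume "x \<in> fst ` R" "y \<in> fst ` R"
      then obtain a b a' b' where ab: "(a, b) \<in> R" "(a', b') \<in> R" "x = fst (a, b)" "y = fst (a', b')" by auto
      show "x + y \<in> fst ` R" using add[OF ab(1,2)] by (rule rev_image_eqI) (simp add: ab)
    next
      fix c x assume "x \<in> fst ` R"
      then obtain a b where ab: "(a, b) \<in> R" "x = fst (a, b)" by auto
      show "c *\<^sub>C x \<in> fst ` R" using scale[OF ab(1), of c] by (rule rev_image_eqI) (simp add: ab)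
    qed
    then show "cspan {V f s | f s. continuous_on UNIV f \<and> s \<in> carrier H} \<subseteq> fst ` R"
      by (rule complex_vector.span_minimal[rotated]) (use gen in force)
  qed
  moreover have "snd ` R = cspan {W f s | f s. continuous_on UNIV f \<and> s \<in> carrier H}"
  proof
    show "snd ` R \<subseteq> cspan {W f s | f s. continuous_on UNIV f \<and> s \<in> carrier H}"
    proof
      fix a assume "a \<in> snd ` R"
      then obtain S F where SF: "S \<subseteq> carrier H" "\<forall>s. continuous_on UNIV (F s)" "a = (\<Sum>s\<in>S. W (F s) s)"
        unfolding R_def VW.pairs_def by fastforce
      have "W (F s) s \<in> {W f s | f s. continuous_on UNIV f \<and> s \<in> carrier H}" if "s \<in> S" for s
        using that SF(1,2) by blast
      then show "a \<in> cspan {W f s | f s. continuous_on UNIV f \<and> s \<in> carrier H}"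
        unfolding SF(3) by (intro complex_vector.span_sum complex_vector.span_base)
    qed
    have "complex_vector.subspace (snd ` R)"
    proof (rule complex_vector.subspaceI)
      show "0 \<in> snd ` R" using zero by (rule rev_image_eqI) simp
    next
      fix x y assume "x \<in> snd ` R" "y \<in> snd ` R"
      then obtain a b a' b' where ab: "(a, b) \<in> R" "(a', b') \<in> R" "x = snd (a, b)" "y = snd (a', b')" by auto
      show "x + y \<in> snd ` R" using add[OF ab(1,2)] by (rule rev_image_eqI) (simp add: ab)
    next
      fix c x assume "x \<in> snd ` R"
      then obtain a b where ab: "(a, b) \<in> R" "x = snd (a, b)" by auto
      show "c *\<^sub>C x \<in> snd ` R" using scale[OF ab(1), of c] by (rule rev_image_eqI) (simp add: ab)
    qed
    then show "cspan {W f s | f s. continuous_on UNIV f \<and> s \<in> carrier H} \<subseteq> snd ` R"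
      by (rule complex_vector.span_minimal[rotated]) (use gen in force)
  qed
  ultimately show ?thesis
    using cstar_isomorphic_closure[OF add mult scale star norm] by simp
qed


section \<open>Reduced crossed products by discrete groups\<close>

lemma closure_cspan_add:
  assumes "a \<in> closure (cspan B)" and "b \<in> closure (cspan B)"
  shows "a + b \<in> closure (cspan B)"
proof -
  obtain u v where "\<And>n. u n \<in> cspan B" "u \<longlonglongrightarrow> a" "\<And>n. v n \<in> cspan B" "v \<longlonglongrightarrow> b"
    using assms unfolding closure_sequential by metis
  then show ?thesis
    unfolding closure_sequential
    by (intro exI[of _ "\<lambda>n. u n + v n"]) (auto intro: complex_vector.span_add tendsto_add)
qed

lemma closure_cspan_scaleC:
  assumes "a \<in> closure (cspan B)"
  shows "c *\<^sub>C a \<in> closure (cspan B)"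
proof -
  obtain u where "\<And>n. u n \<in> cspan B" "u \<longlonglongrightarrow> a"
    using assms unfolding closure_sequential by metis
  then show ?thesis
    unfolding closure_sequential
    by (intro exI[of _ "\<lambda>n. c *\<^sub>C u n"])
      (auto intro: complex_vector.span_scale bounded_linear.tendsto[OF bounded_linear_scaleC])
qed

lemma closure_cspan_base: "a \<in> B \<Longrightarrow> a \<in> closure (cspan B)"
  using closure_subset complex_vector.span_base by blast

lemma closure_cspan_induct [consumes 1, case_names base zero add scale limit]:
  assumes "a \<in> closure (cspan B)"
    and base: "\<And>a. a \<in> B \<Longrightarrow> P a"
    and zero: "P 0"
    and add: "\<And>a b. P a \<Longrightarrow> P b \<Longrightarrow> P (a + b)"
    and scale: "\<And>c a. P a \<Longrightarrow> P (c *\<^sub>C a)"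
    and limit: "\<And>X a. (\<And>n. P (X n)) \<Longrightarrow> X \<longlonglongrightarrow> a \<Longrightarrow> P a"
  shows "P a"
proof -
  have span: "P b" if "b \<in> cspan B" for b
  proof -
    have "complex_vector.subspace {b. P b}"
      unfolding complex_vector.subspace_def using zero add scale by auto
    then show ?thesis
      using complex_vector.span_minimal[of B "{b. P b}"] base that by auto
  qed
  obtain X where "\<And>n. X n \<in> cspan B" "X \<longlonglongrightarrow> a"
    using assms(1) unfolding closure_sequential by blast
  then show ?thesis using span limit by blast
qed

lemma continuous_ex_bound:
  fixes f :: "'x::topological_space \<Rightarrow> complex"
  assumes "compact (UNIV :: 'x set)" and "continuous_on UNIV f"
  shows "\<exists>M. \<forall>x. cmod (f x) \<le> M"
proof -
  have "bounded (range f)"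
    using compact_continuous_image[OF assms(2,1)] by (rule compact_imp_bounded)
  then show ?thesis by (auto simp: bounded_iff)
qed

lemma ex_continuous_separating:
  fixes x :: "'x::t2_space"
  assumes "compact (UNIV :: 'x set)" and "closed K" and "x \<notin> K"
  shows "\<exists>f :: 'x \<Rightarrow> complex. continuous_on UNIV f \<and> f x = 1 \<and> (\<forall>y\<in>K. f y = 0)"
proof -
  have "normal_space (euclidean :: 'x topology)"
  proof (rule compact_Hausdorff_or_regular_imp_normal_space)
    show "compact_space (euclidean :: 'x topology)"
      using assms(1) by (simp add: compact_space_def)
    have "Hausdorff_space (euclidean :: 'x topology)"
      unfolding Hausdorff_space_def disjnt_def by (metis hausdorff open_openin)
    then show "Hausdorff_space (euclidean :: 'x topology) \<or> regular_space (euclidean :: 'x topology)" ..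
  qed
  then obtain g where g: "continuous_map euclidean (top_of_set {0..1::real}) g"
    "g ` K \<subseteq> {0}" "g ` {x} \<subseteq> {1}"
    using Urysohn_lemma[of euclidean K "{x}" 0 1] assms(2,3) by (auto simp: closed_closedin[symmetric])
  then have "continuous_on UNIV g"
    by (auto simp: continuous_map_in_subtopology)
  then show ?thesis
    using g by (intro exI[of _ "\<lambda>y. complex_of_real (g y)"]) (auto intro!: continuous_intros)
qed

locale compact_dynamics = group G for G :: "'g monoid" (structure) +
  fixes \<phi> :: "'g \<Rightarrow> 'x::t2_space \<Rightarrow> 'x"
  assumes compact_UNIV: "compact (UNIV :: 'x set)"
    and act_mult: "\<And>s t x. s \<in> carrier G \<Longrightarrow> t \<in> carrier G \<Longrightarrow> \<phi> (s \<otimes> t) x = \<phi> s (\<phi> t x)"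
    and act_one: "\<And>x. \<phi> \<one> x = x"
    and continuous_act: "\<And>s. s \<in> carrier G \<Longrightarrow> continuous_on UNIV (\<phi> s)"
begin

lemma act_inv: "s \<in> carrier G \<Longrightarrow> \<phi> (inv s) (\<phi> s x) = x" "s \<in> carrier G \<Longrightarrow> \<phi> s (\<phi> (inv s) x) = x"
  by (simp_all add: act_one flip: act_mult)

lemma continuous_comp_act: "continuous_on UNIV f \<Longrightarrow> s \<in> carrier G \<Longrightarrow> continuous_on UNIV (\<lambda>x. f (\<phi> s x))"
  using continuous_on_compose[OF continuous_act, of s f] by (simp add: o_def continuous_on_subset)

text \<open>A crossed product function, and likewise a unitary, is a weighted composition operator, with weight
  \<open>0\<close> at the group elements outside of the carrier.\<close>

lemma crossed_fun_bounded:
  assumes "\<And>x. cmod (f x) \<le> M"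
  shows "Rep_ell2 (crossed_fun G \<phi> f \<cdot> \<xi>) (t, x)
      = (if t \<in> carrier G then f (\<phi> t x) * Rep_ell2 \<xi> (t, x) else 0)"
    and norm_crossed_fun_le: "norm (crossed_fun G \<phi> f) \<le> M"
proof -
  have "0 \<le> M" using assms norm_ge_zero order_trans by blast
  then have "\<exists>a. (\<forall>\<xi>. Rep_ell2 (a \<cdot> \<xi>) = (\<lambda>i. (case i of (t, x) \<Rightarrow> if t \<in> carrier G then f (\<phi> t x) else 0)
      * Rep_ell2 \<xi> (id i))) \<and> norm a \<le> M"
    using assms
    by (intro ex_wcomp_bop[where h = "\<lambda>(t, x). if t \<in> carrier G then cnj (f (\<phi> t x)) else 0" and \<tau> = id])
      (auto split: prod.splits if_splits)
  then obtain a where a: "\<And>\<xi>. Rep_ell2 (a \<cdot> \<xi>)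
      = (\<lambda>i. (case i of (t, x) \<Rightarrow> if t \<in> carrier G then f (\<phi> t x) else 0) * Rep_ell2 \<xi> i)" "norm a \<le> M"
    by auto
  have "crossed_fun G \<phi> f = a"
    unfolding crossed_fun_def by (rule bop_of_eqI) (auto simp: a fun_eq_iff)
  with a show "Rep_ell2 (crossed_fun G \<phi> f \<cdot> \<xi>) (t, x)
      = (if t \<in> carrier G then f (\<phi> t x) * Rep_ell2 \<xi> (t, x) else 0)"
    "norm (crossed_fun G \<phi> f) \<le> M" by auto
qed

lemma crossed_fun_apply:
  assumes "continuous_on UNIV f"
  shows "Rep_ell2 (crossed_fun G \<phi> f \<cdot> \<xi>) (t, x)
    = (if t \<in> carrier G then f (\<phi> t x) * Rep_ell2 \<xi> (t, x) else 0)"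
  using continuous_ex_bound[OF compact_UNIV assms] crossed_fun_bounded(1) by blast

lemma crossed_unitary_bounded:
  assumes s: "s \<in> carrier G"
  shows crossed_unitary_apply: "Rep_ell2 ((crossed_unitary G s :: ('g \<times> 'x) bop) \<cdot> \<xi>) (t, x)
      = (if t \<in> carrier G then Rep_ell2 \<xi> (inv s \<otimes> t, x) else 0)"
    and norm_crossed_unitary_le: "norm (crossed_unitary G s :: ('g \<times> 'x) bop) \<le> 1"
proof -
  let ?g = "\<lambda>(t, x :: 'x). if t \<in> carrier G then 1 else 0 :: complex"
  have *: "inv s \<otimes> (s \<otimes> t) = t" "s \<otimes> (inv s \<otimes> t) = t" if "t \<in> carrier G" for t
    using s that by (simp_all flip: m_assoc)
  have "\<exists>a. (\<forall>\<xi>. Rep_ell2 (a \<cdot> \<xi>) = (\<lambda>i. ?g i * Rep_ell2 \<xi> ((\<lambda>(t, x :: 'x). (inv s \<otimes> t, x)) i))) \<and> norm a \<le> 1"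
    using s by (intro ex_wcomp_bop[where h = ?g and \<tau> = "\<lambda>(t, x). (s \<otimes> t, x)"])
      (auto simp: * split: prod.splits if_splits)
  then obtain a :: "('g \<times> 'x) bop" where a: "\<And>\<xi>. Rep_ell2 (a \<cdot> \<xi>)
      = (\<lambda>i. ?g i * Rep_ell2 \<xi> ((\<lambda>(t, x). (inv s \<otimes> t, x)) i))" "norm a \<le> 1"
    by blast
  have "crossed_unitary G s = a"
    unfolding crossed_unitary_def by (rule bop_of_eqI) (auto simp: a fun_eq_iff)
  with a show "Rep_ell2 ((crossed_unitary G s :: ('g \<times> 'x) bop) \<cdot> \<xi>) (t, x)
      = (if t \<in> carrier G then Rep_ell2 \<xi> (inv s \<otimes> t, x) else 0)"
    "norm (crossed_unitary G s :: ('g \<times> 'x) bop) \<le> 1" by auto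
qed

definition monomial :: "('x \<Rightarrow> complex) \<Rightarrow> 'g \<Rightarrow> ('g \<times> 'x) bop"
  where "monomial f s = crossed_fun G \<phi> f * crossed_unitary G s"

abbreviation crossed :: "'g set \<Rightarrow> ('g \<times> 'x) bop set"
  where "crossed \<equiv> reduced_crossed_product G \<phi>"

abbreviation commutant :: "('g \<times> 'x) bop set"
  where "commutant \<equiv> relative_commutant (crossed (carrier G)) (crossed_functions G \<phi>)"

lemma crossed_eq: "crossed N = closure (cspan {monomial f s | f s. continuous_on UNIV f \<and> s \<in> N})"
  by (simp add: reduced_crossed_product_def monomial_def)

lemma Rep_monomial:
  assumes "continuous_on UNIV f" and "s \<in> carrier G"
  shows "Rep_ell2 (monomial f s \<cdot> \<xi>) (t, x)
    = (if t \<in> carrier G then f (\<phi> t x) * Rep_ell2 \<xi> (inv s \<otimes> t, x) else 0)"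
  using assms by (simp add: monomial_def bop_apply_simps crossed_fun_apply crossed_unitary_apply)

lemma norm_monomial_le:
  assumes "s \<in> carrier G" and "\<And>x. cmod (f x) \<le> M"
  shows "norm (monomial f s) \<le> M"
proof -
  have "norm (monomial f s) \<le> M * 1"
    unfolding monomial_def
    by (rule order_trans[OF norm_mult_ineq], rule mult_mono)
      (use assms norm_crossed_fun_le norm_crossed_unitary_le order_trans[OF norm_ge_zero assms(2)] in auto)
  then show ?thesis by simp
qed

lemma bop_eqI_coordinates:
  "(\<And>\<xi> t x. Rep_ell2 (a \<cdot> \<xi>) (t, x) = Rep_ell2 (b \<cdot> \<xi>) (t, x)) \<Longrightarrow> a = b"
  by (intro bop_eqI ell2_eqI) (metis prod.collapse)

lemma inv_mult_eq_iff:
  assumes "s \<in> carrier G" "t \<in> carrier G" "r \<in> carrier G"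
  shows "r = inv s \<otimes> t \<longleftrightarrow> s = t \<otimes> inv r"
  using assms by (metis inv_closed inv_solve_left inv_solve_right m_closed)

lemma entry_monomial:
  assumes "continuous_on UNIV f" and "s \<in> carrier G"
  shows "entry (monomial f s) (t, x) (r, y)
    = (if t \<in> carrier G \<and> r = inv s \<otimes> t \<and> x = y then f (\<phi> t x) else 0)"
  unfolding entry_def Rep_monomial[OF assms] by (auto simp: Rep_ket)

lemma monomial_mult:
  assumes f: "continuous_on UNIV f" and g: "continuous_on UNIV g" and s: "s \<in> carrier G" and t: "t \<in> carrier G"
  shows "monomial f s * monomial g t = monomial (\<lambda>x. f x * g (\<phi> (inv s) x)) (s \<otimes> t)"
proof (rule bop_eqI_coordinates)
  have c: "continuous_on UNIV (\<lambda>x. f x * g (\<phi> (inv s) x))"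
    by (intro continuous_intros f continuous_comp_act g inv_closed s)
  show "Rep_ell2 ((monomial f s * monomial g t) \<cdot> \<xi>) (r, x)
      = Rep_ell2 (monomial (\<lambda>x. f x * g (\<phi> (inv s) x)) (s \<otimes> t) \<cdot> \<xi>) (r, x)" for \<xi> r x
    using s t by (simp add: bop_apply_simps Rep_monomial[OF f s] Rep_monomial[OF g t] Rep_monomial[OF c]
      act_mult inv_mult_group m_assoc)
qed

lemma monomial_star:
  assumes f: "continuous_on UNIV f" and s: "s \<in> carrier G"
  shows "star (monomial f s) = monomial (\<lambda>x. cnj (f (\<phi> s x))) (inv s)"
proof (rule bop_eqI_entry)
  have c: "continuous_on UNIV (\<lambda>x. cnj (f (\<phi> s x)))"
    by (intro continuous_intros continuous_comp_act f s)
  fix i j :: "'g \<times> 'x"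
  obtain t x r y where ij: "i = (t, x)" "j = (r, y)" by (cases i; cases j)
  have "r \<in> carrier G \<and> t = inv s \<otimes> r \<longleftrightarrow> t \<in> carrier G \<and> r = s \<otimes> t"
    using s by (auto simp flip: m_assoc)
  then show "entry (star (monomial f s)) i j = entry (monomial (\<lambda>x. cnj (f (\<phi> s x))) (inv s)) i j"
    unfolding ij entry_star entry_monomial[OF f s] entry_monomial[OF c inv_closed[OF s]] inv_inv[OF s]
    by (cases "t \<in> carrier G \<and> r = s \<otimes> t") (auto simp: act_mult[OF s])
qed

lemma monomial_add:
  assumes "continuous_on UNIV f" "continuous_on UNIV g" "s \<in> carrier G"
  shows "monomial (\<lambda>x. f x + g x) s = monomial f s + monomial g s"
  using assms continuous_on_add[OF assms(1,2)]
  by (intro bop_eqI_coordinates) (simp add: bop_apply_simps plus_ell2.rep_eq Rep_monomial algebra_simps)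

lemma monomial_scaleC:
  assumes "continuous_on UNIV f" "s \<in> carrier G"
  shows "monomial (\<lambda>x. c * f x) s = c *\<^sub>C monomial f s"
  using assms continuous_on_mult_left[OF assms(1), of c]
  by (intro bop_eqI_coordinates) (simp add: bop_apply_scaleC_left scaleC_ell2.rep_eq Rep_monomial algebra_simps)

lemma crossed_fun_eq_monomial:
  assumes "continuous_on UNIV f"
  shows "crossed_fun G \<phi> f = monomial f \<one>"
  by (rule bop_eqI_coordinates) (simp add: crossed_fun_apply Rep_monomial assms)

lemma monomial_in_crossed: "continuous_on UNIV f \<Longrightarrow> s \<in> N \<Longrightarrow> monomial f s \<in> crossed N"
  unfolding crossed_eq by (rule closure_cspan_base) blast

lemma crossed_mono: "N \<subseteq> N' \<Longrightarrow> crossed N \<subseteq> crossed N'"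
  unfolding crossed_eq by (intro closure_mono complex_vector.span_mono) blast

lemma crossed_functions_subset: "\<one> \<in> N \<Longrightarrow> crossed_functions G \<phi> \<subseteq> crossed N"
  unfolding crossed_functions_def by (auto simp: crossed_fun_eq_monomial intro: monomial_in_crossed)

text \<open>The monomials over a subgroup are closed under products and adjoints, and both operations are
  continuous. The product is extended to the closure in one factor at a time.\<close>

lemma cstar_subalgebra_crossed:
  assumes N: "subgroup N G"
  shows "cstar_subalgebra (crossed N)"
proof -
  interpret N: subgroup N G by (rule N)
  have Nc: "s \<in> carrier G" if "s \<in> N" for s using that N.subset by blast
  have add: "a + b \<in> crossed N" if "a \<in> crossed N" "b \<in> crossed N" for a b
    using that unfolding crossed_eq by (rule closure_cspan_add)
  have scale: "c *\<^sub>C a \<in> crossed N" if "a \<in> crossed N" for a c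
    using that unfolding crossed_eq by (rule closure_cspan_scaleC)
  have cl: "closed (crossed N)" unfolding crossed_eq by simp
  have lim: "a \<in> crossed N" if "\<And>n. X n \<in> crossed N" "X \<longlonglongrightarrow> a" for X a
    using closed_sequentially[OF cl that] .
  have zero: "0 \<in> crossed N"
    unfolding crossed_eq using closure_subset complex_vector.span_zero by blast
  have star: "star a \<in> crossed N" if "a \<in> crossed N" for a
    using that unfolding crossed_eq[of N]
  proof (induction rule: closure_cspan_induct)
    case (base a)
    then obtain f s where fs: "a = monomial f s" "continuous_on UNIV f" "s \<in> N" by blast
    show ?case
      unfolding crossed_eq[symmetric] fs(1) monomial_star[OF fs(2) Nc[OF fs(3)]]
      using fs by (intro monomial_in_crossed) (auto intro!: continuous_intros continuous_comp_act Nc)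
  next
    case (limit X a)
    show ?case
      unfolding crossed_eq[symmetric]
      by (rule lim[of "\<lambda>n. star (X n)"])
        (use limit in \<open>auto simp: crossed_eq intro: bounded_linear.tendsto[OF bounded_linear_star]\<close>)
  qed (use zero add scale in \<open>simp_all add: star_add star_scaleC crossed_eq
    bounded_linear.linear[OF bounded_linear_star, THEN linear_0]\<close>)
  have mult1: "monomial f s * b \<in> crossed N" if f: "continuous_on UNIV f" and s: "s \<in> N" and "b \<in> crossed N" for f s b
    using that(3) unfolding crossed_eq[of N]
  proof (induction rule: closure_cspan_induct)
    case (base b)
    then obtain g t where gt: "b = monomial g t" "continuous_on UNIV g" "t \<in> N" by blast
    show ?case
      unfolding crossed_eq[symmetric] gt(1) monomial_mult[OF f gt(2) Nc[OF s] Nc[OF gt(3)]]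
      using f s gt by (intro monomial_in_crossed) (auto intro!: continuous_intros continuous_comp_act Nc)
  next
    case (limit X a)
    show ?case
      unfolding crossed_eq[symmetric]
      by (rule lim[of "\<lambda>n. monomial f s * X n"])
        (use limit in \<open>auto simp: crossed_eq intro: tendsto_mult_left\<close>)
  qed (use zero add scale in \<open>simp_all add: distrib_left mult_scaleC_right crossed_eq\<close>)
  have mult: "a * b \<in> crossed N" if "a \<in> crossed N" and b: "b \<in> crossed N" for a b
    using that(1) unfolding crossed_eq[of N]
  proof (induction rule: closure_cspan_induct)
    case (base a)
    then show ?case using mult1 b unfolding crossed_eq[symmetric] by blast
  next
    case (limit X a)
    show ?case
      unfolding crossed_eq[symmetric]
      by (rule lim[of "\<lambda>n. X n * b"])
        (use limit in \<open>auto simp: crossed_eq intro: tendsto_mult_right\<close>)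
  qed (use zero add scale in \<open>simp_all add: distrib_right mult_scaleC_left crossed_eq\<close>)
  show ?thesis
    unfolding cstar_subalgebra_def by (intro conjI ballI allI cl zero add mult scale star)
qed

section \<open>Fourier coefficients\<close>

text \<open>For a finite sum of terms \<open>f\<^sub>s w\<^sub>s\<close> this is \<open>f\<^sub>s\<close>. It is read off in the row of the identity, where
  the function acts without being translated.\<close>

definition coef :: "('g \<times> 'x) bop \<Rightarrow> 'g \<Rightarrow> 'x \<Rightarrow> complex"
  where "coef a s x = entry a (\<one>, x) (inv s, x)"

lemma coef_monomial:
  assumes "continuous_on UNIV f" "s \<in> carrier G" "r \<in> carrier G"
  shows "coef (monomial f s) r x = (if r = s then f x else 0)"
proof -
  have "inv r = inv s \<longleftrightarrow> r = s" using assms(2,3) inv_inj by (auto dest: inj_onD)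
  then show ?thesis using assms by (simp add: coef_def entry_monomial act_one)
qed

text \<open>Elements of the crossed product are equivariant: their matrices are block diagonal over \<open>X\<close>, and
  every row is a translate of the row of the identity. Hence the coefficients determine the element.\<close>

lemma entry_eq_coef:
  assumes "a \<in> crossed (carrier G)"
  shows "entry a (t, x) (r, y)
    = (if t \<in> carrier G \<and> r \<in> carrier G \<and> x = y then coef a (t \<otimes> inv r) (\<phi> t x) else 0)"
  using assms unfolding crossed_eq
proof (induction rule: closure_cspan_induct)
  case (base a)
  then obtain f s where fs: "a = monomial f s" "continuous_on UNIV f" "s \<in> carrier G" by blast
  show ?case
  proof (cases "t \<in> carrier G \<and> r \<in> carrier G")
    case True
    then have c: "coef a (t \<otimes> inv r) (\<phi> t x) = (if r = inv s \<otimes> t then f (\<phi> t x) else 0)"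
      unfolding fs(1) using inv_mult_eq_iff[of s t r] fs by (subst coef_monomial) auto
    have "entry a (t, x) (r, y) = (if r = inv s \<otimes> t \<and> x = y then f (\<phi> t x) else 0)"
      using True fs by (simp add: entry_monomial)
    then show ?thesis unfolding c using True by simp
  next
    case False
    then show ?thesis using fs by (auto simp: entry_monomial)
  qed
next
  case (limit X a)
  have "(\<lambda>n. entry (X n) (t, x) (r, y))
      \<longlonglongrightarrow> (if t \<in> carrier G \<and> r \<in> carrier G \<and> x = y then coef a (t \<otimes> inv r) (\<phi> t x) else 0)"
    unfolding limit(1) by (auto simp: coef_def intro!: tendsto_entry limit(2))
  then show ?case
    using tendsto_entry[OF limit(2)] LIMSEQ_unique by blast
qed (simp_all add: coef_def entry_add entry_scaleC entry_zero)

lemma continuous_coef: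
  assumes "a \<in> crossed (carrier G)" and s: "s \<in> carrier G"
  shows "continuous_on UNIV (coef a s)"
  using assms(1) unfolding crossed_eq
proof (induction rule: closure_cspan_induct)
  case (base a)
  then obtain f t where ft: "a = monomial f t" "continuous_on UNIV f" "t \<in> carrier G" by blast
  then have "coef a s = (if s = t then f else (\<lambda>_. 0))"
    using s by (auto simp: coef_monomial fun_eq_iff)
  then show ?case using ft by simp
next
  case (limit X a)
  have "uniform_limit UNIV (\<lambda>n. coef (X n) s) (coef a s) sequentially"
  proof (rule uniform_limitI)
    fix e :: real assume "0 < e"
    then have "\<forall>\<^sub>F n in sequentially. dist (X n) a < e"
      using limit(2) by (simp add: tendsto_iff)
    then show "\<forall>\<^sub>F n in sequentially. \<forall>x\<in>UNIV. dist (coef (X n) s x) (coef a s x) < e"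
    proof (rule eventually_mono, intro ballI)
      fix n x assume "dist (X n) a < e"
      moreover have "dist (coef (X n) s x) (coef a s x) \<le> norm (X n - a)"
        unfolding coef_def dist_norm entry_diff[symmetric] by (rule norm_entry_le)
      ultimately show "dist (coef (X n) s x) (coef a s x) < e" by (simp add: dist_norm)
    qed
  qed
  then show ?case
    by (rule uniform_limit_theorem[rotated]) (use limit(1) in auto)
next
  case (add a b)
  have "coef (a + b) s = (\<lambda>x. coef a s x + coef b s x)" by (simp add: coef_def entry_add fun_eq_iff)
  then show ?case using add by (auto intro: continuous_intros)
next
  case (scale c a)
  have "coef (c *\<^sub>C a) s = (\<lambda>x. c * coef a s x)" by (simp add: coef_def entry_scaleC fun_eq_iff)
  then show ?case using scale by (auto intro: continuous_intros)
qed (simp add: coef_def entry_zero)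

lemma coef_crossed_eq_0:
  assumes "a \<in> crossed N" and "N \<subseteq> carrier G" "s \<in> carrier G" "s \<notin> N"
  shows "coef a s x = 0"
  using assms(1) unfolding crossed_eq
proof (induction rule: closure_cspan_induct)
  case (base a)
  then show ?case using assms by (auto simp: coef_monomial subset_eq)
next
  case (limit X a)
  have "(\<lambda>n. coef (X n) s x) \<longlonglongrightarrow> coef a s x" unfolding coef_def by (rule tendsto_entry[OF limit(2)])
  then show ?case by (simp add: limit(1) LIMSEQ_const_iff)
qed (simp_all add: coef_def entry_add entry_scaleC entry_zero)

lemma entry_crossed_fun_mult:
  assumes f: "continuous_on UNIV f"
  shows "entry (crossed_fun G \<phi> f * a) (t, x) j = (if t \<in> carrier G then f (\<phi> t x) * entry a (t, x) j else 0)"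
  by (simp add: entry_def bop_apply_simps crossed_fun_apply f)

lemma entry_mult_crossed_fun:
  assumes f: "continuous_on UNIV f"
  shows "entry (a * crossed_fun G \<phi> f) i (r, y) = (if r \<in> carrier G then entry a i (r, y) * f (\<phi> r y) else 0)"
proof -
  have "crossed_fun G \<phi> f \<cdot> ket (r, y) = (if r \<in> carrier G then f (\<phi> r y) else 0) *\<^sub>C ket (r, y)"
  proof (rule ell2_eqI)
    fix i :: "'g \<times> 'x"
    obtain t x where "i = (t, x)" by (cases i)
    then show "Rep_ell2 (crossed_fun G \<phi> f \<cdot> ket (r, y)) i
        = Rep_ell2 ((if r \<in> carrier G then f (\<phi> r y) else 0) *\<^sub>C ket (r, y)) i"
      by (auto simp: crossed_fun_apply[OF f] Rep_ket scaleC_ell2.rep_eq)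
  qed
  then show ?thesis
    by (simp add: entry_def bop_apply_simps bop_apply_scaleC scaleC_ell2.rep_eq)
qed

text \<open>Comparing coefficients in \<open>d * a = a * d\<close>: the coefficient at \<open>s\<close> is multiplied by \<open>d\<close> on one
  side and by \<open>d\<close> composed with the inverse of \<open>s\<close> on the other.\<close>

lemma commutant_iff:
  assumes a: "a \<in> crossed (carrier G)"
  shows "a \<in> commutant \<longleftrightarrow> (\<forall>s\<in>carrier G. \<forall>x. coef a s x \<noteq> 0 \<longrightarrow> \<phi> s x = x)"
proof
  assume com: "a \<in> commutant"
  show "\<forall>s\<in>carrier G. \<forall>x. coef a s x \<noteq> 0 \<longrightarrow> \<phi> s x = x"
  proof (intro ballI allI impI, rule ccontr)
    fix s x assume s: "s \<in> carrier G" and n: "coef a s x \<noteq> 0" "\<phi> s x \<noteq> x"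
    then have "x \<notin> {\<phi> (inv s) x}" using act_inv[of s x] by auto
    then obtain f :: "'x \<Rightarrow> complex" where f: "continuous_on UNIV f" "f x = 1" "f (\<phi> (inv s) x) = 0"
      using ex_continuous_separating[OF compact_UNIV, of "{\<phi> (inv s) x}" x] by auto
    have "a * crossed_fun G \<phi> f = crossed_fun G \<phi> f * a"
      using com f(1) by (auto simp: relative_commutant_def crossed_functions_def)
    then have "entry (a * crossed_fun G \<phi> f) (\<one>, x) (inv s, x) = entry (crossed_fun G \<phi> f * a) (\<one>, x) (inv s, x)"
      by simp
    then show False
      using n(1) s by (simp add: entry_crossed_fun_mult entry_mult_crossed_fun f act_one coef_def)
  qed
next
  assume supp: "\<forall>s\<in>carrier G. \<forall>x. coef a s x \<noteq> 0 \<longrightarrow> \<phi> s x = x"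
  have "a * crossed_fun G \<phi> f = crossed_fun G \<phi> f * a" if f: "continuous_on UNIV f" for f
  proof (rule bop_eqI_entry)
    fix i j :: "'g \<times> 'x"
    obtain t x r y where ij: "i = (t, x)" "j = (r, y)" by (cases i; cases j)
    show "entry (a * crossed_fun G \<phi> f) i j = entry (crossed_fun G \<phi> f * a) i j"
    proof (cases "entry a i j = 0")
      case False
      then have *: "t \<in> carrier G" "r \<in> carrier G" "x = y" "coef a (t \<otimes> inv r) (\<phi> t x) \<noteq> 0"
        unfolding ij entry_eq_coef[OF a] by (auto split: if_splits)
      then have "\<phi> (t \<otimes> inv r) (\<phi> t x) = \<phi> t x" using supp by simp
      then have "\<phi> (inv (t \<otimes> inv r)) (\<phi> t x) = \<phi> t x"
        using act_inv(1)[of "t \<otimes> inv r" "\<phi> t x"] * by simp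
      then have "\<phi> (inv (t \<otimes> inv r) \<otimes> t) x = \<phi> t x"
        using * by (simp add: act_mult)
      moreover have "inv (t \<otimes> inv r) \<otimes> t = r"
        using * by (simp add: inv_mult_group m_assoc)
      ultimately show ?thesis
        using * by (simp add: ij entry_crossed_fun_mult entry_mult_crossed_fun f)
    qed (simp add: ij entry_crossed_fun_mult entry_mult_crossed_fun f)
  qed
  then show "a \<in> commutant"
    using a by (auto simp: relative_commutant_def crossed_functions_def)
qed

text \<open>The set where a continuous coefficient does not vanish is open, so if it consists of fixed points
  it lies in their interior.\<close>

lemma coef_supported_interior:
  assumes "a \<in> commutant" "s \<in> carrier G" "coef a s x \<noteq> 0"
  shows "x \<in> interior {x. \<phi> s x = x}"
proof (rule interiorI)
  have a: "a \<in> crossed (carrier G)" using assms(1) by (simp add: relative_commutant_def)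
  have "open (coef a s -` (- {0}))"
    using continuous_coef[OF a assms(2)] by (intro open_vimage) auto
  then show "open {x. coef a s x \<noteq> 0}" by (simp add: vimage_def)
  show "{x. coef a s x \<noteq> 0} \<subseteq> {x. \<phi> s x = x}"
    using assms(1,2) commutant_iff[OF a] by auto
qed (use assms in simp)

section \<open>The conditional expectation onto a sub-crossed product\<close>

text \<open>The operator \<open>w\<^sub>s\<close> moves the coordinate \<open>t\<close> to \<open>s t\<close>, which is in the same coset \<open>N t\<close> exactly when \<open>s\<close> is in
  \<open>N\<close>. So the compression to these cosets keeps the coefficients at elements of \<open>N\<close> and deletes all
  others.\<close>

definition expectation :: "'g set \<Rightarrow> ('g \<times> 'x) bop \<Rightarrow> ('g \<times> 'x) bop"
  where "expectation N = compress (\<lambda>(t, x). (\<lambda>n. n \<otimes> t) ` N)"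

lemma same_coset_iff:
  assumes N: "subgroup N G" and t: "t \<in> carrier G" and r: "r \<in> carrier G"
  shows "(\<lambda>n. n \<otimes> t) ` N = (\<lambda>n. n \<otimes> r) ` N \<longleftrightarrow> t \<otimes> inv r \<in> N"
proof -
  interpret N: subgroup N G by (rule N)
  have Nc: "n \<in> carrier G" if "n \<in> N" for n using that N.subset by blast
  show ?thesis
  proof
    assume eq: "(\<lambda>n. n \<otimes> t) ` N = (\<lambda>n. n \<otimes> r) ` N"
    have "t \<in> (\<lambda>n. n \<otimes> t) ` N" using t by (intro image_eqI[of _ _ \<one>]) auto
    then obtain n where "n \<in> N" "t = n \<otimes> r" using eq by auto
    then show "t \<otimes> inv r \<in> N" using r Nc by (simp add: m_assoc)
  next
    assume n: "t \<otimes> inv r \<in> N"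
    have "n' \<otimes> t = (n' \<otimes> (t \<otimes> inv r)) \<otimes> r" "n' \<otimes> r = (n' \<otimes> inv (t \<otimes> inv r)) \<otimes> t" if "n' \<in> N" for n'
      using Nc[OF that] t r by (simp_all add: m_assoc inv_mult_group)
    then show "(\<lambda>n. n \<otimes> t) ` N = (\<lambda>n. n \<otimes> r) ` N"
      using n N.m_closed N.m_inv_closed by blast
  qed
qed

lemma crossed_block_diagonal:
  assumes N: "subgroup N G" and b: "b \<in> crossed N"
    and ne: "(\<lambda>(t, x). (\<lambda>n. n \<otimes> t) ` N) i \<noteq> (\<lambda>(t, x). (\<lambda>n. n \<otimes> t) ` N) j"
  shows "entry b i j = 0"
proof -
  have Nc: "N \<subseteq> carrier G" using N by (rule subgroup.subset)
  have "b \<in> crossed (carrier G)" using b crossed_mono[OF Nc] by blast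
  moreover obtain t x r y where "i = (t, x)" "j = (r, y)" by (cases i; cases j)
  ultimately show ?thesis
    using ne same_coset_iff[OF N, of t r] coef_crossed_eq_0[OF b Nc, of "t \<otimes> inv r"]
    by (auto simp: entry_eq_coef)
qed

lemma expectation_eq_self: "subgroup N G \<Longrightarrow> b \<in> crossed N \<Longrightarrow> expectation N b = b"
  unfolding expectation_def by (rule compress_eq_self) (rule crossed_block_diagonal)

lemma expectation_in_crossed:
  assumes N: "subgroup N G" and "a \<in> crossed (carrier G)"
  shows "expectation N a \<in> crossed N"
  using assms(2) unfolding crossed_eq[of "carrier G"]
proof (induction rule: closure_cspan_induct)
  have sub: "cstar_subalgebra (crossed N)" using N by (rule cstar_subalgebra_crossed)
  {
    case (base a)
    then obtain f s where fs: "a = monomial f s" "continuous_on UNIV f" "s \<in> carrier G" by blast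
    show ?case
    proof (cases "s \<in> N")
      case True
      then have "a \<in> crossed N" using fs by (simp add: monomial_in_crossed)
      then show ?thesis using expectation_eq_self[OF N] by simp
    next
      case False
      have "expectation N a = 0"
      proof (rule bop_eqI_entry)
        fix i j :: "'g \<times> 'x"
        obtain t x r y where ij: "i = (t, x)" "j = (r, y)" by (cases i; cases j)
        show "entry (expectation N a) i j = entry 0 i j"
        proof (cases "t \<in> carrier G \<and> r = inv s \<otimes> t")
          case True
          then have "r \<in> carrier G" "t \<otimes> inv r = s"
            using fs by (auto simp: inv_mult_group simp flip: m_assoc)
          then show ?thesis
            using True False same_coset_iff[OF N, of t r]
            by (auto simp: ij expectation_def entry_compress entry_zero)
        qed (auto simp: ij expectation_def entry_compress entry_zero fs entry_monomial)
      qed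
      then show ?thesis using sub by (simp add: cstar_subalgebra_def)
    qed
  next
    case zero
    have "expectation N 0 = 0"
      by (rule bop_eqI_entry) (simp add: expectation_def entry_compress entry_zero)
    then show ?case using sub by (simp add: cstar_subalgebra_def)
  next
    case (add a b)
    then show ?case using sub by (simp add: expectation_def compress_add cstar_subalgebra_def)
  next
    case (scale c a)
    then show ?case using sub by (simp add: expectation_def compress_scaleC cstar_subalgebra_def)
  next
    case (limit X a)
    have "(\<lambda>n. norm (X n - a)) \<longlonglongrightarrow> 0"
      using limit(2) by (simp add: LIM_zero tendsto_norm_zero)
    then have "(\<lambda>n. expectation N (X n) - expectation N a) \<longlonglongrightarrow> 0"
      by (rule Lim_null_comparison[rotated])
        (simp add: expectation_def norm_compress_le flip: compress_diff)
    then have "(\<lambda>n. expectation N (X n)) \<longlonglongrightarrow> expectation N a"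
      by (rule LIM_zero_cancel)
    with limit(1) sub show ?case
      unfolding cstar_subalgebra_def by (meson closed_sequentially)
  }
qed

lemma conditional_expectation_expectation:
  assumes N: "subgroup N G"
  shows "conditional_expectation (crossed (carrier G)) (crossed N) (expectation N)"
proof -
  have "expectation N (b * a) = b * expectation N a" "expectation N (a * b) = expectation N a * b"
    if "b \<in> crossed N" for a b
    unfolding expectation_def
    by (rule compress_mult_left compress_mult_right, rule crossed_block_diagonal[OF N that], assumption)+
  then show ?thesis
    unfolding conditional_expectation_def
    using expectation_in_crossed[OF N] expectation_eq_self[OF N]
    by (simp add: expectation_def compress_add compress_scaleC norm_compress_le positive_compress)
qed

text \<open>The compression keeps the diagonal, and the diagonal entries of \<open>star a * a\<close> are the squared norms
  of the columns of \<open>a\<close>.\<close>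

lemma faithful_expectation: "faithful_on A (expectation N)"
  unfolding faithful_on_def
proof (intro ballI impI)
  fix a assume E: "expectation N (star a * a) = 0"
  have "a \<cdot> ket i = 0" for i
  proof -
    have "entry (star a * a) i i = entry (expectation N (star a * a)) i i"
      by (simp add: expectation_def entry_compress)
    then have "cinner (a \<cdot> ket i) (a \<cdot> ket i) = 0"
      by (simp only: E entry_zero) (simp add: entry_eq_cinner bop_apply_simps cinner_star_right)
    then show ?thesis by (simp add: cinner_self)
  qed
  then show "a = 0"
    by (intro bop_eqI_entry) (simp add: entry_def zero_ell2.rep_eq bop_apply_zero_left)
qed

text \<open>An element may be far from the partial sums of its Fourier series. That it lies in the smaller
  crossed product is seen from the expectation, which fixes it.\<close>

lemma in_crossed_if_coef_eq_0:
  assumes N: "subgroup N G" and a: "a \<in> crossed (carrier G)"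
    and "\<And>s x. s \<in> carrier G \<Longrightarrow> s \<notin> N \<Longrightarrow> coef a s x = 0"
  shows "a \<in> crossed N"
proof -
  have "expectation N a = a"
    unfolding expectation_def
  proof (rule compress_eq_self)
    fix i j :: "'g \<times> 'x"
    assume ne: "(\<lambda>(t, x). (\<lambda>n. n \<otimes> t) ` N) i \<noteq> (\<lambda>(t, x). (\<lambda>n. n \<otimes> t) ` N) j"
    obtain t x r y where "i = (t, x)" "j = (r, y)" by (cases i; cases j)
    then show "entry a i j = 0"
      using ne same_coset_iff[OF N, of t r] assms(3)[of "t \<otimes> inv r"] by (auto simp: entry_eq_coef[OF a])
  qed
  then show ?thesis using expectation_in_crossed[OF N a] by simp
qed

end


section \<open>The tensor product of C(X) with a group C*-algebra\<close>

lemma Rep_tensor_vec: "Rep_ell2 (tensor_vec \<xi> \<eta>) (i, j) = Rep_ell2 \<xi> i * Rep_ell2 \<eta> j"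
proof -
  have "(\<Sum>p\<in>F. (cmod (case p of (i, j) \<Rightarrow> Rep_ell2 \<xi> i * Rep_ell2 \<eta> j))\<^sup>2) \<le> (norm \<xi> * norm \<eta>)\<^sup>2"
    if "finite F" for F
  proof -
    have "(\<Sum>p\<in>F. (cmod (case p of (i, j) \<Rightarrow> Rep_ell2 \<xi> i * Rep_ell2 \<eta> j))\<^sup>2)
        \<le> (\<Sum>p\<in>fst ` F \<times> snd ` F. (cmod (case p of (i, j) \<Rightarrow> Rep_ell2 \<xi> i * Rep_ell2 \<eta> j))\<^sup>2)"
      by (rule sum_mono2) (use \<open>finite F\<close> in \<open>auto simp: image_iff split: prod.splits\<close>, force+)
    also have "\<dots> = (\<Sum>i\<in>fst ` F. (cmod (Rep_ell2 \<xi> i))\<^sup>2) * (\<Sum>j\<in>snd ` F. (cmod (Rep_ell2 \<eta> j))\<^sup>2)"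
      by (simp add: sum_product sum.cartesian_product split_def norm_mult power_mult_distrib)
    also have "\<dots> \<le> (norm \<xi>)\<^sup>2 * (norm \<eta>)\<^sup>2"
      using \<open>finite F\<close> by (intro mult_mono ell2_sum_le sum_nonneg) auto
    finally show ?thesis by (simp add: power_mult_distrib)
  qed
  from ell2_of_finite_sums(1)[OF _ this] show ?thesis
    by (simp add: tensor_vec_def)
qed

lemma fibre_tensor_vec: "fibre (tensor_vec \<xi> \<eta>) i = Rep_ell2 \<xi> i *\<^sub>C \<eta>"
  by (rule ell2_eqI) (simp add: Rep_fibre Rep_tensor_vec scaleC_ell2.rep_eq)

lemma fibre_add: "fibre (\<xi> + \<eta>) k = fibre \<xi> k + fibre \<eta> k"
  by (rule ell2_eqI) (simp add: Rep_fibre plus_ell2.rep_eq)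

lemma fibre_scaleC: "fibre (c *\<^sub>C \<xi>) k = c *\<^sub>C fibre \<xi> k"
  by (rule ell2_eqI) (simp add: Rep_fibre scaleC_ell2.rep_eq)

lemma tensor_vec_ket: "tensor_vec (ket i) (ket j) = ket (i, j)"
  by (rule ell2_eqI) (auto simp: Rep_tensor_vec Rep_ket split_paired_all split: prod.splits)

lemma mult_op_apply:
  assumes "\<And>x. cmod (f x) \<le> M"
  shows "Rep_ell2 (mult_op f \<cdot> \<xi>) = (\<lambda>x. f x * Rep_ell2 \<xi> x)"
proof -
  have "0 \<le> M" using assms norm_ge_zero order_trans by blast
  then have "\<exists>a. (\<forall>\<xi>. Rep_ell2 (a \<cdot> \<xi>) = (\<lambda>x. f x * Rep_ell2 \<xi> (id x))) \<and> norm a \<le> M"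
    using assms by (intro ex_wcomp_bop[where h = "\<lambda>x. cnj (f x)" and \<tau> = id]) auto
  then obtain a where a: "\<And>\<xi>. Rep_ell2 (a \<cdot> \<xi>) = (\<lambda>x. f x * Rep_ell2 \<xi> x)" by auto
  have "mult_op f = a" unfolding mult_op_def by (rule bop_of_eqI) (rule a)
  then show ?thesis by (simp add: a)
qed

text \<open>The elementary tensors of basis vectors form the basis of the tensor product, so at most one
  operator satisfies the defining equations of the tensor product of operators. An operator which
  does is obtained by letting \<open>b\<close> act in each fibre over \<open>X\<close>, scaled by the value of \<open>f\<close>.\<close>

lemma tensor_op_mult_op:
  assumes f: "\<And>x. cmod (f x) \<le> M"
  shows "tensor_op (mult_op f) b = fibre_op (\<lambda>x. f x *\<^sub>C b)"
proof -
  have M: "norm (f x *\<^sub>C b) \<le> M * norm b" for x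
    by (simp add: norm_scaleC f mult_right_mono)
  show ?thesis
    unfolding tensor_op_def
  proof (rule the_equality, intro allI)
    show "fibre_op (\<lambda>x. f x *\<^sub>C b) \<cdot> tensor_vec \<xi> \<eta> = tensor_vec (mult_op f \<cdot> \<xi>) (b \<cdot> \<eta>)" for \<xi> \<eta>
      by (rule fibre_eqI) (simp add: fibre_fibre_op[OF M] fibre_tensor_vec mult_op_apply[OF f]
        bop_apply_scaleC bop_apply_scaleC_left scaleC_ell2_simps mult.commute)
    then show "c = fibre_op (\<lambda>x. f x *\<^sub>C b)"
      if "\<forall>\<xi> \<eta>. c \<cdot> tensor_vec \<xi> \<eta> = tensor_vec (mult_op f \<cdot> \<xi>) (b \<cdot> \<eta>)" for c
      by (intro bop_eqI_entry) (metis that tensor_vec_ket entry_def prod.collapse)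
  qed
qed

lemma entry_fibre_op:
  assumes "\<And>k. norm (b k) \<le> K"
  shows "entry (fibre_op b) (k, j) (k, l) = entry (b k) j l"
proof -
  have "fibre (ket (k, l)) k = ket l" by (rule ell2_eqI) (auto simp: Rep_fibre Rep_ket)
  then show ?thesis by (simp add: entry_def fibre_fibre_op[OF assms] flip: Rep_fibre)
qed

locale discrete_group = group G for G :: "'a monoid" (structure)
begin

text \<open>A unitary representation on \<open>\<ell>\<^sup>2\<close> of the whole type has to map the unit of the group to the
  identity. So the regular representation is extended by the trivial one off the carrier.\<close>

definition regular_rep :: "'a \<Rightarrow> 'a bop"
  where "regular_rep s = bop_of (\<lambda>\<xi> t. \<xi> (if t \<in> carrier G then inv s \<otimes> t else t))"

lemma regular_rep_apply:
  assumes s: "s \<in> carrier G"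
  shows "Rep_ell2 (regular_rep s \<cdot> \<xi>) t = Rep_ell2 \<xi> (if t \<in> carrier G then inv s \<otimes> t else t)"
proof -
  have *: "inv s \<otimes> (s \<otimes> t) = t" "s \<otimes> (inv s \<otimes> t) = t" if "t \<in> carrier G" for t
    using s that by (simp_all flip: m_assoc)
  have "\<exists>a. (\<forall>\<xi>. Rep_ell2 (a \<cdot> \<xi>) = (\<lambda>t. 1 * Rep_ell2 \<xi> (if t \<in> carrier G then inv s \<otimes> t else t))) \<and> norm a \<le> 1"
    using s by (intro ex_wcomp_bop[where h = "\<lambda>_. 1" and \<tau> = "\<lambda>t. if t \<in> carrier G then s \<otimes> t else t"])
      (auto simp: *)
  then obtain a where a: "\<And>\<xi>. Rep_ell2 (a \<cdot> \<xi>) = (\<lambda>t. Rep_ell2 \<xi> (if t \<in> carrier G then inv s \<otimes> t else t))"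
    by auto
  have "regular_rep s = a" unfolding regular_rep_def by (rule bop_of_eqI) (rule a)
  then show ?thesis by (simp add: a)
qed

lemma regular_rep_unitary: "regular_rep \<in> unitary_reps G"
  unfolding unitary_reps_def mem_Collect_eq
proof (intro conjI allI ballI)
  show "regular_rep \<one> \<cdot> \<xi> = \<xi>" for \<xi>
    by (rule ell2_eqI) (simp add: regular_rep_apply)
  fix s assume s: "s \<in> carrier G"
  show "regular_rep (s \<otimes> t) = regular_rep s * regular_rep t" if "t \<in> carrier G" for t
    using s that by (intro bop_eqI ell2_eqI) (simp add: regular_rep_apply bop_apply_simps inv_mult_group m_assoc)
  show "star (regular_rep s) = regular_rep (inv s)"
  proof (rule bop_eqI_entry)
    fix i j
    have "(if j \<in> carrier G then inv s \<otimes> j else j) = i \<longleftrightarrow> (if i \<in> carrier G then s \<otimes> i else i) = j"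
      using s by (auto simp flip: m_assoc)
    then show "entry (star (regular_rep s)) i j = entry (regular_rep (inv s)) i j"
      using s by (simp only: entry_star) (simp add: entry_def regular_rep_apply Rep_ket)
  qed
qed

lemma norm_unitary_rep_le:
  assumes "\<rho> \<in> unitary_reps G" and s: "s \<in> carrier G"
  shows "norm (\<rho> s) \<le> 1"
proof -
  have "\<rho> (inv s \<otimes> s) = \<rho> (inv s) * \<rho> s" "star (\<rho> s) = \<rho> (inv s)"
    using assms(1) s inv_closed[OF s] unfolding unitary_reps_def by blast+
  then have "star (\<rho> s) * \<rho> s = \<rho> (inv s \<otimes> s)" by simp
  also have "\<dots> = 1"
    using assms by (intro bop_eqI) (simp add: unitary_reps_def one_apply)
  finally have "(norm (\<rho> s))\<^sup>2 = 1"
    using cstar_identity[of "\<rho> s"] by simp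
  then show ?thesis using norm_ge_zero[of "\<rho> s"] by (simp only: power2_eq_1_iff) linarith
qed

definition summand :: "'a \<Rightarrow> ('a \<Rightarrow> 'a bop) \<Rightarrow> 'a bop"
  where "summand s \<rho> = (if \<rho> \<in> unitary_reps G then \<rho> s else 0)"

lemma universal_unitary_eq: "universal_unitary G s = fibre_op (summand s)"
  unfolding universal_unitary_def fibre_op_def
  by (rule arg_cong[of _ _ bop_of])
    (auto simp: fun_eq_iff summand_def bop_apply_zero_left zero_ell2.rep_eq)

lemma norm_summand_le: "s \<in> carrier G \<Longrightarrow> norm (summand s \<rho>) \<le> 1"
  by (simp add: summand_def norm_unitary_rep_le)

lemma norm_universal_unitary_le: "s \<in> carrier G \<Longrightarrow> norm (universal_unitary G s) \<le> 1"
  unfolding universal_unitary_eq by (rule norm_fibre_op_le) (rule norm_summand_le)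

lemma universal_unitary_mult:
  assumes "s \<in> carrier G" "t \<in> carrier G"
  shows "universal_unitary G s * universal_unitary G t = universal_unitary G (s \<otimes> t)"
  unfolding universal_unitary_eq fibre_op_mult[OF norm_summand_le[OF assms(1)] norm_summand_le[OF assms(2)]]
  by (rule arg_cong[of _ _ fibre_op]) (use assms in \<open>auto simp: unitary_reps_def summand_def\<close>)

lemma universal_unitary_star:
  assumes "s \<in> carrier G"
  shows "star (universal_unitary G s) = universal_unitary G (inv s)"
  unfolding universal_unitary_eq fibre_op_star[OF norm_summand_le[OF assms]]
  by (rule arg_cong[of _ _ fibre_op])
    (use assms in \<open>auto simp: unitary_reps_def summand_def linear_0[OF bounded_linear.linear[OF bounded_linear_star]]\<close>)

definition tensor_monomial :: "('x \<Rightarrow> complex) \<Rightarrow> 'a \<Rightarrow> ('x \<times> (('a \<Rightarrow> 'a bop) \<times> 'a)) bop"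
  where "tensor_monomial f s = tensor_op (mult_op f) (universal_unitary G s)"

end

locale discrete_abelian_group = discrete_group + comm_group

text \<open>The coefficients are read off in the summand of the universal representation given by the
  regular representation.\<close>

lemma (in discrete_abelian_group) coefficient_rep_tensor_monomial:
  assumes X: "compact (UNIV :: 'x::t2_space set)"
  shows "coefficient_rep G (tensor_monomial :: ('x \<Rightarrow> complex) \<Rightarrow> _)"
proof -
  have eq: "tensor_monomial f s = fibre_op (\<lambda>x. f x *\<^sub>C universal_unitary G s)"
    and bd: "\<exists>M. \<forall>x. norm (f x *\<^sub>C universal_unitary G s) \<le> M"
    if f: "continuous_on UNIV f" for f :: "'x \<Rightarrow> complex" and s
  proof -
    obtain M where M: "\<And>x. cmod (f x) \<le> M" using continuous_ex_bound[OF X f] by blast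
    show "tensor_monomial f s = fibre_op (\<lambda>x. f x *\<^sub>C universal_unitary G s)"
      unfolding tensor_monomial_def by (rule tensor_op_mult_op[OF M])
    show "\<exists>M. \<forall>x. norm (f x *\<^sub>C universal_unitary G s) \<le> M"
      by (rule exI[of _ "M * norm (universal_unitary G s)"]) (simp add: norm_scaleC M mult_right_mono)
  qed
  show ?thesis
  proof (intro coefficient_rep.intro coefficient_rep_axioms.intro comm_group_axioms)
    fix f :: "'x \<Rightarrow> complex" and s
    assume f: "continuous_on UNIV f" and s: "s \<in> carrier G"
    obtain Mf where Mf: "\<And>x. norm (f x *\<^sub>C universal_unitary G s) \<le> Mf" using bd[OF f] by blast
    show "tensor_monomial (\<lambda>x. f x + g x) s = tensor_monomial f s + tensor_monomial g s"
      if g: "continuous_on UNIV g" for g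
    proof -
      obtain Mg where Mg: "\<And>x. norm (g x *\<^sub>C universal_unitary G s) \<le> Mg" using bd[OF g] by blast
      show ?thesis
        unfolding eq[OF f] eq[OF g] eq[OF continuous_on_add[OF f g]]
      proof (rule fibre_op_eqI)
        show "norm ((f x + g x) *\<^sub>C universal_unitary G s) \<le> Mf + Mg" for x
          unfolding scaleC_add_left by (rule order_trans[OF norm_triangle_ineq add_mono[OF Mf Mg]])
        show "fibre ((fibre_op (\<lambda>x. f x *\<^sub>C universal_unitary G s) + fibre_op (\<lambda>x. g x *\<^sub>C universal_unitary G s)) \<cdot> \<xi>) x
            = ((f x + g x) *\<^sub>C universal_unitary G s) \<cdot> fibre \<xi> x" for \<xi> x
          unfolding scaleC_add_left bop_apply_simps fibre_add fibre_fibre_op[OF Mf] fibre_fibre_op[OF Mg] ..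
      qed
    qed
    show "tensor_monomial (\<lambda>x. k * f x) s = k *\<^sub>C tensor_monomial f s" for k
      unfolding eq[OF f] eq[OF continuous_on_mult_left[OF f]]
    proof (rule fibre_op_eqI)
      show "norm ((k * f x) *\<^sub>C universal_unitary G s) \<le> cmod k * Mf" for x
        using mult_left_mono[OF Mf, of "cmod k" x] by (simp add: norm_scaleC norm_mult mult.assoc)
      show "fibre ((k *\<^sub>C fibre_op (\<lambda>x. f x *\<^sub>C universal_unitary G s)) \<cdot> \<xi>) x
          = ((k * f x) *\<^sub>C universal_unitary G s) \<cdot> fibre \<xi> x" for \<xi> x
        unfolding scaleC_scaleC[symmetric] bop_apply_scaleC_left[of k] fibre_scaleC fibre_fibre_op[OF Mf] ..
    qed
    show "tensor_monomial f s * tensor_monomial g t = tensor_monomial (\<lambda>x. f x * g x) (s \<otimes> t)"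
      if g: "continuous_on UNIV g" and t: "t \<in> carrier G" for g t
    proof -
      obtain Mg where Mg: "\<And>x. norm (g x *\<^sub>C universal_unitary G t) \<le> Mg" using bd[OF g] by blast
      show ?thesis
        unfolding eq[OF f] eq[OF g] eq[OF continuous_on_mult[OF f g]] fibre_op_mult[OF Mf Mg]
        by (simp add: mult_scaleC_left mult_scaleC_right scaleC_scaleC universal_unitary_mult[OF s t] mult.commute)
    qed
    show "star (tensor_monomial f s) = tensor_monomial (\<lambda>x. cnj (f x)) (inv s)"
      unfolding eq[OF f] eq[OF continuous_on_cnj[OF f]] fibre_op_star[OF Mf]
      by (simp add: star_scaleC universal_unitary_star[OF s])
    show "norm (tensor_monomial f s) \<le> M" if M: "\<And>x. cmod (f x) \<le> M" for M
      unfolding eq[OF f]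
    proof (rule norm_fibre_op_le)
      fix x
      have "cmod (f x) * norm (universal_unitary G s) \<le> M * 1"
        using M norm_universal_unitary_le[OF s] order_trans[OF norm_ge_zero M]
        by (intro mult_mono) auto
      then show "norm (f x *\<^sub>C universal_unitary G s) \<le> M" by (simp add: norm_scaleC)
    qed
  next
    fix F :: "'a \<Rightarrow> 'x \<Rightarrow> complex" and S s and x :: 'x
    assume S: "finite S" "S \<subseteq> carrier G" and F: "\<And>s. continuous_on UNIV (F s)" and s: "s \<in> S"
    have sc: "s \<in> carrier G" using S s by blast
    \<comment> \<open>the row of the identity in the summand of the regular representation, over the point \<open>x\<close>\<close>
    let ?i = "(x, (regular_rep, \<one>))" and ?j = "(x, (regular_rep, inv s))"
    have e: "entry (tensor_monomial (F r) r) ?i ?j = (if r = s then F s x else 0)" if "r \<in> S" for r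
    proof -
      have r: "r \<in> carrier G" using S that by blast
      obtain M where M: "\<And>x. norm (F r x *\<^sub>C universal_unitary G r) \<le> M" using bd[OF F] by blast
      have "inv r = inv s \<longleftrightarrow> r = s" using r sc inv_inj by (auto dest: inj_onD)
      then have "entry (regular_rep r) \<one> (inv s) = (if r = s then 1 else 0)"
        using r by (simp add: entry_def regular_rep_apply Rep_ket)
      then have "entry (universal_unitary G r) (regular_rep, \<one>) (regular_rep, inv s) = (if r = s then 1 else 0)"
        unfolding universal_unitary_eq entry_fibre_op[OF norm_summand_le[OF r]]
        by (simp add: summand_def regular_rep_unitary)
      then show ?thesis
        unfolding eq[OF F] entry_fibre_op[OF M] entry_scaleC by simp
    qed
    have "entry (\<Sum>r\<in>S. tensor_monomial (F r) r) ?i ?j = F s x"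
      unfolding entry_sum using S s by (simp add: e)
    then show "cmod (F s x) \<le> norm (\<Sum>r\<in>S. tensor_monomial (F r) r)"
      using norm_entry_le[of "\<Sum>r\<in>S. tensor_monomial (F r) r" ?i ?j] by simp
  qed
qed

text \<open>For fixed \<open>f\<close> the tensor product \<open>f \<otimes> b\<close> is a bounded linear function of \<open>b\<close>, so it is determined
  by the unitaries \<open>b\<close> which generate the group C*-algebra.\<close>

lemma (in discrete_abelian_group) cstar_tensor_eq:
  assumes X: "compact (UNIV :: 'x::t2_space set)"
  shows "cstar_tensor (continuous_functions :: 'x bop set) (group_cstar G)
    = closure (cspan {tensor_monomial f s | f s. continuous_on UNIV f \<and> s \<in> carrier G})"
    (is "_ = closure (cspan ?B)")
proof
  have "?B \<subseteq> {tensor_op a b | a b. a \<in> continuous_functions \<and> b \<in> group_cstar G}"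
    unfolding tensor_monomial_def continuous_functions_def group_cstar_def
    by (blast intro: closure_cspan_base)
  then show "closure (cspan ?B) \<subseteq> cstar_tensor continuous_functions (group_cstar G)"
    unfolding cstar_tensor_def by (intro closure_mono complex_vector.span_mono)
  have gen: "tensor_op (mult_op f) b \<in> closure (cspan ?B)"
    if f: "continuous_on UNIV f" and b: "b \<in> group_cstar G" for f :: "'x \<Rightarrow> complex" and b
  proof -
    obtain M where M: "\<And>x. cmod (f x) \<le> M" using continuous_ex_bound[OF X f] by blast
    have bd: "norm (f x *\<^sub>C c) \<le> M * norm c" for x and c :: "(('a \<Rightarrow> 'a bop) \<times> 'a) bop"
      by (simp add: norm_scaleC M mult_right_mono)
    define T where "T c = fibre_op (\<lambda>x. f x *\<^sub>C c)" for c :: "(('a \<Rightarrow> 'a bop) \<times> 'a) bop"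
    have fT: "fibre (T c \<cdot> \<xi>) x = (f x *\<^sub>C c) \<cdot> fibre \<xi> x" for c \<xi> x
      unfolding T_def by (rule fibre_fibre_op[OF bd])
    have nT: "norm (T c) \<le> M * norm c" for c
      unfolding T_def by (rule norm_fibre_op_le[OF bd])
    have Tadd: "T (c + d) = T c + T d" for c d
    proof (rule bop_eqI, rule fibre_eqI)
      show "fibre (T (c + d) \<cdot> \<xi>) x = fibre ((T c + T d) \<cdot> \<xi>) x" for \<xi> x
        unfolding bop_apply_simps fibre_add fT scaleC_add_right ..
    qed
    have Tscale: "T (k *\<^sub>C c) = k *\<^sub>C T c" for k c
    proof (rule bop_eqI, rule fibre_eqI)
      show "fibre (T (k *\<^sub>C c) \<cdot> \<xi>) x = fibre ((k *\<^sub>C T c) \<cdot> \<xi>) x" for \<xi> x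
        unfolding bop_apply_scaleC_left fibre_scaleC fT scaleC_ell2_simps(3) by (simp add: mult.commute)
    qed
    have lin: "bounded_linear T"
      by (rule bounded_linear_intro[of _ M]) (simp_all add: Tadd Tscale scaleR_scaleC nT mult.commute)
    have "T b \<in> closure (cspan ?B)"
      using b unfolding group_cstar_def
    proof (induction rule: closure_cspan_induct)
      case (base b)
      then obtain s where s: "s \<in> carrier G" "b = universal_unitary G s" by blast
      have "T b = tensor_monomial f s"
        unfolding tensor_monomial_def T_def s(2) by (rule tensor_op_mult_op[OF M, symmetric])
      then show ?case using f s(1) by (intro closure_cspan_base) blast
    next
      case zero
      have "T 0 = 0" using lin by (simp add: bounded_linear.linear linear_0)
      then show ?case using closure_subset complex_vector.span_zero by auto
    next
      case (limit Y b)
      show ?case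
        by (rule closed_sequentially[OF closed_closure limit(1)])
          (rule bounded_linear.tendsto[OF lin limit(2)])
    qed (simp_all add: Tadd Tscale closure_cspan_add closure_cspan_scaleC)
    then show ?thesis by (simp add: T_def tensor_op_mult_op[OF M])
  qed
  show "cstar_tensor continuous_functions (group_cstar G) \<subseteq> closure (cspan ?B)"
  proof
    fix c assume "c \<in> cstar_tensor (continuous_functions :: 'x bop set) (group_cstar G)"
    then show "c \<in> closure (cspan ?B)"
      unfolding cstar_tensor_def
    proof (induction rule: closure_cspan_induct)
      case (base c)
      then show ?case using gen unfolding continuous_functions_def by blast
    next
      case zero
      show ?case using closure_subset complex_vector.span_zero by blast
    next
      case (limit Y c)
      show ?case by (rule closed_sequentially[OF closed_closure limit])
    qed (simp_all add: closure_cspan_add closure_cspan_scaleC)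
  qed
qed


section \<open>The relative commutant of C(X)\<close>

lemma cstar_subalgebra_relative_commutant:
  assumes A: "cstar_subalgebra A" and D: "\<And>d. d \<in> D \<Longrightarrow> star d \<in> D"
  shows "cstar_subalgebra (relative_commutant A D)"
  unfolding cstar_subalgebra_def
proof (intro conjI ballI allI)
  have clA: "closed A" using A by (simp add: cstar_subalgebra_def)
  show "closed (relative_commutant A D)"
    unfolding closed_sequential_limits
  proof (intro allI impI)
    fix X a assume X: "(\<forall>n. X n \<in> relative_commutant A D) \<and> X \<longlonglongrightarrow> a"
    then have lim: "X \<longlonglongrightarrow> a" and XA: "\<And>n. X n \<in> A" and com: "\<And>n d. d \<in> D \<Longrightarrow> X n * d = d * X n"
      by (auto simp: relative_commutant_def)
    have "a \<in> A" using closed_sequentially[OF clA XA lim] .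
    moreover have "a * d = d * a" if "d \<in> D" for d
    proof (rule LIMSEQ_unique)
      show "(\<lambda>n. X n * d) \<longlonglongrightarrow> a * d" by (rule tendsto_mult_right[OF lim])
      show "(\<lambda>n. X n * d) \<longlonglongrightarrow> d * a" unfolding com[OF that] by (rule tendsto_mult_left[OF lim])
    qed
    ultimately show "a \<in> relative_commutant A D" by (simp add: relative_commutant_def)
  qed
  show "0 \<in> relative_commutant A D"
    using A by (simp add: relative_commutant_def cstar_subalgebra_def)
  fix a assume a: "a \<in> relative_commutant A D"
  show "c *\<^sub>C a \<in> relative_commutant A D" for c
    using A a by (simp add: relative_commutant_def cstar_subalgebra_def mult_scaleC_left mult_scaleC_right)
  show "star a \<in> relative_commutant A D"
    unfolding relative_commutant_def mem_Collect_eq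
  proof (intro conjI ballI)
    show "star a \<in> A" using A a by (simp add: relative_commutant_def cstar_subalgebra_def)
    fix d assume "d \<in> D"
    then have "a * star d = star d * a" using a D by (simp add: relative_commutant_def)
    then show "star a * d = d * star a" by (metis star_mult star_star)
  qed
  fix b assume b: "b \<in> relative_commutant A D"
  show "a + b \<in> relative_commutant A D"
    using A a b by (simp add: relative_commutant_def cstar_subalgebra_def distrib_left distrib_right)
  show "a * b \<in> relative_commutant A D"
    using A a b unfolding relative_commutant_def cstar_subalgebra_def mem_Collect_eq
    by (metis mult.assoc)
qed

context compact_dynamics
begin

lemma subgroup_carrier: "subgroup (carrier G) G"
  by (rule subgroup_self)

lemma star_crossed_functions:
  assumes "d \<in> crossed_functions G \<phi>"
  shows "star d \<in> crossed_functions G \<phi>"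
proof -
  obtain f where f: "d = crossed_fun G \<phi> f" "continuous_on UNIV f"
    using assms by (auto simp: crossed_functions_def)
  have c: "continuous_on UNIV (\<lambda>x. cnj (f x))" by (intro continuous_intros f)
  have "star d = crossed_fun G \<phi> (\<lambda>x. cnj (f x))"
    unfolding f(1) crossed_fun_eq_monomial[OF f(2)] crossed_fun_eq_monomial[OF c]
    using monomial_star[OF f(2) one_closed] by (simp add: act_one)
  then show ?thesis using c by (auto simp: crossed_functions_def)
qed

lemma cstar_subalgebra_commutant: "cstar_subalgebra commutant"
  by (intro cstar_subalgebra_relative_commutant cstar_subalgebra_crossed subgroup_carrier star_crossed_functions)

lemma crossed_functions_subset_commutant: "crossed_functions G \<phi> \<subseteq> commutant"
proof
  fix d assume "d \<in> crossed_functions G \<phi>"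
  then obtain f where f: "d = crossed_fun G \<phi> f" "continuous_on UNIV f"
    by (auto simp: crossed_functions_def)
  then have d: "d \<in> crossed (carrier G)"
    using crossed_functions_subset[of "carrier G"] by (auto simp: crossed_functions_def)
  have "\<forall>s\<in>carrier G. \<forall>x. coef d s x \<noteq> 0 \<longrightarrow> \<phi> s x = x"
    using f by (auto simp: crossed_fun_eq_monomial coef_monomial act_one)
  then show "d \<in> commutant" using commutant_iff[OF d] by simp
qed

lemma unit_mult:
  assumes a: "a \<in> crossed (carrier G)"
  shows "crossed_fun G \<phi> (\<lambda>_. 1) * a = a" "a * crossed_fun G \<phi> (\<lambda>_. 1) = a"
proof -
  show "crossed_fun G \<phi> (\<lambda>_. 1) * a = a"
  proof (rule bop_eqI_entry)
    fix i j :: "'g \<times> 'x"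
    show "entry (crossed_fun G \<phi> (\<lambda>_. 1) * a) i j = entry a i j"
      by (cases i; cases j) (auto simp: entry_crossed_fun_mult entry_eq_coef[OF a])
  qed
  show "a * crossed_fun G \<phi> (\<lambda>_. 1) = a"
  proof (rule bop_eqI_entry)
    fix i j :: "'g \<times> 'x"
    show "entry (a * crossed_fun G \<phi> (\<lambda>_. 1)) i j = entry a i j"
      by (cases i; cases j) (auto simp: entry_mult_crossed_fun entry_eq_coef[OF a])
  qed
qed

lemma cstar_inclusion_commutant: "cstar_inclusion (crossed (carrier G)) commutant"
proof -
  let ?e = "crossed_fun G \<phi> (\<lambda>_. 1)"
  have e: "?e \<in> crossed_functions G \<phi>" by (auto simp: crossed_functions_def)
  then have eC: "?e \<in> crossed (carrier G)" using crossed_functions_subset[of "carrier G"] by blast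
  have "star ?e = ?e"
    by (simp add: crossed_fun_eq_monomial monomial_star)
  then have "positive ?e"
    unfolding positive_def using unit_mult(1)[OF eC] by metis
  moreover have "norm ?e \<le> 1" by (rule norm_crossed_fun_le) simp
  ultimately have "has_approximate_unit_in (crossed (carrier G)) commutant"
    unfolding has_approximate_unit_in_def
    using e crossed_functions_subset_commutant unit_mult
    by (intro exI[of _ "principal {?e}"])
      (auto simp: eventually_principal principal_eq_bot_iff tendsto_def)
  moreover have "commutant \<subseteq> crossed (carrier G)" by (auto simp: relative_commutant_def)
  ultimately show ?thesis
    unfolding cstar_inclusion_def
    using cstar_subalgebra_commutant cstar_subalgebra_crossed[OF subgroup_carrier] by blast
qed

text \<open>Every monomial intertwines the functions with their translates, hence it normalizes their
  relative commutant.\<close>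

lemma monomial_crossed_fun:
  assumes f: "continuous_on UNIV f" and d: "continuous_on UNIV d" and s: "s \<in> carrier G"
  shows "crossed_fun G \<phi> d * monomial f s = monomial f s * crossed_fun G \<phi> (\<lambda>x. d (\<phi> s x))"
proof -
  have d': "continuous_on UNIV (\<lambda>x. d (\<phi> s x))" by (rule continuous_comp_act[OF d s])
  show ?thesis
    unfolding crossed_fun_eq_monomial[OF d] crossed_fun_eq_monomial[OF d'] monomial_mult[OF d f one_closed s]
      monomial_mult[OF f d' s one_closed]
    using s by (simp add: act_one act_inv mult.commute)
qed

lemma monomial_conjugation:
  assumes f: "continuous_on UNIV f" and s: "s \<in> carrier G" and b: "b \<in> commutant"
  shows "monomial f s * b * star (monomial f s) \<in> commutant"
proof -
  let ?n = "monomial f s"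
  have sub: "cstar_subalgebra (crossed (carrier G))" by (rule cstar_subalgebra_crossed[OF subgroup_carrier])
  have n: "?n \<in> crossed (carrier G)" using f s by (rule monomial_in_crossed)
  have bC: "b \<in> crossed (carrier G)" using b by (simp add: relative_commutant_def)
  have "?n * b * star ?n \<in> crossed (carrier G)" using sub n bC unfolding cstar_subalgebra_def by blast
  moreover have "?n * b * star ?n * crossed_fun G \<phi> d = crossed_fun G \<phi> d * (?n * b * star ?n)"
    if d: "continuous_on UNIV d" for d
  proof -
    let ?d = "crossed_fun G \<phi> d" and ?d' = "crossed_fun G \<phi> (\<lambda>x. d (\<phi> s x))"
    have d': "continuous_on UNIV (\<lambda>x. d (\<phi> s x))" by (rule continuous_comp_act[OF d s])
    have c: "continuous_on UNIV (\<lambda>x. cnj (f (\<phi> s x)))" by (intro continuous_intros continuous_comp_act f s)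
    have e1: "star ?n * ?d = ?d' * star ?n"
      unfolding monomial_star[OF f s] monomial_crossed_fun[OF c d' inv_closed[OF s]]
      using s by (simp add: act_inv)
    have e2: "b * ?d' = ?d' * b"
      using b d' by (auto simp: relative_commutant_def crossed_functions_def)
    have "?n * b * star ?n * ?d = ?n * (b * ?d') * star ?n"
      by (simp only: e1 mult.assoc)
    also have "\<dots> = (?n * ?d') * b * star ?n"
      unfolding e2 by (simp only: mult.assoc)
    also have "\<dots> = ?d * (?n * b * star ?n)"
      unfolding monomial_crossed_fun[OF f d s, symmetric] by (simp only: mult.assoc)
    finally show ?thesis .
  qed
  ultimately show ?thesis by (auto simp: relative_commutant_def crossed_functions_def)
qed

lemma regular_inclusion_commutant: "regular_inclusion (crossed (carrier G)) commutant"
proof -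
  have "monomial f s \<in> normalizers (crossed (carrier G)) commutant"
    if f: "continuous_on UNIV f" and s: "s \<in> carrier G" for f s
  proof -
    have c: "continuous_on UNIV (\<lambda>x. cnj (f (\<phi> s x)))" by (intro continuous_intros continuous_comp_act f s)
    have "star (monomial f s) * b * monomial f s \<in> commutant" if b: "b \<in> commutant" for b
      using monomial_conjugation[OF c inv_closed[OF s] b] unfolding monomial_star[OF f s, symmetric] star_star .
    then show ?thesis
      unfolding normalizers_def using monomial_conjugation[OF f s] monomial_in_crossed[OF f s] by blast
  qed
  then have "{monomial f s | f s. continuous_on UNIV f \<and> s \<in> carrier G}
      \<subseteq> normalizers (crossed (carrier G)) commutant"
    by blast
  from closure_mono[OF complex_vector.span_mono[OF this]]
  have "crossed (carrier G) \<subseteq> closure (cspan (normalizers (crossed (carrier G)) commutant))"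
    by (simp only: flip: crossed_eq)
  then show ?thesis
    unfolding regular_inclusion_def using cstar_inclusion_commutant by blast
qed

text \<open>An abelian algebra containing the relative commutant contains C(X); its elements
  therefore commute with C(X) and lie in the relative commutant.\<close>

lemma maximal_abelian_commutant:
  assumes "abelian commutant"
  shows "maximal_abelian (crossed (carrier G)) commutant"
  unfolding maximal_abelian_def
proof (intro conjI allI impI assms cstar_subalgebra_commutant)
  show "commutant \<subseteq> crossed (carrier G)" by (auto simp: relative_commutant_def)
  fix B assume B: "cstar_subalgebra B \<and> B \<subseteq> crossed (carrier G) \<and> abelian B \<and> commutant \<subseteq> B"
  then have "B \<subseteq> commutant"
    using crossed_functions_subset_commutant unfolding relative_commutant_def abelian_def by blast
  with B show "B = commutant" by blast
qed

section \<open>The kernel of the action\<close>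

definition kernel_of_action :: "'g set"
  where "kernel_of_action = {s \<in> carrier G. \<forall>x. \<phi> s x = x}"

lemma subgroup_kernel: "subgroup kernel_of_action G"
  by (rule subgroupI) (auto simp: kernel_of_action_def act_mult act_one, use act_inv(1) in metis)

lemma normal_kernel: "kernel_of_action \<lhd> G"
  unfolding normal_inv_iff
proof (intro conjI ballI subgroup_kernel)
  fix t s assume "t \<in> carrier G" "s \<in> kernel_of_action"
  then show "t \<otimes> s \<otimes> inv t \<in> kernel_of_action"
    by (auto simp: kernel_of_action_def act_mult act_inv)
qed

lemma fix_interior_condition_eq_kernel:
  assumes "fix_interior_condition G \<phi> N"
  shows "N = kernel_of_action"
proof -
  have N: "N \<subseteq> carrier G" and i: "\<And>s. s \<in> carrier G \<Longrightarrow> interior {x. \<phi> s x = x} = (if s \<in> N then UNIV else {})"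
    using assms unfolding fix_interior_condition_def abelian_subgroup_def by (auto dest: subgroup.subset)
  have "s \<in> N \<longleftrightarrow> (\<forall>x. \<phi> s x = x)" if "s \<in> carrier G" for s
  proof
    assume "s \<in> N"
    then have "interior {x. \<phi> s x = x} = UNIV" using i[OF that] by simp
    then show "\<forall>x. \<phi> s x = x" using interior_subset[of "{x. \<phi> s x = x}"] by blast
  next
    assume "\<forall>x. \<phi> s x = x"
    then have "interior {x. \<phi> s x = x} = UNIV" by simp
    then show "s \<in> N" using i[OF that] by (simp split: if_splits)
  qed
  then show ?thesis using N by (auto simp: kernel_of_action_def)
qed

text \<open>If \<open>s\<close> acts trivially, its unitary commutes with C(X). When the relative commutant is the crossed
  product by \<open>N\<close>, the coefficient \<open>1\<close> of this unitary at \<open>s\<close> forces \<open>s\<close> to be in \<open>N\<close>.\<close>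

lemma commutant_condition_eq_kernel:
  assumes "commutant_condition G \<phi> N"
  shows "N = kernel_of_action"
proof
  have N: "N \<subseteq> carrier G" and triv: "\<And>s x. s \<in> N \<Longrightarrow> \<phi> s x = x" and eq: "commutant = crossed N"
    using assms unfolding commutant_condition_def abelian_subgroup_def by (auto dest: subgroup.subset)
  show "N \<subseteq> kernel_of_action" using N triv by (auto simp: kernel_of_action_def)
  show "kernel_of_action \<subseteq> N"
  proof
    fix s assume s: "s \<in> kernel_of_action"
    then have sc: "s \<in> carrier G" by (simp add: kernel_of_action_def)
    let ?w = "monomial (\<lambda>_. 1) s"
    have w: "?w \<in> crossed (carrier G)" using sc by (intro monomial_in_crossed) simp_all
    have "?w \<in> commutant"
      unfolding commutant_iff[OF w] using s sc by (auto simp: coef_monomial kernel_of_action_def)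
    then have "?w \<in> crossed N" by (simp add: eq)
    then show "s \<in> N"
      using coef_crossed_eq_0[of ?w N s] N sc by (auto simp: coef_monomial)
  qed
qed

text \<open>Off \<open>N\<close> the fixed points have empty interior, so the coefficients of an element of the relative
  commutant vanish there.\<close>

lemma commutant_eq_crossed:
  assumes "fix_interior_condition G \<phi> N"
  shows "commutant = crossed N"
proof
  have N: "subgroup N G" and i: "\<And>s. s \<in> carrier G \<Longrightarrow> interior {x. \<phi> s x = x} = (if s \<in> N then UNIV else {})"
    using assms unfolding fix_interior_condition_def abelian_subgroup_def by auto
  have Nc: "N \<subseteq> carrier G" using N by (rule subgroup.subset)
  have triv: "\<phi> s x = x" if "s \<in> N" for s x
    using that fix_interior_condition_eq_kernel[OF assms] by (simp add: kernel_of_action_def)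
  show "commutant \<subseteq> crossed N"
  proof
    fix a assume a: "a \<in> commutant"
    show "a \<in> crossed N"
    proof (rule in_crossed_if_coef_eq_0[OF N])
      show "a \<in> crossed (carrier G)" using a by (simp add: relative_commutant_def)
      show "coef a s x = 0" if "s \<in> carrier G" "s \<notin> N" for s x
        using coef_supported_interior[OF a that(1), of x] i[OF that(1)] that(2) by auto
    qed
  qed
  show "crossed N \<subseteq> commutant"
  proof
    fix a assume a: "a \<in> crossed N"
    then have "a \<in> crossed (carrier G)" using crossed_mono[OF Nc] by blast
    then show "a \<in> commutant"
      using commutant_iff coef_crossed_eq_0[OF a Nc] triv by blast
  qed
qed

lemma abelian_crossed:
  assumes N: "abelian_subgroup N G" and triv: "\<And>s x. s \<in> N \<Longrightarrow> \<phi> s x = x"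
  shows "abelian (crossed N)"
proof -
  have Nc: "s \<in> carrier G" and com: "t \<in> N \<Longrightarrow> s \<otimes> t = t \<otimes> s" and inv: "inv s \<in> N" if "s \<in> N" for s t
    using N that by (auto simp: abelian_subgroup_def dest: subgroup.subset subgroup.m_inv_closed)
  have 1: "monomial f s * b = b * monomial f s"
    if f: "continuous_on UNIV f" and s: "s \<in> N" and "b \<in> crossed N" for f s b
    using that(3) unfolding crossed_eq
  proof (induction rule: closure_cspan_induct)
    case (base b)
    then obtain g t where gt: "b = monomial g t" "continuous_on UNIV g" "t \<in> N" by blast
    then show ?case
      using s f by (simp add: monomial_mult Nc triv inv com mult.commute)
  next
    case (limit X b)
    have "(\<lambda>n. monomial f s * X n) \<longlonglongrightarrow> b * monomial f s"
      unfolding limit(1) by (rule tendsto_mult_right[OF limit(2)])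
    then show ?case using tendsto_mult_left[OF limit(2)] LIMSEQ_unique by blast
  qed (simp_all add: distrib_left distrib_right mult_scaleC_left mult_scaleC_right)
  have "a * b = b * a" if "a \<in> crossed N" and b: "b \<in> crossed N" for a b
    using that(1) unfolding crossed_eq
  proof (induction rule: closure_cspan_induct)
    case (base a)
    then show ?case using 1 b by blast
  next
    case (limit X a)
    have "(\<lambda>n. X n * b) \<longlonglongrightarrow> b * a"
      unfolding limit(1) by (rule tendsto_mult_left[OF limit(2)])
    then show ?case using tendsto_mult_right[OF limit(2)] LIMSEQ_unique by blast
  qed (simp_all add: distrib_left distrib_right mult_scaleC_left mult_scaleC_right)
  then show ?thesis by (simp add: abelian_def)
qed

section \<open>Equivalence of the conditions\<close>

text \<open>A trivial action reduces the covariant multiplication of monomials to convolution.\<close>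

lemma coefficient_rep_monomial:
  assumes N: "abelian_subgroup N G" and triv: "\<And>s x. s \<in> N \<Longrightarrow> \<phi> s x = x"
  shows "coefficient_rep (G\<lparr>carrier := N\<rparr>) monomial"
proof -
  have sub: "subgroup N G" and com: "\<And>s t. s \<in> N \<Longrightarrow> t \<in> N \<Longrightarrow> s \<otimes> t = t \<otimes> s"
    using N by (auto simp: abelian_subgroup_def)
  have Nc: "s \<in> carrier G" and inv: "inv s \<in> N" if "s \<in> N" for s
    using sub that by (auto dest: subgroup.subset subgroup.m_inv_closed)
  have "group (G\<lparr>carrier := N\<rparr>)" by (rule subgroup.subgroup_is_group[OF sub is_group])
  then have cg: "comm_group (G\<lparr>carrier := N\<rparr>)"
    by (rule group.group_comm_groupI) (simp add: com)
  have triv': "\<phi> (inv s) x = x" if "s \<in> N" for s x using triv[OF inv[OF that]] .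
  show ?thesis
  proof (intro coefficient_rep.intro coefficient_rep_axioms.intro cg)
    fix F :: "'g \<Rightarrow> 'x \<Rightarrow> complex" and S s and x :: 'x
    assume S: "finite S" "S \<subseteq> carrier (G\<lparr>carrier := N\<rparr>)" and F: "\<And>s. continuous_on UNIV (F s)" and s: "s \<in> S"
    have "coef (monomial (F r) r) s x = (if r = s then F s x else 0)" if "r \<in> S" for r
      using S s that Nc F by (auto simp: coef_monomial subset_eq)
    then have "entry (\<Sum>r\<in>S. monomial (F r) r) (\<one>, x) (inv s, x) = F s x"
      unfolding entry_sum coef_def using S s by simp
    then show "cmod (F s x) \<le> norm (\<Sum>r\<in>S. monomial (F r) r)"
      using norm_entry_le[of "\<Sum>r\<in>S. monomial (F r) r" "(\<one>, x)" "(inv s, x)"] by simp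
  next
    fix f :: "'x \<Rightarrow> complex" and s assume f: "continuous_on UNIV f" and s: "s \<in> carrier (G\<lparr>carrier := N\<rparr>)"
    then show "star (monomial f s) = monomial (\<lambda>x. cnj (f x)) (inv\<^bsub>G\<lparr>carrier := N\<rparr>\<^esub> s)"
      using m_inv_consistent[OF sub] by (simp add: monomial_star Nc triv)
  qed (use Nc triv' in \<open>simp_all add: monomial_add monomial_scaleC monomial_mult norm_monomial_le\<close>)
qed

lemma fix_interior_imp_commutant_condition:
  assumes "fix_interior_condition G \<phi> N"
  shows "commutant_condition G \<phi> N"
proof -
  have N: "abelian_subgroup N G" using assms by (simp add: fix_interior_condition_def)
  have triv: "\<phi> s x = x" if "s \<in> N" for s x
    using that fix_interior_condition_eq_kernel[OF assms] by (simp add: kernel_of_action_def)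
  let ?H = "G\<lparr>carrier := N\<rparr>"
  have V: "coefficient_rep ?H monomial" using N triv by (rule coefficient_rep_monomial)
  then interpret V: coefficient_rep ?H monomial .
  interpret H: discrete_abelian_group ?H by unfold_locales
  have "cstar_isomorphic (crossed N) (cstar_tensor (continuous_functions :: 'x bop set) (group_cstar ?H))"
    using coefficient_reps_isomorphic[OF V H.coefficient_rep_tensor_monomial[OF compact_UNIV]]
    unfolding crossed_eq H.cstar_tensor_eq[OF compact_UNIV] by simp
  then show ?thesis
    unfolding commutant_condition_def using N triv commutant_eq_crossed[OF assms] by simp
qed

lemma commutant_condition_imp_expectation:
  assumes "commutant_condition G \<phi> N"
  shows "abelian commutant \<and> conditional_expectation (crossed (carrier G)) commutant (expectation N)"
proof -
  have N: "abelian_subgroup N G" and triv: "\<And>s x. s \<in> N \<Longrightarrow> \<phi> s x = x" and eq: "commutant = crossed N"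
    using assms by (auto simp: commutant_condition_def)
  have "subgroup N G" using N by (simp add: abelian_subgroup_def)
  then show ?thesis
    unfolding eq using abelian_crossed[OF N triv] conditional_expectation_expectation by blast
qed

text \<open>Let \<open>h\<close> be the coefficient at \<open>s\<close> of the expectation of the unitary of \<open>s\<close>. It vanishes outside
  the interior \<open>U\<close> of the fixed points of \<open>s\<close>. If \<open>d\<close> is supported in \<open>U\<close>, the product of \<open>d\<close>
  and the unitary is in the commutant and so is fixed by the expectation, whence
  \<open>d h = d\<close>. So \<open>h\<close> is the indicator function of \<open>U\<close>, and \<open>U\<close> is clopen by continuity.\<close>

lemma interior_fixed_points_clopen:
  assumes E: "conditional_expectation (crossed (carrier G)) commutant \<Delta>" and s: "s \<in> carrier G"
  shows "closed (interior {x. \<phi> s x = x})"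
proof -
  define U where "U = interior {x. \<phi> s x = x}"
  let ?w = "monomial (\<lambda>_. 1) s"
  have w: "?w \<in> crossed (carrier G)" using s by (intro monomial_in_crossed) simp_all
  have Ew: "\<Delta> ?w \<in> commutant" using E w by (simp add: conditional_expectation_def)
  then have EwC: "\<Delta> ?w \<in> crossed (carrier G)" by (simp add: relative_commutant_def)
  define h where "h = coef (\<Delta> ?w) s"
  have h0: "h x = 0" if "x \<notin> U" for x
    using coef_supported_interior[OF Ew s, of x] that by (auto simp: U_def h_def)
  have h1: "h x = 1" if x: "x \<in> U" for x
  proof -
    have "closed (- U)" by (simp add: U_def closed_Compl)
    then obtain d :: "'x \<Rightarrow> complex" where d: "continuous_on UNIV d" "d x = 1" "\<And>y. y \<notin> U \<Longrightarrow> d y = 0"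
      using ex_continuous_separating[OF compact_UNIV, of "- U" x] x by auto
    have dw: "monomial d s = crossed_fun G \<phi> d * ?w"
      unfolding crossed_fun_eq_monomial[OF d(1)] using monomial_mult[OF d(1), of "\<lambda>_. 1" \<one> s] s by simp
    have "monomial d s \<in> crossed (carrier G)" using d(1) s by (rule monomial_in_crossed)
    moreover have "\<phi> r y = y" if "r \<in> carrier G" "coef (monomial d s) r y \<noteq> 0" for r y
    proof -
      have "r = s" "d y \<noteq> 0" using that d(1) s by (auto simp: coef_monomial split: if_splits)
      then have "y \<in> U" using d(3) by blast
      then show ?thesis using interior_subset[of "{x. \<phi> s x = x}"] \<open>r = s\<close> by (auto simp: U_def)
    qed
    ultimately have "monomial d s \<in> commutant" using commutant_iff by blast
    then have "\<Delta> (monomial d s) = monomial d s" using E by (simp add: conditional_expectation_def)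
    moreover have "crossed_fun G \<phi> d \<in> commutant"
      using crossed_functions_subset_commutant d(1) by (auto simp: crossed_functions_def)
    then have "\<Delta> (crossed_fun G \<phi> d * ?w) = crossed_fun G \<phi> d * \<Delta> ?w"
      using E w by (simp add: conditional_expectation_def)
    ultimately have "coef (monomial d s) s x = coef (crossed_fun G \<phi> d * \<Delta> ?w) s x"
      by (simp add: dw)
    then show ?thesis
      using d s by (simp add: coef_monomial) (simp add: coef_def entry_crossed_fun_mult act_one h_def)
  qed
  have "U = h -` {1}" using h0 h1 by (auto simp: vimage_def) (metis zero_neq_one)
  moreover have "closed (h -` {1})"
    using continuous_coef[OF EwC s] unfolding h_def by (intro closed_vimage) auto
  ultimately show ?thesis by (simp add: U_def)
qed

text \<open>By connectedness the interior of the fixed points of \<open>s\<close> is empty or everything, and the latter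
  means that \<open>s\<close> acts trivially. The unitaries of the elements which act trivially lie in the relative
  commutant; they commute with each other, and so do the group elements.\<close>

lemma expectation_imp_fix_interior_condition:
  assumes conn: "connected (UNIV :: 'x set)" and ab: "abelian commutant"
    and E: "conditional_expectation (crossed (carrier G)) commutant \<Delta>"
  shows "fix_interior_condition G \<phi> kernel_of_action"
  unfolding fix_interior_condition_def abelian_subgroup_def
proof (intro conjI ballI subgroup_kernel)
  fix s assume s: "s \<in> carrier G"
  let ?U = "interior {x. \<phi> s x = x}"
  have "?U = {} \<or> ?U = UNIV"
    using conn interior_fixed_points_clopen[OF E s] open_interior[of "{x. \<phi> s x = x}"]
    by (auto simp: connected_clopen closedin_closed_eq)
  moreover have "?U = UNIV \<longleftrightarrow> s \<in> kernel_of_action"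
  proof
    assume "?U = UNIV"
    then show "s \<in> kernel_of_action"
      using s interior_subset[of "{x. \<phi> s x = x}"] unfolding kernel_of_action_def by blast
  next
    assume "s \<in> kernel_of_action"
    then show "?U = UNIV" by (simp add: kernel_of_action_def)
  qed
  ultimately show "?U = (if s \<in> kernel_of_action then UNIV else {})" by auto
next
  fix s t assume st: "s \<in> kernel_of_action" "t \<in> kernel_of_action"
  have c: "s \<in> carrier G" "t \<in> carrier G" using st by (auto simp: kernel_of_action_def)
  have "monomial (\<lambda>_. 1) r \<in> commutant" if "r \<in> kernel_of_action" for r
  proof -
    have r: "r \<in> carrier G" using that by (simp add: kernel_of_action_def)
    then have "monomial (\<lambda>_. 1) r \<in> crossed (carrier G)" by (intro monomial_in_crossed) simp_all
    then show ?thesis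
      using that r commutant_iff by (auto simp: coef_monomial kernel_of_action_def)
  qed
  then have "monomial (\<lambda>_. 1) s * monomial (\<lambda>_. 1) t = monomial (\<lambda>_. 1) t * monomial (\<lambda>_. 1) s"
    using ab st unfolding abelian_def by blast
  then have "monomial (\<lambda>_. 1) (s \<otimes> t) = monomial (\<lambda>_. 1) (t \<otimes> s)"
    using c by (simp add: monomial_mult)
  then have "coef (monomial (\<lambda>_. 1) (s \<otimes> t)) (s \<otimes> t) x = coef (monomial (\<lambda>_. 1) (t \<otimes> s)) (s \<otimes> t) x" for x
    by simp
  then show "s \<otimes> t = t \<otimes> s"
    using c by (simp add: coef_monomial split: if_splits)
qed

lemma equivalences:
  assumes conn: "connected (UNIV :: 'x set)"
  shows "(cartan_inclusion (crossed (carrier G)) commutant \<longleftrightarrow> (\<exists>N. fix_interior_condition G \<phi> N)) \<and>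
    ((\<exists>N. fix_interior_condition G \<phi> N) \<longleftrightarrow> (\<exists>N. commutant_condition G \<phi> N)) \<and>
    ((\<exists>N. commutant_condition G \<phi> N) \<longleftrightarrow>
      abelian commutant \<and> (\<exists>\<Delta>. conditional_expectation (crossed (carrier G)) commutant \<Delta>))"
proof -
  have ad: "abelian commutant \<and> (\<exists>\<Delta>. conditional_expectation (crossed (carrier G)) commutant \<Delta>)"
    if "cartan_inclusion (crossed (carrier G)) commutant"
    using that unfolding cartan_inclusion_def maximal_abelian_def by blast
  have db: "\<exists>N. fix_interior_condition G \<phi> N"
    if "abelian commutant \<and> (\<exists>\<Delta>. conditional_expectation (crossed (carrier G)) commutant \<Delta>)"
    using that expectation_imp_fix_interior_condition[OF conn] by blast
  have bc: "\<exists>N. commutant_condition G \<phi> N" if "\<exists>N. fix_interior_condition G \<phi> N"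
    using that fix_interior_imp_commutant_condition by blast
  have ca: "cartan_inclusion (crossed (carrier G)) commutant" if c: "\<exists>N. commutant_condition G \<phi> N"
  proof -
    obtain N where "commutant_condition G \<phi> N" using c by blast
    from commutant_condition_imp_expectation[OF this] show ?thesis
      unfolding cartan_inclusion_def
      using regular_inclusion_commutant maximal_abelian_commutant faithful_expectation by blast
  qed
  show ?thesis using ad db bc ca by argo
qed

end

theorem theorem5p14:
  fixes G :: "'g monoid" and \<phi> :: "'g \<Rightarrow> 'x::t2_space \<Rightarrow> 'x"
    and C D Dc :: "('g \<times> 'x) bop set"
  assumes "compact (UNIV :: 'x set)" and "connected (UNIV :: 'x set)"
    and "group G" and "group_action G UNIV \<phi>"
    and "\<And>s. s \<in> carrier G \<Longrightarrow> homeomorphism UNIV UNIV (\<phi> s) (\<phi> (inv\<^bsub>G\<^esub> s))"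
    and "C = reduced_crossed_product G \<phi> (carrier G)"
    and "D = crossed_functions G \<phi>"
    and "Dc = relative_commutant C D"
  shows "(cartan_inclusion C Dc \<longleftrightarrow> (\<exists>N. fix_interior_condition G \<phi> N)) \<and>
    ((\<exists>N. fix_interior_condition G \<phi> N) \<longleftrightarrow> (\<exists>N. commutant_condition G \<phi> N)) \<and>
    ((\<exists>N. commutant_condition G \<phi> N) \<longleftrightarrow>
      abelian Dc \<and> (\<exists>\<Delta>. conditional_expectation C Dc \<Delta>)) \<and>
    (\<forall>N. fix_interior_condition G \<phi> N \<or> commutant_condition G \<phi> N \<longrightarrow> N \<lhd> G)"
proof -
  interpret group G by (rule assms(3))
  interpret A: group_action G UNIV \<phi> by (rule assms(4))
  interpret compact_dynamics G \<phi>
  proof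
    show "compact (UNIV :: 'x set)" by (rule assms(1))
    show "\<phi> (s \<otimes>\<^bsub>G\<^esub> t) x = \<phi> s (\<phi> t x)" if "s \<in> carrier G" "t \<in> carrier G" for s t x
      using A.composition_rule[of x s t] that by simp
    show "\<phi> \<one>\<^bsub>G\<^esub> x = x" for x
      using A.id_eq_one by (metis UNIV_I restrict_apply)
    show "continuous_on UNIV (\<phi> s)" if "s \<in> carrier G" for s
      using assms(5)[OF that] by (simp add: homeomorphism_def)
  qed
  have "N \<lhd> G" if "fix_interior_condition G \<phi> N \<or> commutant_condition G \<phi> N" for N
    using that fix_interior_condition_eq_kernel commutant_condition_eq_kernel normal_kernel by metis
  with equivalences[OF assms(2)] show ?thesis
    unfolding assms(6-8) by blast
qed

end
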